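(* Let $T>0$, $\alpha\in[0,1)$ and $m_0\in PM^0$. Let $H_1,H_2$ be given by $H_i(v,m)=g_i(v)\int_{\mathbb T^d}f_i(v)\,m\,dx$ with $f_1,f_2,g_1,g_2$ satisfying the Hamiltonian assumption (see context), with constants $c_h,\tilde c_h>0$ and exponents $p_h,\tilde p_h\ge 0$ for $h\in\{f_1,f_2,g_1,g_2\}$. Let $G$ satisfy the payoff assumption (see context), with constants $c_G,\tilde c_G>0$ and functions $\Psi_1,\Psi_2$. (a) Suppose that all of the following hold: $$p_{f_1}+p_{g_1}>1,\quad p_{f_2}+p_{g_2}>1,\quad p_{f_1}+\tilde p_{g_1}>0,\quad \tilde p_{f_1}+p_{g_1}>0,\quad p_{f_2}+\tilde p_{g_2}>0,\quad \tilde p_{f_2}+p_{g_2}>0.$$ Then there exists $\varepsilon>0$ (which may depend on $d,T,\alpha,m_0,\Psi_1,\Psi_2$ and on $f_i,g_i$ and their constants and exponents, but not on $G$, $c_G$, $\tilde c_G$) such that if $c_G+\tilde c_G<\varepsilon$, then there exists a mild solution $(v,m)\in(\mathcal B_{\alpha T})^d\times\mathcal{PM}^\alpha$ of the system $$v_t+\nabla(H_1(v,m))=-\Delta v,\qquad m_t+\mathrm{div}(mH_2(v,m))=\Delta m,$$ with data $m(\cdot,0)=m_0$ and $v(\cdot,T)=\nabla G(m(\cdot,T),\cdot)$, and this mild solution is unique in a ball in $(\mathcal B_{\alpha T})^d\times\mathcal{PM}^\alpha$. (b) (Without the conditions on the exponents in (a).) There exists $\varepsilon>0$ (which may depend on $d,T,\alpha,m_0$,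 on $G$ and its constants and functions $c_G,\tilde c_G,\Psi_1,\Psi_2$, and on the exponents $p_h,\tilde p_h$, but not on $f_i,g_i$ or the constants $c_h,\tilde c_h$) such that if $$c_{f_1}c_{g_1}+c_{f_2}c_{g_2}+\tilde c_{f_1}c_{g_1}+c_{f_1}\tilde c_{g_1}+c_{f_2}\tilde c_{g_2}+\tilde c_{f_2}c_{g_2}<\varepsilon,$$ then there exists a mild solution $(v,m)\in(\mathcal B_{\alpha T})^d\times\mathcal{PM}^\alpha$ of the same system with the same data, and this mild solution is unique in a ball in $(\mathcal B_{\alpha T})^d\times\mathcal{PM}^\alpha$.
   Context: Setting: $\mathbb T^d$ is $[0,2\pi]^d$ with periodic boundary conditions. Functions and distributions on $\mathbb T^d$ are real-valued and written as $f(x)=\sum_{k\in\mathbb Z^d}f_ke^{ik\cdot x}$; if $f$ depends also on $t\in[0,T]$ then $f_k=f_k(t)$, assumed measurable in $t$. $|k|$ is the Euclidean norm. For $\beta\ge0$, $\alpha\ge 0$, define spaces by finiteness of the norms $$\|f\|_{PM^\beta}=\sup_{k}e^{\beta|k|}|f_k|,\qquad \|f\|_{\mathcal{PM}^\alpha}=\sup_k\sup_{t\in[0,T]}e^{\alpha t|k|}|f_k(t)|,$$ $$\|f\|_{B_\beta}=\sum_k e^{\beta|k|}|f_k|,\qquad \|f\|_{\mathcal B_\beta}=\sum_k\sup_{t\in[0,T]}e^{\beta|k|}|f_k(t)|,\qquad \|f\|_{B_{1,\beta}}=\sum_k(1+|k|)e^{\beta|k|}|f_k|.$$ Elements of $PM^\beta$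 and $\mathcal{PM}^\alpha$ are identified with their Fourier coefficients. The norm on $(\mathcal B_\beta)^d$ (and $(B_\beta)^d$) is the sum of the norms of the components, and the norm on a product of two spaces is the sum of the two norms. Products of a function and a pseudomeasure are defined by convolution of Fourier coefficients. The integral is normalized: at each time, $\int_{\mathbb T^d}f\,m\,dx=\sum_{k}f_k m_{-k}$. Hamiltonians: $f_1,f_2,g_1$ are scalar-valued and $g_2$ is $\mathbb R^d$-valued functions of $v\in\mathbb R^d$, acting on functions by composition; $H_i(v,m)=g_i(v)\int_{\mathbb T^d}f_i(v)\,m\,dx$ (the integral is a function of $t$ only), so $H_1$ is scalar-valued and $H_2$ is $\mathbb R^d$-valued. Hamiltonian assumption: for any $T>0$ and any $\alpha\in[0,1)$, $f_1,f_2,g_1$ map $(\mathcal B_{\alpha T})^d$ to $\mathcal B_{\alpha T}$ and $g_2$ maps $(\mathcal B_{\alpha T})^d$ to $(\mathcal B_{\alpha T})^d$. For all $h\in\{f_1,f_2,g_1,g_2\}$ there exist $c_h>0$, $p_h\ge0$, $\tilde c_h>0$, $\tilde p_h\ge0$ such that for all $v,v_1,v_2\in(\mathcal B_{\alpha T})^d$, $$\|h(v)\|\le c_h\|v\|_{(\mathcal B_{\alpha T})^d}^{p_h},\qquad \|h(v_1)-h(v_2)\|\le\tilde c_h\|v_1-v_2\|_{(\mathcal B_{\alpha T})^d}\left(\|v_1\|_{(\mathcal B_{\alpha T})^d}^{\tilde p_h}+\|v_2\|_{(\mathcal B_{\alpha T})^d}^{\tilde p_h}\right),$$ the norms on the left-hand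 sides being those of $\mathcal B_{\alpha T}$ or $(\mathcal B_{\alpha T})^d$ as appropriate. Payoff assumption: for each $m\in PM^{\alpha T}$, $G(m,\cdot)\in B_{1,\alpha T}$. There exist non-decreasing continuous functions $\Psi_1,\Psi_2:\mathbb R_+\to\mathbb R_+$ and constants $c_G>0,\tilde c_G>0$ such that for all $m,m_1,m_2\in PM^{\alpha T}$, $$\|G(m,\cdot)\|_{B_{1,\alpha T}}\le c_G\|m\|_{PM^{\alpha T}}\Psi_1(\|m\|_{PM^{\alpha T}}),$$ $$\|G(m_1,\cdot)-G(m_2,\cdot)\|_{B_{1,\alpha T}}\le\tilde c_G\|m_1-m_2\|_{PM^{\alpha T}}\Psi_2(\|m_1\|_{PM^{\alpha T}}+\|m_2\|_{PM^{\alpha T}}).$$ Mild solution: $e^{\Delta t}$ is the heat semigroup, multiplying the $k$-th Fourier coefficient by $e^{-|k|^2t}$. A mild solution is a pair $(v,m)\in(\mathcal B_{\alpha T})^d\times\mathcal{PM}^\alpha$ such that for all $t\in[0,T]$ (integrals understood coefficientwise) $$m(\cdot,t)=e^{\Delta t}m_0-\int_0^te^{\Delta(t-s)}\mathrm{div}\big(mH_2(v,m)\big)(\cdot,s)\,ds,$$ $$v(\cdot,t)=e^{\Delta(T-t)}\nabla G(m(\cdot,T),\cdot)+\int_t^Te^{\Delta(s-t)}\nabla\big(H_1(v,m)\big)(\cdot,s)\,ds.$$ *)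

theory Defs
  imports "HOL-Analysis.Analysis"
begin

section \<open>Fourier coefficients on the torus\<close>

text \<open>
  A function or pseudomeasure on the torus is represented by its family of Fourier coefficients,
  indexed by \<open>int ^ 'd\<close>; the dimension is \<open>CARD('d)\<close>. A time-dependent one is a map from times to
  such families, of which only the values at times in \<open>{0..T}\<close> are relevant.
\<close>

type_synonym 'd coeffs = "(int, 'd) vec \<Rightarrow> complex"
type_synonym 'd tcoeffs = "real \<Rightarrow> (int, 'd) vec \<Rightarrow> complex"

definition wv :: "int ^ 'd \<Rightarrow> real ^ 'd" where
  "wv k = (\<chi> j. real_of_int (k $ j))"

text \<open>The Fourier coefficients of real-valued functions and distributions.\<close>

definition real_coeffs :: "('d::finite) coeffs \<Rightarrow> bool" where
  "real_coeffs a \<longleftrightarrow> (\<forall>k. a (- k) = cnj (a k))"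

definition torus :: "(real ^ 'd) set" where
  "torus = cbox 0 (\<chi> j. 2 * pi)"

definition fourier_coeff :: "(real ^ 'd \<Rightarrow> real) \<Rightarrow> ('d::finite) coeffs" where
  "fourier_coeff u k =
     integral torus (\<lambda>x. complex_of_real (u x) * cis (- (wv k \<bullet> x)))
       / complex_of_real ((2 * pi) ^ CARD('d))"

text \<open>The real part only serves to land in the reals: the series is real if \<open>real_coeffs a\<close>.\<close>

definition fourier_series :: "('d::finite) coeffs \<Rightarrow> real ^ 'd \<Rightarrow> real" where
  "fourier_series a x = Re (\<Sum>\<^sub>\<infinity>k. a k * cis (wv k \<bullet> x))"


section \<open>Function spaces\<close>

definition PM :: "real \<Rightarrow> ('d::finite) coeffs set" where
  "PM \<beta> = {a. real_coeffs a \<and> bdd_above (range (\<lambda>k. exp (\<beta> * norm (wv k)) * cmod (a k)))}"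

definition PM_norm :: "real \<Rightarrow> ('d::finite) coeffs \<Rightarrow> real" where
  "PM_norm \<beta> a = (SUP k. exp (\<beta> * norm (wv k)) * cmod (a k))"

definition B1 :: "real \<Rightarrow> ('d::finite) coeffs set" where
  "B1 \<beta> = {a. real_coeffs a \<and>
     (\<lambda>k. (1 + norm (wv k)) * exp (\<beta> * norm (wv k)) * cmod (a k)) summable_on UNIV}"

definition B1_norm :: "real \<Rightarrow> ('d::finite) coeffs \<Rightarrow> real" where
  "B1_norm \<beta> a = (\<Sum>\<^sub>\<infinity>k. (1 + norm (wv k)) * exp (\<beta> * norm (wv k)) * cmod (a k))"

definition admissible :: "real \<Rightarrow> ('d::finite) tcoeffs \<Rightarrow> bool" where
  "admissible T f \<longleftrightarrow> (\<forall>t\<in>{0..T}. real_coeffs (f t)) \<and>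
     (\<forall>k. (\<lambda>t. f t k) \<in> borel_measurable (lebesgue_on {0..T}))"

definition calPM :: "real \<Rightarrow> real \<Rightarrow> ('d::finite) tcoeffs set" where
  "calPM T \<alpha> = {f. admissible T f \<and>
     bdd_above ((\<lambda>(k, t). exp (\<alpha> * t * norm (wv k)) * cmod (f t k)) ` (UNIV \<times> {0..T}))}"

definition calPM_norm :: "real \<Rightarrow> real \<Rightarrow> ('d::finite) tcoeffs \<Rightarrow> real" where
  "calPM_norm T \<alpha> f =
     (SUP (k, t) \<in> UNIV \<times> {0..T}. exp (\<alpha> * t * norm (wv k)) * cmod (f t k))"

definition calB :: "real \<Rightarrow> real \<Rightarrow> ('d::finite) tcoeffs set" where
  "calB T \<beta> = {f. admissible T f \<and>
     (\<forall>k. bdd_above ((\<lambda>t. exp (\<beta> * norm (wv k)) * cmod (f t k)) ` {0..T})) \<and>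
     (\<lambda>k. SUP t\<in>{0..T}. exp (\<beta> * norm (wv k)) * cmod (f t k)) summable_on UNIV}"

definition calB_norm :: "real \<Rightarrow> real \<Rightarrow> ('d::finite) tcoeffs \<Rightarrow> real" where
  "calB_norm T \<beta> f = (\<Sum>\<^sub>\<infinity>k. SUP t\<in>{0..T}. exp (\<beta> * norm (wv k)) * cmod (f t k))"

definition calBv :: "real \<Rightarrow> real \<Rightarrow> (('d::finite) tcoeffs ^ 'd) set" where
  "calBv T \<beta> = {v. \<forall>i. v $ i \<in> calB T \<beta>}"

definition calBv_norm :: "real \<Rightarrow> real \<Rightarrow> ('d::finite) tcoeffs ^ 'd \<Rightarrow> real" where
  "calBv_norm T \<beta> v = (\<Sum>i\<in>UNIV. calB_norm T \<beta> (v $ i))"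


section \<open>The Hamiltonians\<close>

definition value_at :: "('d::finite) tcoeffs ^ 'd \<Rightarrow> real \<Rightarrow> real ^ 'd \<Rightarrow> real ^ 'd" where
  "value_at v t x = (\<chi> i. fourier_series ((v $ i) t) x)"

definition compose :: "(real ^ 'd \<Rightarrow> real) \<Rightarrow> ('d::finite) tcoeffs ^ 'd \<Rightarrow> 'd tcoeffs" where
  "compose h v t = fourier_coeff (\<lambda>x. h (value_at v t x))"

definition compose_vec ::
    "(real ^ 'd \<Rightarrow> real ^ 'd) \<Rightarrow> ('d::finite) tcoeffs ^ 'd \<Rightarrow> 'd tcoeffs ^ 'd" where
  "compose_vec h v = (\<chi> i. compose (\<lambda>y. h y $ i) v)"

text \<open>
  The function \<open>h \<circ> v\<close> lies in the space: it is a genuine integrable function at each time (so that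
  its Fourier coefficients are meaningful) whose coefficients have finite norm.
\<close>

definition compose_in ::
    "real \<Rightarrow> real \<Rightarrow> (real ^ 'd \<Rightarrow> real) \<Rightarrow> ('d::finite) tcoeffs ^ 'd \<Rightarrow> bool" where
  "compose_in T \<beta> h v \<longleftrightarrow>
     (\<forall>t\<in>{0..T}. (\<lambda>x. h (value_at v t x)) absolutely_integrable_on torus) \<and>
     compose h v \<in> calB T \<beta>"

text \<open>Real powers with the convention \<open>x\<^sup>0 = 1\<close> also for \<open>x = 0\<close> (whereas \<open>0 powr 0 = 0\<close>).\<close>

definition rpow :: "real \<Rightarrow> real \<Rightarrow> real" where
  "rpow x p = (if p = 0 then 1 else x powr p)"

definition ham_bounds :: "real \<Rightarrow> real \<Rightarrow> (real ^ 'd \<Rightarrow> real) \<Rightarrow>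
    real \<Rightarrow> real \<Rightarrow> real \<Rightarrow> real \<Rightarrow> bool" where
  "ham_bounds T \<beta> h c p c' p' \<longleftrightarrow>
     c > 0 \<and> p \<ge> 0 \<and> c' > 0 \<and> p' \<ge> 0 \<and>
     (\<forall>v\<in>calBv T \<beta>. compose_in T \<beta> h v) \<and>
     (\<forall>v\<in>calBv T \<beta>. calB_norm T \<beta> (compose h v) \<le> c * rpow (calBv_norm T \<beta> v) p) \<and>
     (\<forall>v1\<in>calBv T \<beta>. \<forall>v2\<in>calBv T \<beta>.
        calB_norm T \<beta> (compose h v1 - compose h v2) \<le>
          c' * calBv_norm T \<beta> (v1 - v2) *
            (rpow (calBv_norm T \<beta> v1) p' + rpow (calBv_norm T \<beta> v2) p'))"

definition ham_bounds_vec :: "real \<Rightarrow> real \<Rightarrow> (real ^ 'd \<Rightarrow> real ^ 'd) \<Rightarrow>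
    real \<Rightarrow> real \<Rightarrow> real \<Rightarrow> real \<Rightarrow> bool" where
  "ham_bounds_vec T \<beta> h c p c' p' \<longleftrightarrow>
     c > 0 \<and> p \<ge> 0 \<and> c' > 0 \<and> p' \<ge> 0 \<and>
     (\<forall>v\<in>calBv T \<beta>. \<forall>i. compose_in T \<beta> (\<lambda>y. h y $ i) v) \<and>
     (\<forall>v\<in>calBv T \<beta>. calBv_norm T \<beta> (compose_vec h v) \<le> c * rpow (calBv_norm T \<beta> v) p) \<and>
     (\<forall>v1\<in>calBv T \<beta>. \<forall>v2\<in>calBv T \<beta>.
        calBv_norm T \<beta> (compose_vec h v1 - compose_vec h v2) \<le>
          c' * calBv_norm T \<beta> (v1 - v2) *
            (rpow (calBv_norm T \<beta> v1) p' + rpow (calBv_norm T \<beta> v2) p'))"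

text \<open>
  Constants and exponents exist for all times \<open>T'\<close> and all \<open>\<alpha>'\<close>, on which they may depend;
  the named ones are those for the given \<open>T\<close> and \<open>\<alpha>\<close>.
\<close>

definition ham_assumption :: "real \<Rightarrow> real \<Rightarrow> (real ^ 'd \<Rightarrow> real) \<Rightarrow>
    real \<Rightarrow> real \<Rightarrow> real \<Rightarrow> real \<Rightarrow> bool" where
  "ham_assumption T \<alpha> h c p c' p' \<longleftrightarrow>
     (\<forall>T'>0. \<forall>\<alpha>'\<in>{0..<1}. \<exists>a q a' q'. ham_bounds T' (\<alpha>' * T') h a q a' q') \<and>
     ham_bounds T (\<alpha> * T) h c p c' p'"

definition ham_assumption_vec :: "real \<Rightarrow> real \<Rightarrow> (real ^ 'd \<Rightarrow> real ^ 'd) \<Rightarrow>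
    real \<Rightarrow> real \<Rightarrow> real \<Rightarrow> real \<Rightarrow> bool" where
  "ham_assumption_vec T \<alpha> h c p c' p' \<longleftrightarrow>
     (\<forall>T'>0. \<forall>\<alpha>'\<in>{0..<1}. \<exists>a q a' q'. ham_bounds_vec T' (\<alpha>' * T') h a q a' q') \<and>
     ham_bounds_vec T (\<alpha> * T) h c p c' p'"

text \<open>The normalized integral over the torus of the product of two functions.\<close>

definition pairing :: "('d::finite) coeffs \<Rightarrow> 'd coeffs \<Rightarrow> complex" where
  "pairing a b = (\<Sum>\<^sub>\<infinity>k. a k * b (- k))"

definition Ham :: "(real ^ 'd \<Rightarrow> real) \<Rightarrow> (real ^ 'd \<Rightarrow> real) \<Rightarrow>
    ('d::finite) tcoeffs ^ 'd \<Rightarrow> 'd tcoeffs \<Rightarrow> 'd tcoeffs" where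
  "Ham f g v m t k = compose g v t k * pairing (compose f v t) (m t)"

definition Ham_vec :: "(real ^ 'd \<Rightarrow> real) \<Rightarrow> (real ^ 'd \<Rightarrow> real ^ 'd) \<Rightarrow>
    ('d::finite) tcoeffs ^ 'd \<Rightarrow> 'd tcoeffs \<Rightarrow> 'd tcoeffs ^ 'd" where
  "Ham_vec f g v m = (\<chi> i. (\<lambda>t k. (compose_vec g v $ i) t k * pairing (compose f v t) (m t)))"


section \<open>The payoff\<close>

definition payoff_assumption :: "real \<Rightarrow> real \<Rightarrow> (('d::finite) coeffs \<Rightarrow> 'd coeffs) \<Rightarrow>
    real \<Rightarrow> real \<Rightarrow> (real \<Rightarrow> real) \<Rightarrow> (real \<Rightarrow> real) \<Rightarrow> bool" where
  "payoff_assumption T \<alpha> G c c' \<Psi>1 \<Psi>2 \<longleftrightarrow>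
     c > 0 \<and> c' > 0 \<and>
     (\<forall>\<Psi>\<in>{\<Psi>1, \<Psi>2}. mono_on {0..} \<Psi> \<and> continuous_on {0..} \<Psi> \<and> \<Psi> ` {0..} \<subseteq> {0..}) \<and>
     (\<forall>m\<in>PM (\<alpha> * T). G m \<in> B1 (\<alpha> * T)) \<and>
     (\<forall>m\<in>PM (\<alpha> * T).
        B1_norm (\<alpha> * T) (G m) \<le> c * PM_norm (\<alpha> * T) m * \<Psi>1 (PM_norm (\<alpha> * T) m)) \<and>
     (\<forall>m1\<in>PM (\<alpha> * T). \<forall>m2\<in>PM (\<alpha> * T).
        B1_norm (\<alpha> * T) (G m1 - G m2) \<le>
          c' * PM_norm (\<alpha> * T) (m1 - m2) * \<Psi>2 (PM_norm (\<alpha> * T) m1 + PM_norm (\<alpha> * T) m2))"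


section \<open>Mild solutions\<close>

definition heat :: "real \<Rightarrow> ('d::finite) coeffs \<Rightarrow> 'd coeffs" where
  "heat t a k = complex_of_real (exp (- (norm (wv k))\<^sup>2 * t)) * a k"

definition grad :: "('d::finite) coeffs \<Rightarrow> 'd coeffs ^ 'd" where
  "grad a = (\<chi> j. (\<lambda>k. \<i> * of_int (k $ j) * a k))"

definition dvg :: "('d::finite) coeffs ^ 'd \<Rightarrow> 'd coeffs" where
  "dvg u k = (\<Sum>j\<in>UNIV. \<i> * of_int (k $ j) * (u $ j) k)"

text \<open>The Fourier coefficients of a product.\<close>

definition conv :: "('d::finite) coeffs \<Rightarrow> 'd coeffs \<Rightarrow> 'd coeffs" where
  "conv a b k = (\<Sum>\<^sub>\<infinity>j. a j * b (k - j))"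

definition mild_solution ::
    "real \<Rightarrow> real \<Rightarrow> ('d::finite) coeffs \<Rightarrow> (real ^ 'd \<Rightarrow> real) \<Rightarrow> (real ^ 'd \<Rightarrow> real) \<Rightarrow>
     (real ^ 'd \<Rightarrow> real) \<Rightarrow> (real ^ 'd \<Rightarrow> real ^ 'd) \<Rightarrow> ('d coeffs \<Rightarrow> 'd coeffs) \<Rightarrow>
     'd tcoeffs ^ 'd \<Rightarrow> 'd tcoeffs \<Rightarrow> bool" where
  "mild_solution T \<alpha> m0 f1 f2 g1 g2 G v m \<longleftrightarrow>
     v \<in> calBv T (\<alpha> * T) \<and> m \<in> calPM T \<alpha> \<and>
     (\<forall>t\<in>{0..T}. \<forall>k.
        m t k = heat t m0 k -
          integral {0..t}
            (\<lambda>s. heat (t - s) (dvg (\<chi> i. conv (m s) ((Ham_vec f2 g2 v m $ i) s))) k)) \<and>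
     (\<forall>t\<in>{0..T}. \<forall>k. \<forall>i.
        (v $ i) t k = heat (T - t) (grad (G (m T)) $ i) k +
          integral {t..T} (\<lambda>s. heat (s - t) (grad (Ham f1 g1 v m s) $ i) k))"

text \<open>
  There is a ball in the product space which contains a mild solution, and only one, where
  solutions are identified if they agree on the time interval.
\<close>

definition solvable_uniquely_in_ball ::
    "real \<Rightarrow> real \<Rightarrow> ('d::finite) coeffs \<Rightarrow> (real ^ 'd \<Rightarrow> real) \<Rightarrow> (real ^ 'd \<Rightarrow> real) \<Rightarrow>
     (real ^ 'd \<Rightarrow> real) \<Rightarrow> (real ^ 'd \<Rightarrow> real ^ 'd) \<Rightarrow> ('d coeffs \<Rightarrow> 'd coeffs) \<Rightarrow> bool" where
  "solvable_uniquely_in_ball T \<alpha> m0 f1 f2 g1 g2 G \<longleftrightarrow>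
     (\<exists>vc\<in>calBv T (\<alpha> * T). \<exists>mc\<in>calPM T \<alpha>. \<exists>R>0. \<exists>v m.
        mild_solution T \<alpha> m0 f1 f2 g1 g2 G v m \<and>
        calBv_norm T (\<alpha> * T) (v - vc) + calPM_norm T \<alpha> (m - mc) < R \<and>
        (\<forall>v' m'. mild_solution T \<alpha> m0 f1 f2 g1 g2 G v' m' \<and>
           calBv_norm T (\<alpha> * T) (v' - vc) + calPM_norm T \<alpha> (m' - mc) < R \<longrightarrow>
           (\<forall>t\<in>{0..T}. m' t = m t \<and> (\<forall>i. (v' $ i) t = (v $ i) t))))"

end

theory Submission
  imports Defs
begin

text \<open>
  A mild solution is a fixed point of the map \<open>\<Phi>\<close> that sends \<open>(v, m)\<close> to the right-hand sides of the
  two Duhamel formulas, and the proof is a contraction argument for \<open>\<Phi>\<close> on a region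
  \<open>\<parallel>v\<parallel> \<le> r, \<parallel>m\<parallel> \<le> M\<close> with \<open>M = \<parallel>m0\<parallel> + 1\<close>.

  The spaces are chosen so that every term of \<open>\<Phi>\<close> is bounded. The exponential weights are
  submultiplicative under convolution, so the product of a pseudomeasure in \<open>calPM\<close> with a function
  in \<open>calB\<close> is again in \<open>calPM\<close>, and pairing the two gives a bounded function of time
  (\<open>conv_calPM\<close>, \<open>nonlocal_product\<close>). The derivative in each Duhamel term costs a factor \<open>|k|\<close>,
  and the heat kernel returns more than that: its time integral is at most \<open>1 / |k|\<^sup>2\<close>, or
  \<open>1 / (|k|\<^sup>2 - \<alpha> |k|)\<close> when the weight growing in time has to be absorbed, and \<open>|k| \<ge> 1\<close>
  for nonzero frequencies (\<open>forward_bound\<close>, \<open>backward_bound\<close>).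

  Write \<open>A\<close> for the size of \<open>g (v)\<close> times that of \<open>f (v)\<close> on the region, and \<open>L\<close> for the Lipschitz
  constant of this product. The Duhamel terms of \<open>\<Phi>\<close> and their Lipschitz constants are then
  multiples of \<open>A\<close> and \<open>L\<close>. The payoff acts only on the \<open>v\<close>-component, on which it has
  Lipschitz constant proportional to some \<open>\<Lambda>\<close> with respect to \<open>m\<close>. In part (b) this \<open>\<Lambda>\<close> is not
  small, so \<open>\<Phi>\<close> need not contract the sum of the two norms. It does contract
  \<open>\<parallel>v\<parallel> + K \<parallel>m\<parallel>\<close> for a weight \<open>K\<close> large compared with \<open>\<Lambda>\<close>, because all the dependence of the
  \<open>m\<close>-component on \<open>(v, m)\<close> carries a factor \<open>A\<close> or \<open>L\<close> (\<open>dist_K_contraction\<close>).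

  For part (b), \<open>r\<close> is chosen from the payoff, and small Hamiltonian constants then make \<open>A\<close> and
  \<open>L\<close> as small as required. For part (a), \<open>A\<close> and \<open>L\<close> are made small by decreasing \<open>r\<close>, as they
  are sums of positive powers of \<open>r\<close>. The \<open>v\<close>-component has to land in the shrinking ball
  \<open>\<parallel>v\<parallel> \<le> r\<close>, for which \<open>A\<close> must be \<open>o(r)\<close>; this is where the sum of the exponents of \<open>f1\<close> and
  \<open>g1\<close> has to exceed \<open>1\<close>. Once \<open>r\<close> is fixed, the payoff constants are taken small compared with it.

  Finally, \<open>\<Phi>\<close> maps the region into the smaller one \<open>\<parallel>v\<parallel> \<le> r / 2, \<parallel>m\<parallel> \<le> M - 1 / 2\<close>. The fixed
  point therefore has a whole ball around it inside the region, and uniqueness in the region gives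
  uniqueness in that ball (\<open>solvable\<close>).
\<close>



section \<open>Frequencies and real-valuedness\<close>

lemma wv_uminus: "wv (- k) = - wv k"
  by (simp add: wv_def vec_eq_iff)

lemma wv_diff: "wv (k - j) = wv k - wv j"
  by (simp add: wv_def vec_eq_iff)

lemma norm_wv_triangle:
  fixes k j :: "int ^ 'd::finite"
  shows "norm (wv k) \<le> norm (wv j) + norm (wv (k - j))"
  by (metis wv_diff add.commute norm_triangle_sub)

lemma component_le_norm_wv: "\<bar>real_of_int (k $ j)\<bar> \<le> norm (wv (k :: int ^ 'd::finite))"
  using component_le_norm_cart[of "wv k" j] by (simp add: wv_def)

lemma norm_wv_ge_1:
  fixes k :: "int ^ 'd::finite"
  assumes "k \<noteq> 0"
  shows "norm (wv k) \<ge> 1"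
proof -
  obtain j where "k $ j \<noteq> 0"
    using assms by (auto simp: vec_eq_iff)
  then have "\<bar>real_of_int (k $ j)\<bar> \<ge> 1"
    by linarith
  then show ?thesis
    using component_le_norm_wv[of k j] by linarith
qed

lemma real_coeffs_diff: "real_coeffs a \<Longrightarrow> real_coeffs b \<Longrightarrow> real_coeffs (a - b)"
  by (simp add: real_coeffs_def)

lemma admissible_diff: "admissible T f \<Longrightarrow> admissible T g \<Longrightarrow> admissible T (f - g)"
  by (auto simp: admissible_def real_coeffs_diff intro: borel_measurable_diff)

lemma admissible_add: "admissible T f \<Longrightarrow> admissible T g \<Longrightarrow> admissible T (\<lambda>t k. f t k + g t k)"
  by (auto simp: admissible_def real_coeffs_def intro: borel_measurable_add)

lemma admissible_limit:
  assumes adm: "\<And>n. admissible T (f n)"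
    and cau: "\<And>t k. t \<in> {0..T} \<Longrightarrow> Cauchy (\<lambda>n. f n t k)"
  obtains g where "admissible T g" "\<And>t k. t \<in> {0..T} \<Longrightarrow> (\<lambda>n. f n t k) \<longlonglongrightarrow> g t k"
proof
  define g where "g t k = lim (\<lambda>n. f n t k)" for t k
  show lim: "(\<lambda>n. f n t k) \<longlonglongrightarrow> g t k" if "t \<in> {0..T}" for t k
    unfolding g_def using cau[OF that] by (simp add: Cauchy_convergent_iff convergent_LIMSEQ_iff)
  have "g t (- k) = cnj (g t k)" if t: "t \<in> {0..T}" for t k
  proof (rule LIMSEQ_unique[OF lim[OF t]])
    have "f n t (- k) = cnj (f n t k)" for n
      using adm[of n] t by (auto simp: admissible_def real_coeffs_def)
    then show "(\<lambda>n. f n t (- k)) \<longlonglongrightarrow> cnj (g t k)"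
      using lim[OF t, of k] by (simp add: tendsto_cnj)
  qed
  moreover have "(\<lambda>t. g t k) \<in> borel_measurable (lebesgue_on {0..T})" for k
  proof (rule borel_measurable_LIMSEQ_metric[where f = "\<lambda>n t. f n t k"])
    show "(\<lambda>t. f n t k) \<in> borel_measurable (lebesgue_on {0..T})" for n
      using adm[of n] by (simp add: admissible_def)
  qed (simp add: lim)
  ultimately show "admissible T g"
    by (auto simp: admissible_def real_coeffs_def)
qed


section \<open>The Banach spaces\<close>

lemma calPM_le:
  assumes "f \<in> calPM T \<alpha>" "t \<in> {0..T}"
  shows "exp (\<alpha> * t * norm (wv k)) * cmod (f t k) \<le> calPM_norm T \<alpha> f"
proof -
  have "(case (k, t) of (k, t) \<Rightarrow> exp (\<alpha> * t * norm (wv k)) * cmod (f t k)) \<le> calPM_norm T \<alpha> f"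
    unfolding calPM_norm_def using assms by (intro cSUP_upper) (auto simp: calPM_def)
  then show ?thesis by simp
qed

lemma calPM_I:
  assumes "T \<ge> 0" "admissible T f"
    and le: "\<And>t k. t \<in> {0..T} \<Longrightarrow> exp (\<alpha> * t * norm (wv k)) * cmod (f t k) \<le> C"
  shows "f \<in> calPM T \<alpha>" "calPM_norm T \<alpha> f \<le> C"
proof -
  show "f \<in> calPM T \<alpha>"
    using assms by (auto simp: calPM_def intro!: bdd_aboveI[of _ C])
  show "calPM_norm T \<alpha> f \<le> C"
    unfolding calPM_norm_def using assms by (intro cSUP_least) auto
qed

lemma calPM_admissible: "f \<in> calPM T \<alpha> \<Longrightarrow> admissible T f"
  by (simp add: calPM_def)

lemma calPM_norm_nonneg:
  assumes "f \<in> calPM T \<alpha>" "T \<ge> 0"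
  shows "calPM_norm T \<alpha> f \<ge> 0"
  using calPM_le[OF assms(1), of 0 undefined] assms(2) by (auto intro: order_trans[OF norm_ge_zero])

text \<open>
  Sums, differences and the triangle inequality are all instances of a pointwise comparison.
\<close>

lemma calPM_dominated:
  assumes "f \<in> calPM T \<alpha>" "g \<in> calPM T \<alpha>" "T \<ge> 0" "admissible T h"
    and h: "\<And>t k. t \<in> {0..T} \<Longrightarrow> cmod (h t k) \<le> cmod (f t k) + cmod (g t k)"
  shows "h \<in> calPM T \<alpha>" "calPM_norm T \<alpha> h \<le> calPM_norm T \<alpha> f + calPM_norm T \<alpha> g"
proof -
  have le: "exp (\<alpha> * t * norm (wv k)) * cmod (h t k) \<le> calPM_norm T \<alpha> f + calPM_norm T \<alpha> g"
    if t: "t \<in> {0..T}" for t k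
  proof -
    have "exp (\<alpha> * t * norm (wv k)) * cmod (h t k)
        \<le> exp (\<alpha> * t * norm (wv k)) * (cmod (f t k) + cmod (g t k))"
      using h[OF t] by simp
    also have "\<dots> \<le> calPM_norm T \<alpha> f + calPM_norm T \<alpha> g"
      using calPM_le[OF assms(1) t, of k] calPM_le[OF assms(2) t, of k] by (simp add: algebra_simps)
    finally show ?thesis .
  qed
  show "h \<in> calPM T \<alpha>" "calPM_norm T \<alpha> h \<le> calPM_norm T \<alpha> f + calPM_norm T \<alpha> g"
    using calPM_I[OF assms(3,4) le] by auto
qed

lemma calPM_diff:
  assumes "f \<in> calPM T \<alpha>" "g \<in> calPM T \<alpha>" "T \<ge> 0"
  shows "f - g \<in> calPM T \<alpha>" "calPM_norm T \<alpha> (f - g) \<le> calPM_norm T \<alpha> f + calPM_norm T \<alpha> g"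
  by (rule calPM_dominated[OF assms admissible_diff];
      use assms in \<open>simp add: calPM_admissible norm_triangle_ineq4\<close>)+

lemma calPM_norm_minus_commute: "calPM_norm T \<alpha> (f - g) = calPM_norm T \<alpha> (g - f)"
  by (simp add: calPM_norm_def norm_minus_commute)

lemma calPM_norm_triangle:
  assumes "f \<in> calPM T \<alpha>" "g \<in> calPM T \<alpha>" "h \<in> calPM T \<alpha>" "T \<ge> 0"
  shows "calPM_norm T \<alpha> (f - h) \<le> calPM_norm T \<alpha> (f - g) + calPM_norm T \<alpha> (g - h)"
  using assms
  by (intro calPM_dominated(2) calPM_diff admissible_diff calPM_admissible)
     (auto intro!: norm_diff_triangle_le)

lemma calPM_time_slice:
  assumes "f \<in> calPM T \<alpha>" "T \<ge> 0"
  shows "f T \<in> PM (\<alpha> * T)" "PM_norm (\<alpha> * T) (f T) \<le> calPM_norm T \<alpha> f"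
proof -
  have le: "exp (\<alpha> * T * norm (wv k)) * cmod (f T k) \<le> calPM_norm T \<alpha> f" for k
    using calPM_le[OF assms(1), of T k] assms(2) by simp
  show "f T \<in> PM (\<alpha> * T)"
    using calPM_admissible[OF assms(1)] assms(2) le
    by (auto simp: PM_def admissible_def intro!: bdd_aboveI[of _ "calPM_norm T \<alpha> f"])
  show "PM_norm (\<alpha> * T) (f T) \<le> calPM_norm T \<alpha> f"
    unfolding PM_norm_def using le by (intro cSUP_least) auto
qed

lemma PM_norm_le:
  assumes "a \<in> PM \<beta>"
  shows "exp (\<beta> * norm (wv k)) * cmod (a k) \<le> PM_norm \<beta> a"
  unfolding PM_norm_def using assms by (intro cSUP_upper) (auto simp: PM_def)

lemma PM_norm_nonneg: "a \<in> PM \<beta> \<Longrightarrow> PM_norm \<beta> a \<ge> 0"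
  by (rule order_trans[OF _ PM_norm_le[of a \<beta> undefined]]) auto

lemma PM_diff:
  assumes "a \<in> PM \<beta>" "b \<in> PM \<beta>"
  shows "a - b \<in> PM \<beta>"
proof -
  have "exp (\<beta> * norm (wv k)) * cmod (a k - b k) \<le> PM_norm \<beta> a + PM_norm \<beta> b" for k
  proof -
    have "exp (\<beta> * norm (wv k)) * cmod (a k - b k) \<le> exp (\<beta> * norm (wv k)) * (cmod (a k) + cmod (b k))"
      by (simp add: norm_triangle_ineq4)
    then show ?thesis
      using PM_norm_le[OF assms(1), of k] PM_norm_le[OF assms(2), of k] by (simp add: distrib_left)
  qed
  then show ?thesis
    using assms by (auto simp: PM_def real_coeffs_diff intro!: bdd_aboveI[of _ "PM_norm \<beta> a + PM_norm \<beta> b"])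
qed

lemma calB_admissible: "f \<in> calB T \<beta> \<Longrightarrow> admissible T f"
  by (simp add: calB_def)

lemma calB_majorant:
  assumes "f \<in> calB T \<beta>" "T \<ge> 0"
  obtains a where "\<And>t k. t \<in> {0..T} \<Longrightarrow> exp (\<beta> * norm (wv k)) * cmod (f t k) \<le> a k"
    "\<And>k. a k \<ge> 0" "a summable_on UNIV" "infsum a UNIV = calB_norm T \<beta> f"
proof
  define a where "a k = (SUP t\<in>{0..T}. exp (\<beta> * norm (wv k)) * cmod (f t k))" for k
  show le: "exp (\<beta> * norm (wv k)) * cmod (f t k) \<le> a k" if "t \<in> {0..T}" for t k
    unfolding a_def using assms that by (intro cSUP_upper) (auto simp: calB_def)
  show "a k \<ge> 0" for k
    using le[of 0 k] assms(2) by (auto intro: order_trans[rotated])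
  show "a summable_on UNIV" "infsum a UNIV = calB_norm T \<beta> f"
    using assms(1) by (auto simp: a_def[abs_def] calB_def calB_norm_def)
qed

lemma calB_test:
  assumes "f \<in> calB T \<beta>" "T \<ge> 0" "finite F" "\<And>k. k \<in> F \<Longrightarrow> \<tau> k \<in> {0..T}"
  shows "(\<Sum>k\<in>F. exp (\<beta> * norm (wv k)) * cmod (f (\<tau> k) k)) \<le> calB_norm T \<beta> f"
proof -
  obtain a where a: "\<And>t k. t \<in> {0..T} \<Longrightarrow> exp (\<beta> * norm (wv k)) * cmod (f t k) \<le> a k"
    "\<And>k. a k \<ge> 0" "a summable_on UNIV" "infsum a UNIV = calB_norm T \<beta> f"
    using calB_majorant[OF assms(1,2)] by blast
  have "(\<Sum>k\<in>F. exp (\<beta> * norm (wv k)) * cmod (f (\<tau> k) k)) \<le> sum a F"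
    using a(1) assms(4) by (intro sum_mono) auto
  also have "\<dots> \<le> infsum a UNIV"
    using a assms(3) by (intro finite_sum_le_infsum) auto
  finally show ?thesis using a(4) by simp
qed

text \<open>
  The norm is a supremum of the finite sums in the hypothesis, in which every frequency is
  tested at a time of its own. Unlike the sum of the suprema, such a finite sum is continuous under
  pointwise convergence, which is what completeness needs.
\<close>

lemma calB_I:
  assumes T: "T \<ge> 0" and adm: "admissible T f"
    and le: "\<And>F \<tau>. finite F \<Longrightarrow> (\<And>k. \<tau> k \<in> {0..T}) \<Longrightarrow>
      (\<Sum>k\<in>F. exp (\<beta> * norm (wv k)) * cmod (f (\<tau> k) k)) \<le> C"
  shows "f \<in> calB T \<beta>" "calB_norm T \<beta> f \<le> C"
proof -
  define u where "u k t = exp (\<beta> * norm (wv k)) * cmod (f t k)" for k t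
  define a where "a k = (SUP t\<in>{0..T}. u k t)" for k
  have "u k t \<le> C" if "t \<in> {0..T}" for k t
    using le[of "{k}" "\<lambda>_. t"] that by (simp add: u_def)
  then have bdd: "bdd_above (u k ` {0..T})" for k
    by (auto intro!: bdd_aboveI[of _ C])
  have a_nonneg: "a k \<ge> 0" for k
    unfolding a_def using T by (intro cSUP_upper2[OF bdd, of 0]) (auto simp: u_def)
  have fin: "sum a F \<le> C" if F: "finite F" for F
  proof (rule field_le_epsilon)
    fix e :: real assume e: "e > 0"
    \<comment> \<open>the error made at each frequency; the \<open>+ 1\<close> covers the empty set\<close>
    define e' where "e' = e / (card F + 1)"
    have e': "e' > 0" using e by (simp add: e'_def)
    have "\<exists>t\<in>{0..T}. a k - e' < u k t" for k
      using less_cSUP_iff[of "{0..T}" "u k" "a k - e'"] bdd T e' by (auto simp: a_def)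
    then obtain \<tau> where \<tau>: "\<And>k. \<tau> k \<in> {0..T}" "\<And>k. a k - e' < u k (\<tau> k)"
      by metis
    have "sum a F \<le> (\<Sum>k\<in>F. u k (\<tau> k) + e')"
      using \<tau>(2) by (intro sum_mono) (simp add: diff_less_eq[THEN iffD1] less_imp_le)
    also have "\<dots> \<le> C + card F * e'"
      using le[OF F, of \<tau>] \<tau>(1) by (simp add: sum.distrib u_def)
    also have "card F * e' \<le> e"
      using e by (simp add: e'_def field_simps)
    finally show "sum a F \<le> C + e" by simp
  qed
  have summ: "a summable_on UNIV"
    using fin a_nonneg by (intro nonneg_bdd_above_summable_on bdd_aboveI[of _ C]) auto
  show "f \<in> calB T \<beta>"
    using adm bdd summ by (simp add: calB_def u_def[abs_def] a_def[abs_def])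
  show "calB_norm T \<beta> f \<le> C"
    using infsum_le_finite_sums[OF summ] fin
    by (simp add: calB_norm_def u_def[abs_def] a_def[abs_def])
qed

lemma calB_majorized:
  assumes T: "T \<ge> 0" and adm: "admissible T f"
    and le: "\<And>t k. t \<in> {0..T} \<Longrightarrow> exp (\<beta> * norm (wv k)) * cmod (f t k) \<le> a k"
    and summ: "a summable_on UNIV"
  shows "f \<in> calB T \<beta>" "calB_norm T \<beta> f \<le> infsum a UNIV"
proof -
  have "a k \<ge> 0" for k
    using le[of 0 k] T by (auto intro: order_trans[rotated])
  then have "(\<Sum>k\<in>F. exp (\<beta> * norm (wv k)) * cmod (f (\<tau> k) k)) \<le> infsum a UNIV"
    if "finite F" "\<And>k. \<tau> k \<in> {0..T}" for F \<tau>
    using le that by (intro order_trans[OF sum_mono finite_sum_le_infsum[OF summ that(1)]]) auto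
  then show "f \<in> calB T \<beta>" "calB_norm T \<beta> f \<le> infsum a UNIV"
    using calB_I[OF T adm] by blast+
qed

lemma calB_norm_nonneg: "f \<in> calB T \<beta> \<Longrightarrow> T \<ge> 0 \<Longrightarrow> calB_norm T \<beta> f \<ge> 0"
  using calB_test[of f T \<beta> "{}"] by simp

lemma calB_dominated:
  assumes "f \<in> calB T \<beta>" "g \<in> calB T \<beta>" "T \<ge> 0" "admissible T h"
    and h: "\<And>t k. t \<in> {0..T} \<Longrightarrow> cmod (h t k) \<le> cmod (f t k) + cmod (g t k)"
  shows "h \<in> calB T \<beta>" "calB_norm T \<beta> h \<le> calB_norm T \<beta> f + calB_norm T \<beta> g"
proof -
  have le: "(\<Sum>k\<in>F. exp (\<beta> * norm (wv k)) * cmod (h (\<tau> k) k))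
      \<le> calB_norm T \<beta> f + calB_norm T \<beta> g" if "finite F" "\<And>k. \<tau> k \<in> {0..T}" for F \<tau>
  proof -
    have "(\<Sum>k\<in>F. exp (\<beta> * norm (wv k)) * cmod (h (\<tau> k) k))
        \<le> (\<Sum>k\<in>F. exp (\<beta> * norm (wv k)) * (cmod (f (\<tau> k) k) + cmod (g (\<tau> k) k)))"
      using h that by (intro sum_mono mult_left_mono) auto
    also have "\<dots> \<le> calB_norm T \<beta> f + calB_norm T \<beta> g"
      using add_mono[OF calB_test[OF assms(1,3) that] calB_test[OF assms(2,3) that]]
      by (simp add: distrib_left sum.distrib)
    finally show ?thesis .
  qed
  show "h \<in> calB T \<beta>" "calB_norm T \<beta> h \<le> calB_norm T \<beta> f + calB_norm T \<beta> g"
    using calB_I[OF assms(3,4) le] by auto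
qed

lemma calB_diff:
  assumes "f \<in> calB T \<beta>" "g \<in> calB T \<beta>" "T \<ge> 0"
  shows "f - g \<in> calB T \<beta>" "calB_norm T \<beta> (f - g) \<le> calB_norm T \<beta> f + calB_norm T \<beta> g"
  by (rule calB_dominated[OF assms admissible_diff];
      use assms in \<open>simp add: calB_admissible norm_triangle_ineq4\<close>)+

lemma calB_norm_minus_commute: "calB_norm T \<beta> (f - g) = calB_norm T \<beta> (g - f)"
  by (simp add: calB_norm_def norm_minus_commute)

lemma calB_norm_triangle:
  assumes "f \<in> calB T \<beta>" "g \<in> calB T \<beta>" "h \<in> calB T \<beta>" "T \<ge> 0"
  shows "calB_norm T \<beta> (f - h) \<le> calB_norm T \<beta> (f - g) + calB_norm T \<beta> (g - h)"
  using assms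
  by (intro calB_dominated(2) calB_diff admissible_diff calB_admissible)
     (auto intro!: norm_diff_triangle_le)

lemma calB_le:
  assumes "f \<in> calB T \<beta>" "T \<ge> 0" "t \<in> {0..T}"
  shows "exp (\<beta> * norm (wv k)) * cmod (f t k) \<le> calB_norm T \<beta> f"
  using calB_test[OF assms(1,2), of "{k}" "\<lambda>_. t"] assms(3) by simp

text \<open>
  The sum of the suprema dominates the supremum of the sums. Products are estimated at each time
  with the weight \<open>\<gamma> = \<alpha> t\<close> available to a pseudomeasure, which is at most \<open>\<beta> = \<alpha> T\<close>.
\<close>

lemma calB_time_slice:
  fixes f :: "('d::finite) tcoeffs"
  assumes "f \<in> calB T \<beta>" "t \<in> {0..T}" "\<gamma> \<le> \<beta>"
  shows "(\<lambda>k. exp (\<gamma> * norm (wv k)) * cmod (f t k)) summable_on UNIV" (is "?u summable_on _")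
    "infsum (\<lambda>k. exp (\<gamma> * norm (wv k)) * cmod (f t k)) UNIV \<le> calB_norm T \<beta> f"
proof -
  have T: "T \<ge> 0" using assms(2) by simp
  obtain a where a: "\<And>t k. t \<in> {0..T} \<Longrightarrow> exp (\<beta> * norm (wv k)) * cmod (f t k) \<le> a k"
    "\<And>k. a k \<ge> 0" "a summable_on UNIV" "infsum a UNIV = calB_norm T \<beta> f"
    using calB_majorant[OF assms(1) T] by blast
  have le: "?u k \<le> a k" for k
  proof -
    have "?u k \<le> exp (\<beta> * norm (wv k)) * cmod (f t k)"
      using assms(3) by (intro mult_right_mono) (auto intro: mult_right_mono)
    then show ?thesis using a(1)[OF assms(2), of k] by linarith
  qed
  show summ: "?u summable_on UNIV"
    using le by (intro summable_on_comparison_test[OF a(3)]) auto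
  show "infsum ?u UNIV \<le> calB_norm T \<beta> f"
    using infsum_mono[OF summ a(3)] le a(4) by simp
qed

lemma Cauchy_if_rate:
  fixes x :: "nat \<Rightarrow> complex"
  assumes rate: "\<And>n p. n \<le> p \<Longrightarrow> cmod (x p - x n) \<le> e n" and e: "e \<longlonglongrightarrow> 0"
  shows "Cauchy x"
proof (rule metric_CauchyI)
  fix \<epsilon> :: real assume "\<epsilon> > 0"
  then obtain N where N: "e N < \<epsilon> / 2"
    using order_tendstoD(2)[OF e, of "\<epsilon> / 2"] by (auto simp: eventually_sequentially)
  have "dist (x p) (x N) < \<epsilon> / 2" if "p \<ge> N" for p
    using rate[OF that] N by (simp add: dist_norm)
  then show "\<exists>N. \<forall>m\<ge>N. \<forall>n\<ge>N. dist (x m) (x n) < \<epsilon>"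
    by (blast intro: dist_triangle_half_l)
qed

text \<open>
  Completeness, in a form that keeps the rate: a sequence that is Cauchy in norm converges at every
  time and frequency, and the bound on \<open>f p - f n\<close> survives the limit \<open>p \<rightarrow> \<infinity>\<close>.
  The values outside \<open>{0..T}\<close> are never compared, so limits are unique only on that interval.
\<close>

lemma calPM_complete:
  fixes f :: "nat \<Rightarrow> ('d::finite) tcoeffs"
  assumes "T \<ge> 0" "\<alpha> \<ge> 0" and f: "\<And>n. f n \<in> calPM T \<alpha>"
    and le: "\<And>n p. n \<le> p \<Longrightarrow> calPM_norm T \<alpha> (f p - f n) \<le> e n" and e: "e \<longlonglongrightarrow> 0"
  obtains g where "g \<in> calPM T \<alpha>" "\<And>n. calPM_norm T \<alpha> (f n - g) \<le> e n"
proof -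
  have w: "exp (\<alpha> * t * norm (wv k)) * cmod (f p t k - f n t k) \<le> e n"
    if "n \<le> p" "t \<in> {0..T}" for n p t k
    using order_trans[OF calPM_le[OF calPM_diff(1)[OF f f assms(1)] that(2)] le[OF that(1)]] by simp
  have "Cauchy (\<lambda>n. f n t k)" if t: "t \<in> {0..T}" for t k
  proof (rule Cauchy_if_rate[OF _ e])
    fix n p :: nat assume "n \<le> p"
    have "1 * cmod (f p t k - f n t k) \<le> exp (\<alpha> * t * norm (wv k)) * cmod (f p t k - f n t k)"
      using t assms(2) by (intro mult_right_mono) auto
    then show "cmod (f p t k - f n t k) \<le> e n"
      using w[OF \<open>n \<le> p\<close> t, of k] by simp
  qed
  then obtain g where g: "admissible T g" "\<And>t k. t \<in> {0..T} \<Longrightarrow> (\<lambda>n. f n t k) \<longlonglongrightarrow> g t k"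
    using admissible_limit[of T f] f calPM_admissible by blast
  have *: "exp (\<alpha> * t * norm (wv k)) * cmod ((f n - g) t k) \<le> e n" if t: "t \<in> {0..T}" for n t k
  proof (rule LIMSEQ_le_const2)
    show "(\<lambda>p. exp (\<alpha> * t * norm (wv k)) * cmod (f n t k - f p t k))
        \<longlonglongrightarrow> exp (\<alpha> * t * norm (wv k)) * cmod ((f n - g) t k)"
      unfolding minus_apply by (intro tendsto_intros g t)
    have "exp (\<alpha> * t * norm (wv k)) * cmod (f n t k - f p t k) \<le> e n" if "p \<ge> n" for p
      using w[OF that t] by (simp only: norm_minus_commute[of "f n _ _"])
    then show "\<exists>N. \<forall>p\<ge>N. exp (\<alpha> * t * norm (wv k)) * cmod (f n t k - f p t k) \<le> e n"
      by blast
  qed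
  have d: "f n - g \<in> calPM T \<alpha>" "calPM_norm T \<alpha> (f n - g) \<le> e n" for n
    using calPM_I[OF assms(1) admissible_diff[OF calPM_admissible[OF f] g(1)] *] by (auto simp: fun_diff_def)
  have "g \<in> calPM T \<alpha>"
    \<comment> \<open>\<open>g = f 0 - (f 0 - g)\<close>\<close>
    using calPM_diff(1)[OF f[of 0] d(1)[of 0] assms(1)] by (simp add: fun_diff_def)
  then show thesis using that d by blast
qed

lemma calB_complete:
  fixes f :: "nat \<Rightarrow> ('d::finite) tcoeffs"
  assumes "T \<ge> 0" "\<beta> \<ge> 0" and f: "\<And>n. f n \<in> calB T \<beta>"
    and le: "\<And>n p. n \<le> p \<Longrightarrow> calB_norm T \<beta> (f p - f n) \<le> e n" and e: "e \<longlonglongrightarrow> 0"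
  obtains g where "g \<in> calB T \<beta>" "\<And>n. calB_norm T \<beta> (f n - g) \<le> e n"
proof -
  have w: "(\<Sum>k\<in>F. exp (\<beta> * norm (wv k)) * cmod (f p (\<tau> k) k - f n (\<tau> k) k)) \<le> e n"
    if "n \<le> p" "finite F" "\<And>k. \<tau> k \<in> {0..T}" for n p F \<tau>
    using order_trans[OF calB_test[OF calB_diff(1)[OF f f assms(1)] assms(1) that(2,3)] le[OF that(1)]]
    by simp
  have "Cauchy (\<lambda>n. f n t k)" if t: "t \<in> {0..T}" for t k
  proof (rule Cauchy_if_rate[OF _ e])
    fix n p :: nat assume "n \<le> p"
    have "1 * cmod (f p t k - f n t k) \<le> exp (\<beta> * norm (wv k)) * cmod (f p t k - f n t k)"
      using t assms(2) by (intro mult_right_mono) auto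
    then show "cmod (f p t k - f n t k) \<le> e n"
      using w[OF \<open>n \<le> p\<close>, of "{k}" "\<lambda>_. t"] t by simp
  qed
  then obtain g where g: "admissible T g" "\<And>t k. t \<in> {0..T} \<Longrightarrow> (\<lambda>n. f n t k) \<longlonglongrightarrow> g t k"
    using admissible_limit[of T f] f calB_admissible by blast
  have *: "(\<Sum>k\<in>F. exp (\<beta> * norm (wv k)) * cmod ((f n - g) (\<tau> k) k)) \<le> e n"
    if F: "finite F" "\<And>k. \<tau> k \<in> {0..T}" for F \<tau> n
  proof (rule LIMSEQ_le_const2)
    show "(\<lambda>p. \<Sum>k\<in>F. exp (\<beta> * norm (wv k)) * cmod (f n (\<tau> k) k - f p (\<tau> k) k))
        \<longlonglongrightarrow> (\<Sum>k\<in>F. exp (\<beta> * norm (wv k)) * cmod ((f n - g) (\<tau> k) k))"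
      unfolding minus_apply by (intro tendsto_intros g F)
    have "(\<Sum>k\<in>F. exp (\<beta> * norm (wv k)) * cmod (f n (\<tau> k) k - f p (\<tau> k) k)) \<le> e n" if "p \<ge> n" for p
      using w[OF that F] by (simp only: norm_minus_commute[of "f n _ _"])
    then show "\<exists>N. \<forall>p\<ge>N. (\<Sum>k\<in>F. exp (\<beta> * norm (wv k)) * cmod (f n (\<tau> k) k - f p (\<tau> k) k)) \<le> e n"
      by blast
  qed
  have d: "f n - g \<in> calB T \<beta>" "calB_norm T \<beta> (f n - g) \<le> e n" for n
    using calB_I[OF assms(1) admissible_diff[OF calB_admissible[OF f] g(1)] *] by (auto simp: fun_diff_def)
  have "g \<in> calB T \<beta>"
    using calB_diff(1)[OF f[of 0] d(1)[of 0] assms(1)] by (simp add: fun_diff_def)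
  then show thesis using that d by blast
qed

lemma calBv_norm_nonneg: "v \<in> calBv T \<beta> \<Longrightarrow> T \<ge> 0 \<Longrightarrow> calBv_norm T \<beta> v \<ge> 0"
  unfolding calBv_norm_def calBv_def by (auto intro: sum_nonneg calB_norm_nonneg)

lemma calB_component_le:
  assumes "v \<in> calBv T \<beta>" "T \<ge> 0"
  shows "calB_norm T \<beta> (v $ i) \<le> calBv_norm T \<beta> v"
  unfolding calBv_norm_def using assms
  by (intro member_le_sum[where f = "\<lambda>i. calB_norm T \<beta> (v $ i)"])
     (auto simp: calBv_def calB_norm_nonneg)

lemma calBv_diff:
  assumes "v \<in> calBv T \<beta>" "w \<in> calBv T \<beta>" "T \<ge> 0"
  shows "v - w \<in> calBv T \<beta>" "calBv_norm T \<beta> (v - w) \<le> calBv_norm T \<beta> v + calBv_norm T \<beta> w"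
  using assms
  by (auto simp: calBv_def calBv_norm_def simp flip: sum.distrib intro!: sum_mono calB_diff)

lemma calBv_norm_minus_commute: "calBv_norm T \<beta> (v - w) = calBv_norm T \<beta> (w - v)"
  using calB_norm_minus_commute by (auto simp: calBv_norm_def intro!: sum.cong)

lemma calBv_norm_triangle:
  assumes "u \<in> calBv T \<beta>" "v \<in> calBv T \<beta>" "w \<in> calBv T \<beta>" "T \<ge> 0"
  shows "calBv_norm T \<beta> (u - w) \<le> calBv_norm T \<beta> (u - v) + calBv_norm T \<beta> (v - w)"
  using assms
  by (auto simp: calBv_def calBv_norm_def simp flip: sum.distrib intro!: sum_mono calB_norm_triangle)

lemma calBv_complete:
  fixes f :: "nat \<Rightarrow> ('d::finite) tcoeffs ^ 'd" and e :: "nat \<Rightarrow> real"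
  assumes "T \<ge> 0" "\<beta> \<ge> 0" and f: "\<And>n. f n \<in> calBv T \<beta>"
    and le: "\<And>n p. n \<le> p \<Longrightarrow> calBv_norm T \<beta> (f p - f n) \<le> e n" and e: "e \<longlonglongrightarrow> 0"
  obtains g where "g \<in> calBv T \<beta>" "\<And>n. calBv_norm T \<beta> (f n - g) \<le> CARD('d) * e n"
proof -
  have "\<exists>g. g \<in> calB T \<beta> \<and> (\<forall>n. calB_norm T \<beta> (f n $ i - g) \<le> e n)" for i
  proof -
    have le': "calB_norm T \<beta> (f p $ i - f n $ i) \<le> e n" if "n \<le> p" for n p
      using order_trans[OF calB_component_le[OF calBv_diff(1)[OF f f assms(1)] assms(1)] le[OF that], of i]
      by simp
    have mem: "f n $ i \<in> calB T \<beta>" for n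
      using f by (simp add: calBv_def)
    show ?thesis
      using calB_complete[where f = "\<lambda>n. f n $ i", OF assms(1,2) mem le' e] by blast
  qed
  then obtain g where g: "\<And>i. g i \<in> calB T \<beta>" "\<And>i n. calB_norm T \<beta> (f n $ i - g i) \<le> e n"
    by metis
  show thesis
  proof
    show "(\<chi> i. g i) \<in> calBv T \<beta>"
      using g(1) by (simp add: calBv_def)
    show "calBv_norm T \<beta> (f n - (\<chi> i. g i)) \<le> CARD('d) * e n" for n
      unfolding calBv_norm_def using g(2) by (intro sum_bounded_above[THEN order_trans]) auto
  qed
qed


section \<open>Convolutions and nonlocal products\<close>

lemma borel_measurable_infsum:
  fixes f :: "'k::countable \<Rightarrow> 'a \<Rightarrow> complex"
  assumes meas: "\<And>k. f k \<in> borel_measurable M"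
    and summ: "\<And>x. x \<in> space M \<Longrightarrow> (\<lambda>k. f k x) summable_on UNIV"
  shows "(\<lambda>x. \<Sum>\<^sub>\<infinity>k. f k x) \<in> borel_measurable M"
proof -
  define h where "h n x = (if n \<in> range (to_nat :: 'k \<Rightarrow> nat) then f (from_nat n) x else 0)" for n x
  have "(\<lambda>N. \<Sum>n<N. h n x) \<longlonglongrightarrow> (\<Sum>\<^sub>\<infinity>k. f k x)" if x: "x \<in> space M" for x
  proof -
    have "((\<lambda>n. h n x) \<circ> (to_nat :: 'k \<Rightarrow> nat) has_sum (\<Sum>\<^sub>\<infinity>k. f k x)) UNIV"
      using has_sum_infsum[OF summ[OF x]] by (simp add: h_def[abs_def] o_def)
    then have "((\<lambda>n. h n x) has_sum (\<Sum>\<^sub>\<infinity>k. f k x)) (range (to_nat :: 'k \<Rightarrow> nat))"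
      by (subst has_sum_reindex) auto
    then have "((\<lambda>n. h n x) has_sum (\<Sum>\<^sub>\<infinity>k. f k x)) UNIV"
      by (rule has_sum_cong_neutral[THEN iffD1, rotated 3]) (auto simp: h_def)
    then show ?thesis
      using has_sum_imp_sums sums_def by blast
  qed
  moreover have "(\<lambda>x. \<Sum>n<N. h n x) \<in> borel_measurable M" for N
    unfolding h_def using meas by (intro borel_measurable_sum) auto
  ultimately show ?thesis
    by (rule borel_measurable_LIMSEQ_metric[rotated])
qed

lemma calPM_cmod_le:
  assumes "m \<in> calPM T \<alpha>" "\<alpha> \<ge> 0" "t \<in> {0..T}"
  shows "cmod (m t k) \<le> calPM_norm T \<alpha> m"
proof -
  have "1 * cmod (m t k) \<le> exp (\<alpha> * t * norm (wv k)) * cmod (m t k)"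
    using assms by (intro mult_right_mono) auto
  then show ?thesis using calPM_le[OF assms(1,3), of k] by simp
qed

lemma calB_cmod_le:
  assumes "f \<in> calB T \<beta>" "\<beta> \<ge> 0" "t \<in> {0..T}"
  shows "cmod (f t k) \<le> calB_norm T \<beta> f"
proof -
  have "1 * cmod (f t k) \<le> exp (\<beta> * norm (wv k)) * cmod (f t k)"
    using assms by (intro mult_right_mono) auto
  then show ?thesis using calB_le[OF assms(1) _ assms(3), of k] assms(3) by simp
qed

lemma pairing_bound:
  assumes f: "f \<in> calB T \<beta>" and m: "m \<in> calPM T \<alpha>" and "\<alpha> \<ge> 0" "\<beta> \<ge> 0" and t: "t \<in> {0..T}"
  shows "(\<lambda>k. norm (f t k * m t (- k))) summable_on UNIV"
    "cmod (pairing (f t) (m t)) \<le> calB_norm T \<beta> f * calPM_norm T \<alpha> m"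
proof -
  let ?M = "calPM_norm T \<alpha> m"
  have M: "?M \<ge> 0" using calPM_norm_nonneg[OF m] t by simp
  have le: "norm (f t k * m t (- k)) \<le> cmod (f t k) * ?M" for k
    using calPM_cmod_le[OF m assms(3) t, of "- k"] by (simp add: norm_mult mult_left_mono)
  have slice: "(\<lambda>k. cmod (f t k)) summable_on UNIV" "infsum (\<lambda>k. cmod (f t k)) UNIV \<le> calB_norm T \<beta> f"
    using calB_time_slice[OF f t assms(4)] by simp_all
  have maj: "(\<lambda>k. cmod (f t k) * ?M) summable_on UNIV"
    by (intro summable_on_cmult_left slice)
  show summ: "(\<lambda>k. norm (f t k * m t (- k))) summable_on UNIV"
    using le by (intro Infinite_Sum.abs_summable_on_comparison_test'[OF maj])
  have "cmod (pairing (f t) (m t)) \<le> (\<Sum>\<^sub>\<infinity>k. norm (f t k * m t (- k)))"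
    unfolding pairing_def by (rule norm_infsum_bound[OF summ])
  also have "\<dots> \<le> (\<Sum>\<^sub>\<infinity>k. cmod (f t k) * ?M)"
    by (rule infsum_mono[OF summ maj le])
  also have "\<dots> = infsum (\<lambda>k. cmod (f t k)) UNIV * ?M"
    by (rule infsum_cmult_left')
  also have "\<dots> \<le> calB_norm T \<beta> f * ?M"
    using slice(2) M by (rule mult_right_mono)
  finally show "cmod (pairing (f t) (m t)) \<le> calB_norm T \<beta> f * ?M" .
qed

lemma admissible_measurable:
  "admissible T f \<Longrightarrow> (\<lambda>t. f t k) \<in> borel_measurable (lebesgue_on {0..T})"
  by (simp add: admissible_def)

lemma pairing_measurable:
  assumes f: "f \<in> calB T \<beta>" and m: "m \<in> calPM T \<alpha>" and "\<alpha> \<ge> 0" "\<beta> \<ge> 0"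
  shows "(\<lambda>t. pairing (f t) (m t)) \<in> borel_measurable (lebesgue_on {0..T})"
  unfolding pairing_def
proof (rule borel_measurable_infsum)
  show "(\<lambda>t. f t k * m t (- k)) \<in> borel_measurable (lebesgue_on {0..T})" for k
    by (rule borel_measurable_times[OF admissible_measurable[OF calB_admissible[OF f]] admissible_measurable[OF calPM_admissible[OF m]]])
  show "(\<lambda>k. f t k * m t (- k)) summable_on UNIV" if "t \<in> space (lebesgue_on {0..T})" for t
    using that by (intro abs_summable_summable[OF pairing_bound(1)[OF f m assms(3,4)]]) auto
qed

lemma infsum_uminus_index: "(\<Sum>\<^sub>\<infinity>k. f (- k)) = (\<Sum>\<^sub>\<infinity>k. f (k :: int ^ 'd::finite) :: complex)"
  by (rule infsum_reindex_bij_witness[of _ uminus uminus]) auto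

lemma pairing_real:
  assumes "real_coeffs a" "real_coeffs b"
  shows "cnj (pairing a b) = pairing a b"
proof -
  have "cnj (pairing a b) = (\<Sum>\<^sub>\<infinity>k. a (- k) * b (- (- k)))"
    unfolding pairing_def infsum_cnj[symmetric] using assms
    by (intro infsum_cong) (simp add: real_coeffs_def)
  also have "\<dots> = pairing a b"
    unfolding pairing_def by (rule infsum_uminus_index)
  finally show ?thesis .
qed

lemma infsum_diff:
  fixes f g :: "'a \<Rightarrow> complex"
  assumes "f summable_on A" "g summable_on A"
  shows "infsum (\<lambda>x. f x - g x) A = infsum f A - infsum g A"
  using infsum_add[OF assms(1) summable_on_uminus[THEN iffD2, OF assms(2)]]
  by (simp add: infsum_uminus)

lemma pairing_diff_left:
  assumes "f \<in> calB T \<beta>" "g \<in> calB T \<beta>" "m \<in> calPM T \<alpha>" "\<alpha> \<ge> 0" "\<beta> \<ge> 0" "t \<in> {0..T}"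
  shows "pairing ((f - g) t) (m t) = pairing (f t) (m t) - pairing (g t) (m t)"
  unfolding pairing_def minus_apply left_diff_distrib
  by (intro infsum_diff abs_summable_summable[OF pairing_bound(1)[OF _ assms(3-6)]] assms)

lemma pairing_diff_right:
  assumes "f \<in> calB T \<beta>" "m \<in> calPM T \<alpha>" "n \<in> calPM T \<alpha>" "\<alpha> \<ge> 0" "\<beta> \<ge> 0" "t \<in> {0..T}"
  shows "pairing (f t) ((m - n) t) = pairing (f t) (m t) - pairing (f t) (n t)"
  unfolding pairing_def minus_apply right_diff_distrib
  by (intro infsum_diff abs_summable_summable[OF pairing_bound(1)[OF assms(1) _ assms(4-6)]] assms)

text \<open>
  By \<open>|k| \<le> |j| + |k - j|\<close> the weight at \<open>k\<close> splits between the two factors, which turns the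
  convolution into a supremum times a weighted sum.
\<close>

lemma conv_bound:
  fixes u h :: "('d::finite) tcoeffs"
  assumes u: "u \<in> calPM T \<alpha>" and h: "h \<in> calB T (\<alpha> * T)" and "\<alpha> \<ge> 0" and t: "t \<in> {0..T}"
  shows "(\<lambda>j. norm (u t j * h t (k - j))) summable_on UNIV"
    "exp (\<alpha> * t * norm (wv k)) * cmod (conv (u t) (h t) k) \<le> calPM_norm T \<alpha> u * calB_norm T (\<alpha> * T) h"
proof -
  let ?M = "calPM_norm T \<alpha> u"
  let ?e = "\<lambda>k :: int ^ 'd. exp (\<alpha> * t * norm (wv k))"
  let ?a = "\<lambda>k. ?e k * cmod (h t k)"
  have M: "?M \<ge> 0" using calPM_norm_nonneg[OF u] t by simp
  have le: "?e k * norm (u t j * h t (k - j)) \<le> ?M * ?a (k - j)" for j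
  proof -
    have "\<alpha> * t * norm (wv k) \<le> \<alpha> * t * (norm (wv j) + norm (wv (k - j)))"
      using t assms(3) norm_wv_triangle by (intro mult_left_mono) auto
    then have "?e k \<le> ?e j * ?e (k - j)"
      by (simp add: distrib_left flip: exp_add)
    then have "?e k * norm (u t j * h t (k - j)) \<le> (?e j * ?e (k - j)) * (cmod (u t j) * cmod (h t (k - j)))"
      unfolding norm_mult by (intro mult_right_mono) auto
    also have "\<dots> = (?e j * cmod (u t j)) * ?a (k - j)"
      by simp
    also have "\<dots> \<le> ?M * ?a (k - j)"
      by (intro mult_right_mono calPM_le[OF u t]) auto
    finally show ?thesis .
  qed
  have "\<alpha> * t \<le> \<alpha> * T" using t assms(3) by (intro mult_left_mono) auto
  note slice = calB_time_slice[OF h t this]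
  have bij: "bij_betw (\<lambda>j. k - j) UNIV UNIV"
    by (rule bij_betw_byWitness[where f' = "\<lambda>j. k - j"]) auto
  have maj: "(\<lambda>j. ?M * ?a (k - j)) summable_on UNIV"
    using summable_on_reindex_bij_betw[OF bij, of ?a] slice(1)
    by (intro summable_on_cmult_right) simp
  have summ': "(\<lambda>j. ?e k * norm (u t j * h t (k - j))) summable_on UNIV"
    using le by (intro summable_on_comparison_test[OF maj]) auto
  then show summ: "(\<lambda>j. norm (u t j * h t (k - j))) summable_on UNIV"
    by (simp add: summable_on_cmult_right')
  have "?e k * cmod (conv (u t) (h t) k) \<le> ?e k * (\<Sum>\<^sub>\<infinity>j. norm (u t j * h t (k - j)))"
    unfolding conv_def by (intro mult_left_mono norm_infsum_bound summ) auto
  also have "\<dots> = (\<Sum>\<^sub>\<infinity>j. ?e k * norm (u t j * h t (k - j)))"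
    by (rule infsum_cmult_right'[symmetric])
  also have "\<dots> \<le> (\<Sum>\<^sub>\<infinity>j. ?M * ?a (k - j))"
    by (rule infsum_mono[OF summ' maj le])
  also have "\<dots> = ?M * infsum ?a UNIV"
    using infsum_reindex_bij_betw[OF bij, of ?a] by (simp only: infsum_cmult_right')
  also have "\<dots> \<le> ?M * calB_norm T (\<alpha> * T) h"
    using slice(2) M by (rule mult_left_mono)
  finally show "?e k * cmod (conv (u t) (h t) k) \<le> ?M * calB_norm T (\<alpha> * T) h" .
qed

lemma conv_real:
  assumes "real_coeffs a" "real_coeffs b"
  shows "real_coeffs (conv a b)"
  unfolding real_coeffs_def
proof
  fix k
  have "cnj (conv a b k) = (\<Sum>\<^sub>\<infinity>j. a (- j) * b (- k - (- j)))"
    unfolding conv_def infsum_cnj[symmetric]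
  proof (rule infsum_cong)
    fix j
    have "b (- k - (- j)) = b (- (k - j))" by simp
    then show "cnj (a j * b (k - j)) = a (- j) * b (- k - (- j))"
      using assms by (simp only: real_coeffs_def complex_cnj_mult)
  qed
  also have "\<dots> = conv a b (- k)"
    unfolding conv_def by (rule infsum_uminus_index)
  finally show "conv a b (- k) = cnj (conv a b k)" by simp
qed

lemma conv_calPM:
  fixes u h :: "('d::finite) tcoeffs"
  assumes u: "u \<in> calPM T \<alpha>" and h: "h \<in> calB T (\<alpha> * T)" and "\<alpha> \<ge> 0" "T \<ge> 0"
  shows "(\<lambda>t. conv (u t) (h t)) \<in> calPM T \<alpha>"
    "calPM_norm T \<alpha> (\<lambda>t. conv (u t) (h t)) \<le> calPM_norm T \<alpha> u * calB_norm T (\<alpha> * T) h"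
proof -
  have "(\<lambda>t. conv (u t) (h t) k) \<in> borel_measurable (lebesgue_on {0..T})" for k
    unfolding conv_def
  proof (rule borel_measurable_infsum)
    show "(\<lambda>t. u t j * h t (k - j)) \<in> borel_measurable (lebesgue_on {0..T})" for j
      by (rule borel_measurable_times[OF admissible_measurable[OF calPM_admissible[OF u]] admissible_measurable[OF calB_admissible[OF h]]])
    show "(\<lambda>j. u t j * h t (k - j)) summable_on UNIV" if "t \<in> space (lebesgue_on {0..T})" for t
      using that by (intro abs_summable_summable[OF conv_bound(1)[OF u h assms(3)]]) auto
  qed
  then have "admissible T (\<lambda>t. conv (u t) (h t))"
    using calB_admissible[OF h] calPM_admissible[OF u] by (auto simp: admissible_def conv_real)
  from calPM_I[OF assms(4) this conv_bound(2)[OF u h assms(3)]]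
  show "(\<lambda>t. conv (u t) (h t)) \<in> calPM T \<alpha>"
    "calPM_norm T \<alpha> (\<lambda>t. conv (u t) (h t)) \<le> calPM_norm T \<alpha> u * calB_norm T (\<alpha> * T) h"
    by auto
qed

lemma conv_diff_left:
  assumes "u \<in> calPM T \<alpha>" "w \<in> calPM T \<alpha>" "h \<in> calB T (\<alpha> * T)" "\<alpha> \<ge> 0" "t \<in> {0..T}"
  shows "conv ((u - w) t) (h t) k = conv (u t) (h t) k - conv (w t) (h t) k"
  unfolding conv_def minus_apply left_diff_distrib
  by (intro infsum_diff abs_summable_summable[OF conv_bound(1)[OF _ assms(3-5)]] assms)

lemma conv_diff_right:
  assumes "u \<in> calPM T \<alpha>" "g \<in> calB T (\<alpha> * T)" "h \<in> calB T (\<alpha> * T)" "\<alpha> \<ge> 0" "t \<in> {0..T}"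
  shows "conv (u t) ((g - h) t) k = conv (u t) (g t) k - conv (u t) (h t) k"
  unfolding conv_def minus_apply right_diff_distrib
  by (intro infsum_diff abs_summable_summable[OF conv_bound(1)[OF assms(1) _ assms(4,5)]] assms)

lemma calPM_norm_cong:
  assumes "\<And>t k. t \<in> {0..T} \<Longrightarrow> f t k = g t k"
  shows "calPM_norm T \<alpha> f = calPM_norm T \<alpha> g"
  unfolding calPM_norm_def using assms by (intro SUP_cong) auto

lemma calB_norm_cong:
  assumes "\<And>t k. t \<in> {0..T} \<Longrightarrow> f t k = g t k"
  shows "calB_norm T \<beta> f = calB_norm T \<beta> g"
  unfolding calB_norm_def using assms by (intro infsum_cong SUP_cong) auto

lemma conv_difference:
  fixes u w g h :: "('d::finite) tcoeffs"
  assumes u: "u \<in> calPM T \<alpha>" and w: "w \<in> calPM T \<alpha>"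
    and g: "g \<in> calB T (\<alpha> * T)" and h: "h \<in> calB T (\<alpha> * T)" and \<alpha>: "\<alpha> \<ge> 0" and T: "T \<ge> 0"
  shows "calPM_norm T \<alpha> ((\<lambda>t. conv (u t) (g t)) - (\<lambda>t. conv (w t) (h t)))
    \<le> calPM_norm T \<alpha> (u - w) * calB_norm T (\<alpha> * T) g + calPM_norm T \<alpha> w * calB_norm T (\<alpha> * T) (g - h)"
proof -
  let ?c = "\<lambda>u g t. conv (u t) (g t)"
  note cPM = conv_calPM(1)[OF _ _ \<alpha> T] and cle = conv_calPM(2)[OF _ _ \<alpha> T]
  have "calPM_norm T \<alpha> (?c u g - ?c w h)
      \<le> calPM_norm T \<alpha> (?c u g - ?c w g) + calPM_norm T \<alpha> (?c w g - ?c w h)"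
    by (intro calPM_norm_triangle cPM u w g h T)
  also have "calPM_norm T \<alpha> (?c u g - ?c w g) = calPM_norm T \<alpha> (?c (u - w) g)"
    by (rule calPM_norm_cong) (simp add: conv_diff_left[OF u w g \<alpha>, simplified])
  also have "calPM_norm T \<alpha> (?c w g - ?c w h) = calPM_norm T \<alpha> (?c w (g - h))"
    by (rule calPM_norm_cong) (simp add: conv_diff_right[OF w g h \<alpha>, simplified])
  also have "calPM_norm T \<alpha> (?c (u - w) g) + calPM_norm T \<alpha> (?c w (g - h)) \<le>
      calPM_norm T \<alpha> (u - w) * calB_norm T (\<alpha> * T) g + calPM_norm T \<alpha> w * calB_norm T (\<alpha> * T) (g - h)"
    by (intro add_mono cle calPM_diff calB_diff u w g h T)
  finally show ?thesis by (simp only: )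
qed

text \<open>
  The Hamiltonians have the form \<open>g (v)\<close> times a function of time only, namely the pairing of
  \<open>f (v)\<close> with \<open>m\<close>. Such a factor does not interact with the frequencies, and it is real because
  \<open>f (v)\<close> and \<open>m\<close> are.
\<close>

lemma calB_time_factor:
  fixes g :: "('d::finite) tcoeffs"
  assumes g: "g \<in> calB T \<beta>" and T: "T \<ge> 0"
    and meas: "p \<in> borel_measurable (lebesgue_on {0..T})"
    and real: "\<And>t. t \<in> {0..T} \<Longrightarrow> cnj (p t) = p t"
    and le: "\<And>t. t \<in> {0..T} \<Longrightarrow> cmod (p t) \<le> P"
  shows "(\<lambda>t k. g t k * p t) \<in> calB T \<beta>"
    "calB_norm T \<beta> (\<lambda>t k. g t k * p t) \<le> calB_norm T \<beta> g * P"
proof -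
  have adm: "admissible T (\<lambda>t k. g t k * p t)"
    using calB_admissible[OF g] real borel_measurable_times[OF admissible_measurable[OF calB_admissible[OF g]] meas]
    by (simp add: admissible_def real_coeffs_def)
  have P: "P \<ge> 0" using le[of 0] T norm_ge_zero[of "p 0"] by (auto intro: order_trans[OF norm_ge_zero])
  have "(\<Sum>k\<in>F. exp (\<beta> * norm (wv k)) * cmod (g (\<tau> k) k * p (\<tau> k))) \<le> calB_norm T \<beta> g * P"
    if F: "finite F" and \<tau>: "\<And>k. \<tau> k \<in> {0..T}" for F \<tau>
  proof -
    have "(\<Sum>k\<in>F. exp (\<beta> * norm (wv k)) * cmod (g (\<tau> k) k * p (\<tau> k)))
        \<le> (\<Sum>k\<in>F. exp (\<beta> * norm (wv k)) * (cmod (g (\<tau> k) k) * P))"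
      unfolding norm_mult using le[OF \<tau>] by (intro sum_mono mult_left_mono) auto
    also have "\<dots> = (\<Sum>k\<in>F. exp (\<beta> * norm (wv k)) * cmod (g (\<tau> k) k)) * P"
      by (simp add: sum_distrib_right mult.assoc)
    also have "\<dots> \<le> calB_norm T \<beta> g * P"
      using F \<tau> P by (intro mult_right_mono calB_test[OF g T])
    finally show ?thesis .
  qed
  from calB_I[OF T adm this] show "(\<lambda>t k. g t k * p t) \<in> calB T \<beta>"
    "calB_norm T \<beta> (\<lambda>t k. g t k * p t) \<le> calB_norm T \<beta> g * P"
    by auto
qed

lemma nonlocal_product:
  fixes f g m :: "('d::finite) tcoeffs"
  assumes g: "g \<in> calB T \<beta>" and f: "f \<in> calB T \<beta>" and m: "m \<in> calPM T \<alpha>"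
    and \<alpha>: "\<alpha> \<ge> 0" and \<beta>: "\<beta> \<ge> 0" and T: "T \<ge> 0"
  shows "(\<lambda>t k. g t k * pairing (f t) (m t)) \<in> calB T \<beta>"
    "calB_norm T \<beta> (\<lambda>t k. g t k * pairing (f t) (m t))
      \<le> calB_norm T \<beta> g * (calB_norm T \<beta> f * calPM_norm T \<alpha> m)"
proof -
  have "cnj (pairing (f t) (m t)) = pairing (f t) (m t)" if "t \<in> {0..T}" for t
    using calB_admissible[OF f] calPM_admissible[OF m] that by (auto simp: admissible_def pairing_real)
  from calB_time_factor[OF g T pairing_measurable[OF f m \<alpha> \<beta>] this pairing_bound(2)[OF f m \<alpha> \<beta>]]
  show "(\<lambda>t k. g t k * pairing (f t) (m t)) \<in> calB T \<beta>"
    "calB_norm T \<beta> (\<lambda>t k. g t k * pairing (f t) (m t))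
      \<le> calB_norm T \<beta> g * (calB_norm T \<beta> f * calPM_norm T \<alpha> m)"
    by auto
qed

text \<open>The three factors are exchanged one at a time, in the order \<open>g\<close>, \<open>f\<close>, \<open>m\<close>.\<close>

lemma nonlocal_product_difference:
  fixes f1 f2 g1 g2 m1 m2 :: "('d::finite) tcoeffs"
  assumes g: "g1 \<in> calB T \<beta>" "g2 \<in> calB T \<beta>" and f: "f1 \<in> calB T \<beta>" "f2 \<in> calB T \<beta>"
    and m: "m1 \<in> calPM T \<alpha>" "m2 \<in> calPM T \<alpha>"
    and \<alpha>: "\<alpha> \<ge> 0" and \<beta>: "\<beta> \<ge> 0" and T: "T \<ge> 0"
  shows "calB_norm T \<beta> ((\<lambda>t k. g1 t k * pairing (f1 t) (m1 t)) - (\<lambda>t k. g2 t k * pairing (f2 t) (m2 t)))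
    \<le> (calB_norm T \<beta> (g1 - g2) * calB_norm T \<beta> f1 + calB_norm T \<beta> g2 * calB_norm T \<beta> (f1 - f2))
        * calPM_norm T \<alpha> m1
      + calB_norm T \<beta> g2 * calB_norm T \<beta> f2 * calPM_norm T \<alpha> (m1 - m2)"
proof -
  let ?h = "\<lambda>g f m t k. g t k * pairing (f t) (m t)"
  let ?N = "calB_norm T \<beta>"
  note mem = nonlocal_product(1)[OF _ _ _ \<alpha> \<beta> T] and le = nonlocal_product(2)[OF _ _ _ \<alpha> \<beta> T]
  have "?N (?h g1 f1 m1 - ?h g2 f2 m2)
      \<le> ?N (?h g1 f1 m1 - ?h g2 f1 m1) + ?N (?h g2 f1 m1 - ?h g2 f2 m2)"
    by (intro calB_norm_triangle mem g f m T)
  also have "?N (?h g2 f1 m1 - ?h g2 f2 m2)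
      \<le> ?N (?h g2 f1 m1 - ?h g2 f2 m1) + ?N (?h g2 f2 m1 - ?h g2 f2 m2)"
    by (intro calB_norm_triangle mem g f m T)
  also have "?N (?h g1 f1 m1 - ?h g2 f1 m1) = ?N (?h (g1 - g2) f1 m1)"
    by (rule calB_norm_cong) (simp add: left_diff_distrib)
  also have "?N (?h g2 f1 m1 - ?h g2 f2 m1) = ?N (?h g2 (f1 - f2) m1)"
    by (rule calB_norm_cong) (simp add: pairing_diff_left[OF f m(1) \<alpha> \<beta>, simplified] right_diff_distrib)
  also have "?N (?h g2 f2 m1 - ?h g2 f2 m2) = ?N (?h g2 f2 (m1 - m2))"
    by (rule calB_norm_cong) (simp add: pairing_diff_right[OF f(2) m \<alpha> \<beta>, simplified] right_diff_distrib)
  also have "?N (?h (g1 - g2) f1 m1) + (?N (?h g2 (f1 - f2) m1) + ?N (?h g2 f2 (m1 - m2)))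
      \<le> ?N (g1 - g2) * (?N f1 * calPM_norm T \<alpha> m1) + (?N g2 * (?N (f1 - f2) * calPM_norm T \<alpha> m1)
        + ?N g2 * (?N f2 * calPM_norm T \<alpha> (m1 - m2)))"
    by (intro add_mono le calPM_diff calB_diff g f m T)
  finally show ?thesis by (simp add: algebra_simps fun_diff_def)
qed


section \<open>The heat semigroup and the Duhamel integrals\<close>

lemma weighted_integrable:
  fixes h :: "real \<Rightarrow> complex" and e :: "real \<Rightarrow> real"
  assumes meas: "h \<in> borel_measurable (lebesgue_on {0..T})"
    and le: "\<And>s. s \<in> {0..T} \<Longrightarrow> cmod (h s) \<le> C" and e: "continuous_on {0..T} e"
  shows "(\<lambda>s. complex_of_real (e s) * h s) integrable_on {0..T}"
proof -
  obtain B where B: "\<And>s. s \<in> {0..T} \<Longrightarrow> \<bar>e s\<bar> \<le> B"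
    using compact_imp_bounded[OF compact_continuous_image[OF e compact_Icc]]
    unfolding bounded_iff by fastforce
  have "(\<lambda>s. complex_of_real (e s)) \<in> borel_measurable (lebesgue_on {0..T})"
    using e by (intro continuous_imp_measurable_on_sets_lebesgue continuous_intros) auto
  from borel_measurable_times[OF this meas] show ?thesis
  proof (rule measurable_bounded_by_integrable_imp_integrable)
    show "(\<lambda>s. B * C) integrable_on {0..T}"
      by (rule integrable_const_ivl)
    show "norm (complex_of_real (e s) * h s) \<le> B * C" if "s \<in> {0..T}" for s
    proof -
      have "0 \<le> B" using B[OF that] by linarith
      then show ?thesis
        using mult_mono[OF B[OF that] le[OF that]] by (simp add: norm_mult)
    qed
  qed auto
qed

lemma exp_kernel_forward:
  fixes l t :: real
  assumes "l > 0" "t \<ge> 0"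
  shows "(\<lambda>s. exp (- l * (t - s))) integrable_on {0..t}" "integral {0..t} (\<lambda>s. exp (- l * (t - s))) \<le> 1 / l"
proof -
  have "((\<lambda>s. exp (- l * (t - s))) has_integral exp (- l * (t - t)) / l - exp (- l * (t - 0)) / l) {0..t}"
    using assms
    by (intro fundamental_theorem_of_calculus)
       (auto intro!: derivative_eq_intros simp flip: has_real_derivative_iff_has_vector_derivative)
  then show "(\<lambda>s. exp (- l * (t - s))) integrable_on {0..t}" "integral {0..t} (\<lambda>s. exp (- l * (t - s))) \<le> 1 / l"
    using assms by (auto simp: has_integral_iff divide_simps)
qed

lemma exp_kernel_backward:
  fixes l t T :: real
  assumes "l > 0" "t \<le> T"
  shows "(\<lambda>s. exp (- l * (s - t))) integrable_on {t..T}" "integral {t..T} (\<lambda>s. exp (- l * (s - t))) \<le> 1 / l"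
proof -
  have "((\<lambda>s. exp (- l * (s - t))) has_integral (- exp (- l * (T - t)) / l) - (- exp (- l * (t - t)) / l)) {t..T}"
    using assms
    by (intro fundamental_theorem_of_calculus)
       (auto intro!: derivative_eq_intros simp flip: has_real_derivative_iff_has_vector_derivative)
  then show "(\<lambda>s. exp (- l * (s - t))) integrable_on {t..T}" "integral {t..T} (\<lambda>s. exp (- l * (s - t))) \<le> 1 / l"
    using assms by (auto simp: has_integral_iff divide_simps)
qed

lemma cmod_heat: "cmod (heat t a k) = exp (- (norm (wv k))\<^sup>2 * t) * cmod (a k)"
  unfolding heat_def norm_mult norm_of_real by simp

lemma heat_diff: "heat t (a - b) k = heat t a k - heat t b k"
  by (simp add: heat_def right_diff_distrib)

lemma heat_real: "real_coeffs a \<Longrightarrow> real_coeffs (heat t a)"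
  by (simp add: real_coeffs_def heat_def wv_uminus)

lemma grad_real: "real_coeffs a \<Longrightarrow> real_coeffs (grad a $ i)"
  by (simp add: real_coeffs_def grad_def)

definition forward :: "('d::finite) tcoeffs \<Rightarrow> 'd tcoeffs" where
  "forward q t k = integral {0..t} (\<lambda>s. heat (t - s) (q s) k)"

definition backward :: "real \<Rightarrow> ('d::finite) tcoeffs \<Rightarrow> 'd tcoeffs" where
  "backward T q t k = integral {t..T} (\<lambda>s. heat (s - t) (q s) k)"

text \<open>
  Boundedness at each frequency makes the Duhamel integrals converge. It is not uniform in the
  frequency, since the integrands contain a derivative.
\<close>

definition bounded_in_time :: "real \<Rightarrow> ('d::finite) tcoeffs \<Rightarrow> bool" where
  "bounded_in_time T q \<longleftrightarrow> admissible T q \<and> (\<forall>k. \<exists>C. \<forall>t\<in>{0..T}. cmod (q t k) \<le> C)"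

lemma forward_integrable:
  assumes "bounded_in_time T q" "t \<in> {0..T}"
  shows "(\<lambda>s. heat (t - s) (q s) k) integrable_on {0..t}"
proof -
  obtain C where C: "\<And>t. t \<in> {0..T} \<Longrightarrow> cmod (q t k) \<le> C"
    using assms(1) unfolding bounded_in_time_def by blast
  have "(\<lambda>s. heat (t - s) (q s) k) integrable_on {0..T}"
    unfolding heat_def
    using assms(1) C by (intro weighted_integrable[OF admissible_measurable]) (auto simp: bounded_in_time_def intro!: continuous_intros)
  then show ?thesis
    by (rule integrable_on_subinterval) (use assms(2) in auto)
qed

lemma backward_integrable:
  assumes "bounded_in_time T q" "t \<in> {0..T}"
  shows "(\<lambda>s. heat (s - t) (q s) k) integrable_on {t..T}"
proof -
  obtain C where C: "\<And>t. t \<in> {0..T} \<Longrightarrow> cmod (q t k) \<le> C"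
    using assms(1) unfolding bounded_in_time_def by blast
  have "(\<lambda>s. heat (s - t) (q s) k) integrable_on {0..T}"
    unfolding heat_def
    using assms(1) C by (intro weighted_integrable[OF admissible_measurable]) (auto simp: bounded_in_time_def intro!: continuous_intros)
  then show ?thesis
    by (rule integrable_on_subinterval) (use assms(2) in auto)
qed

text \<open>
  Splitting the kernel \<open>exp (- |k|\<^sup>2 (t - s))\<close> into a factor in \<open>t\<close> and a factor in \<open>s\<close> exhibits
  the integral as a continuous, hence measurable, function of \<open>t\<close>.
\<close>

lemma forward_admissible:
  fixes q :: "('d::finite) tcoeffs"
  assumes q: "bounded_in_time T q"
  shows "admissible T (forward q)"
  unfolding admissible_def
proof (intro conjI ballI allI)
  fix t assume t: "t \<in> {0..T}"
  have "cnj (heat (t - s) (q s) k) = heat (t - s) (q s) (- k)" if "s \<in> {0..t}" for s k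
    using q t that heat_real[of "q s"] by (auto simp: bounded_in_time_def admissible_def real_coeffs_def)
  then show "real_coeffs (forward q t)"
    unfolding real_coeffs_def forward_def integral_cnj by (auto intro!: integral_cong)
next
  fix k :: "int ^ 'd"
  let ?l = "(norm (wv k))\<^sup>2"
  obtain C where C: "\<And>t. t \<in> {0..T} \<Longrightarrow> cmod (q t k) \<le> C"
    using q unfolding bounded_in_time_def by blast
  let ?h = "\<lambda>s. complex_of_real (exp (?l * s)) * q s k"
  have "?h integrable_on {0..T}"
    using q C by (intro weighted_integrable[OF admissible_measurable]) (auto simp: bounded_in_time_def intro!: continuous_intros)
  then have "continuous_on {0..T} (\<lambda>t. complex_of_real (exp (- ?l * t)) * integral {0..t} ?h)"
    by (intro continuous_intros indefinite_integral_continuous_1)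
  moreover have "forward q t k = complex_of_real (exp (- ?l * t)) * integral {0..t} ?h" for t
  proof -
    have "heat (t - s) (q s) k = complex_of_real (exp (- ?l * t)) * ?h s" for s
    proof -
      have "- ?l * (t - s) = - ?l * t + ?l * s" by (simp add: algebra_simps)
      then show ?thesis by (simp only: heat_def exp_add of_real_mult mult.assoc)
    qed
    then show ?thesis by (simp add: forward_def)
  qed
  ultimately show "(\<lambda>t. forward q t k) \<in> borel_measurable (lebesgue_on {0..T})"
    by (intro continuous_imp_measurable_on_sets_lebesgue) auto
qed

lemma backward_admissible:
  fixes q :: "('d::finite) tcoeffs"
  assumes q: "bounded_in_time T q"
  shows "admissible T (backward T q)"
  unfolding admissible_def
proof (intro conjI ballI allI)
  fix t assume t: "t \<in> {0..T}"
  have "cnj (heat (s - t) (q s) k) = heat (s - t) (q s) (- k)" if "s \<in> {t..T}" for s k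
    using q t that heat_real[of "q s"] by (auto simp: bounded_in_time_def admissible_def real_coeffs_def)
  then show "real_coeffs (backward T q t)"
    unfolding real_coeffs_def backward_def integral_cnj by (auto intro!: integral_cong)
next
  fix k :: "int ^ 'd"
  let ?l = "(norm (wv k))\<^sup>2"
  obtain C where C: "\<And>t. t \<in> {0..T} \<Longrightarrow> cmod (q t k) \<le> C"
    using q unfolding bounded_in_time_def by blast
  let ?h = "\<lambda>s. complex_of_real (exp (- ?l * s)) * q s k"
  have "?h integrable_on {0..T}"
    using q C by (intro weighted_integrable[OF admissible_measurable]) (auto simp: bounded_in_time_def intro!: continuous_intros)
  then have "continuous_on {0..T} (\<lambda>t. complex_of_real (exp (?l * t)) * integral {t..T} ?h)"
    by (intro continuous_intros indefinite_integral_continuous_1')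
  moreover have "backward T q t k = complex_of_real (exp (?l * t)) * integral {t..T} ?h" for t
  proof -
    have "heat (s - t) (q s) k = complex_of_real (exp (?l * t)) * ?h s" for s
    proof -
      have "- ?l * (s - t) = ?l * t + - ?l * s" by (simp add: algebra_simps)
      then show ?thesis by (simp only: heat_def exp_add of_real_mult mult.assoc)
    qed
    then show ?thesis by (simp add: backward_def)
  qed
  ultimately show "(\<lambda>t. backward T q t k) \<in> borel_measurable (lebesgue_on {0..T})"
    by (intro continuous_imp_measurable_on_sets_lebesgue) auto
qed

lemma forward_diff:
  assumes "bounded_in_time T p" "bounded_in_time T q" "t \<in> {0..T}"
  shows "forward p t k - forward q t k = forward (p - q) t k"
  unfolding forward_def minus_apply heat_diff
  by (intro integral_diff[symmetric] forward_integrable[OF _ assms(3)] assms(1,2))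

lemma backward_diff:
  assumes "bounded_in_time T p" "bounded_in_time T q" "t \<in> {0..T}"
  shows "backward T p t k - backward T q t k = backward T (p - q) t k"
  unfolding backward_def minus_apply heat_diff
  by (intro integral_diff[symmetric] backward_integrable[OF _ assms(3)] assms(1,2))

text \<open>
  The weight \<open>exp (\<alpha> t |k|)\<close> at the final time exceeds the one available at time \<open>s\<close> by
  \<open>exp (\<alpha> (t - s) |k|)\<close>, which the heat kernel absorbs: what is left decays at the rate
  \<open>l = |k| (|k| - \<alpha>)\<close>. Its integral compensates the factor \<open>|k|\<close> of the divergence and leaves
  \<open>1 / (|k| - \<alpha>) \<le> 1 / (1 - \<alpha>)\<close>.
\<close>

lemma forward_bound:
  fixes q :: "('d::finite) tcoeffs"
  assumes q: "bounded_in_time T q" and "0 \<le> \<alpha>" "\<alpha> < 1" "T \<ge> 0" "C \<ge> 0"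
    and le: "\<And>t k. t \<in> {0..T} \<Longrightarrow> exp (\<alpha> * t * norm (wv k)) * cmod (q t k) \<le> norm (wv k) * C"
  shows "forward q \<in> calPM T \<alpha>" "calPM_norm T \<alpha> (forward q) \<le> C / (1 - \<alpha>)"
proof -
  have "exp (\<alpha> * t * norm (wv k)) * cmod (forward q t k) \<le> C / (1 - \<alpha>)" if t: "t \<in> {0..T}" for t k
  proof (cases "k = 0")
    case True
    have "q s k = 0" if "s \<in> {0..t}" for s
      using le[of s k] t that True by (simp add: wv_def zero_vec_def[symmetric] mult_le_0_iff)
    then have "forward q t k = integral {0..t} (\<lambda>s. 0)"
      unfolding forward_def heat_def by (intro integral_cong) simp
    then show ?thesis using assms by simp
  next
    case False
    let ?n = "norm (wv k)"
    define l where "l = ?n * (?n - \<alpha>)"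
    have n: "?n \<ge> 1" by (rule norm_wv_ge_1[OF False])
    have l: "l > 0" using n assms unfolding l_def by (intro mult_pos_pos) linarith+
    let ?g = "\<lambda>s. ?n * C * exp (- \<alpha> * t * ?n) * exp (- l * (t - s))"
    have "cmod (heat (t - s) (q s) k) \<le> ?g s" if s: "s \<in> {0..t}" for s
    proof -
      have "cmod (heat (t - s) (q s) k) = exp (- ?n\<^sup>2 * (t - s)) * exp (- (\<alpha> * s * ?n)) * (exp (\<alpha> * s * ?n) * cmod (q s k))"
        by (simp add: cmod_heat exp_minus)
      also have "\<dots> \<le> exp (- ?n\<^sup>2 * (t - s)) * exp (- (\<alpha> * s * ?n)) * (?n * C)"
        using s t by (intro mult_left_mono le) auto
      also have "\<dots> = ?g s"
        by (simp add: l_def power2_eq_square algebra_simps flip: exp_add)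
      finally show ?thesis .
    qed
    then have "cmod (forward q t k) \<le> integral {0..t} ?g"
      unfolding forward_def using t
      by (intro integral_norm_bound_integral forward_integrable[OF q t] integrable_on_mult_right exp_kernel_forward(1)[OF l]) auto
    also have "\<dots> \<le> ?n * C * exp (- \<alpha> * t * ?n) * (1 / l)"
      unfolding integral_mult_right using t assms by (intro mult_left_mono exp_kernel_forward(2)[OF l]) auto
    finally have "exp (\<alpha> * t * ?n) * cmod (forward q t k) \<le> exp (\<alpha> * t * ?n) * (?n * C * exp (- \<alpha> * t * ?n) * (1 / l))"
      by (intro mult_left_mono) auto
    also have "\<dots> = (exp (\<alpha> * t * ?n) * exp (- (\<alpha> * t * ?n))) * (?n * C / l)"
      by simp
    also have "\<dots> = C / (?n - \<alpha>)"
      using n by (subst exp_minus) (auto simp: l_def)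
    also have "\<dots> \<le> C / (1 - \<alpha>)"
      using n assms by (intro divide_left_mono mult_pos_pos) auto
    finally show ?thesis .
  qed
  from calPM_I[OF \<open>T \<ge> 0\<close> forward_admissible[OF q] this]
  show "forward q \<in> calPM T \<alpha>" "calPM_norm T \<alpha> (forward q) \<le> C / (1 - \<alpha>)" by auto
qed

lemma calB_grad_bounded_in_time:
  fixes h :: "('d::finite) tcoeffs"
  assumes h: "h \<in> calB T \<beta>" and "\<beta> \<ge> 0" "T \<ge> 0"
  shows "bounded_in_time T (\<lambda>s. grad (h s) $ i)"
proof -
  have "(\<lambda>s. (grad (h s) $ i) k) \<in> borel_measurable (lebesgue_on {0..T})" for k
    using borel_measurable_times[OF borel_measurable_const[of "\<i> * of_int (k $ i)"] admissible_measurable[OF calB_admissible[OF h], of k]]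
    by (simp add: grad_def)
  then have "admissible T (\<lambda>s. grad (h s) $ i)"
    using calB_admissible[OF h] by (auto simp: admissible_def grad_real)
  moreover have "\<exists>C. \<forall>t\<in>{0..T}. cmod ((grad (h t) $ i) k) \<le> C" for k
    using calB_cmod_le[OF h assms(2), of _ k]
    by (intro exI[of _ "\<bar>real_of_int (k $ i)\<bar> * calB_norm T \<beta> h"])
       (auto simp: grad_def norm_mult intro!: mult_left_mono)
  ultimately show ?thesis by (simp add: bounded_in_time_def)
qed

text \<open>
  The weight of \<open>calB\<close> does not depend on time, so here the whole decay \<open>|k|\<^sup>2\<close> is available
  against the factor \<open>|k|\<close> of the gradient.
\<close>

lemma backward_bound:
  fixes h :: "('d::finite) tcoeffs"
  assumes h: "h \<in> calB T \<beta>" and \<beta>: "\<beta> \<ge> 0" and T: "T \<ge> 0"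
  shows "backward T (\<lambda>s. grad (h s) $ i) \<in> calB T \<beta>"
    "calB_norm T \<beta> (backward T (\<lambda>s. grad (h s) $ i)) \<le> calB_norm T \<beta> h"
proof -
  let ?q = "\<lambda>s. grad (h s) $ i"
  note q = calB_grad_bounded_in_time[OF h \<beta> T, of i]
  obtain a where a: "\<And>t k. t \<in> {0..T} \<Longrightarrow> exp (\<beta> * norm (wv k)) * cmod (h t k) \<le> a k"
    "\<And>k. a k \<ge> 0" "a summable_on UNIV" "infsum a UNIV = calB_norm T \<beta> h"
    using calB_majorant[OF h T] by blast
  have "exp (\<beta> * norm (wv k)) * cmod (backward T ?q t k) \<le> a k" if t: "t \<in> {0..T}" for t k
  proof (cases "k = 0")
    case True
    then have "backward T ?q t k = 0"
      by (simp add: backward_def heat_def grad_def)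
    then show ?thesis using a(2) by simp
  next
    case False
    let ?n = "norm (wv k)"
    let ?w = "exp (\<beta> * ?n)"
    have n: "?n \<ge> 1" by (rule norm_wv_ge_1[OF False])
    then have l: "?n\<^sup>2 > 0" by (intro zero_less_power) linarith
    let ?g = "\<lambda>s. ?n * (a k / ?w) * exp (- ?n\<^sup>2 * (s - t))"
    have "cmod (heat (s - t) (?q s) k) \<le> ?g s" if s: "s \<in> {t..T}" for s
    proof -
      have "cmod (h s k) \<le> a k / ?w"
        using a(1)[of s k] s t by (simp add: field_simps)
      then have "\<bar>real_of_int (k $ i)\<bar> * cmod (h s k) \<le> ?n * (a k / ?w)"
        using a(2) by (intro mult_mono component_le_norm_wv) auto
      then have "exp (- ?n\<^sup>2 * (s - t)) * (\<bar>real_of_int (k $ i)\<bar> * cmod (h s k)) \<le> exp (- ?n\<^sup>2 * (s - t)) * (?n * (a k / ?w))"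
        by (intro mult_left_mono) auto
      then show ?thesis
        by (simp add: heat_def grad_def norm_mult mult_ac)
    qed
    then have "cmod (backward T ?q t k) \<le> integral {t..T} ?g"
      unfolding backward_def using t
      by (intro integral_norm_bound_integral backward_integrable[OF q t] integrable_on_mult_right exp_kernel_backward(1)[OF l]) auto
    also have "\<dots> \<le> ?n * (a k / ?w) * (1 / ?n\<^sup>2)"
      unfolding integral_mult_right using t a(2) by (intro mult_left_mono exp_kernel_backward(2)[OF l]) auto
    finally have "?w * cmod (backward T ?q t k) \<le> ?w * (?n * (a k / ?w) * (1 / ?n\<^sup>2))"
      by (intro mult_left_mono) auto
    also have "\<dots> = a k / ?n"
      using n by (auto simp: power2_eq_square)
    also have "\<dots> \<le> a k / 1"
      using n a(2) by (intro divide_left_mono) auto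
    finally show ?thesis by simp
  qed
  from calB_majorized[OF T backward_admissible[OF q] this a(3)] a(4)
  show "backward T ?q \<in> calB T \<beta>" "calB_norm T \<beta> (backward T ?q) \<le> calB_norm T \<beta> h" by auto
qed

lemma heat_cmod_le: "t \<ge> 0 \<Longrightarrow> cmod (heat t a k) \<le> cmod (a k)"
  by (auto simp: heat_def norm_mult intro!: mult_left_le_one_le)

lemma heat_flow_measurable:
  fixes \<tau> :: "real \<Rightarrow> real"
  shows "continuous_on UNIV \<tau> \<Longrightarrow> (\<lambda>t. heat (\<tau> t) a k) \<in> borel_measurable (lebesgue_on {0..T})"
  unfolding heat_def
  by (intro continuous_imp_measurable_on_sets_lebesgue continuous_intros) (auto intro: continuous_on_subset)

lemma terminal_bound:
  fixes a :: "('d::finite) coeffs"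
  assumes real: "real_coeffs a"
    and summ: "(\<lambda>k. (1 + norm (wv k)) * exp (\<beta> * norm (wv k)) * cmod (a k)) summable_on UNIV"
    and T: "T \<ge> 0"
  shows "(\<lambda>t. heat (T - t) (grad a $ i)) \<in> calB T \<beta>"
    "calB_norm T \<beta> (\<lambda>t. heat (T - t) (grad a $ i)) \<le> B1_norm \<beta> a"
proof -
  have adm: "admissible T (\<lambda>t. heat (T - t) (grad a $ i))"
    using real by (auto simp: admissible_def heat_real grad_real intro!: heat_flow_measurable continuous_intros)
  have "exp (\<beta> * norm (wv k)) * cmod (heat (T - t) (grad a $ i) k)
      \<le> (1 + norm (wv k)) * exp (\<beta> * norm (wv k)) * cmod (a k)" if t: "t \<in> {0..T}" for t k
  proof -
    have "cmod (heat (T - t) (grad a $ i) k) \<le> cmod ((grad a $ i) k)"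
      using t by (intro heat_cmod_le) auto
    also have "\<dots> = \<bar>real_of_int (k $ i)\<bar> * cmod (a k)"
      by (simp add: grad_def norm_mult)
    also have "\<dots> \<le> (1 + norm (wv k)) * cmod (a k)"
      using component_le_norm_wv[of k i] by (intro mult_right_mono) auto
    finally have "exp (\<beta> * norm (wv k)) * cmod (heat (T - t) (grad a $ i) k)
        \<le> exp (\<beta> * norm (wv k)) * ((1 + norm (wv k)) * cmod (a k))"
      by (intro mult_left_mono) auto
    then show ?thesis by (simp add: mult_ac)
  qed
  from calB_majorized[OF T adm this summ]
  show "(\<lambda>t. heat (T - t) (grad a $ i)) \<in> calB T \<beta>"
    "calB_norm T \<beta> (\<lambda>t. heat (T - t) (grad a $ i)) \<le> B1_norm \<beta> a"
    by (auto simp: B1_norm_def)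
qed

lemma B1_diff_summable:
  fixes a b :: "('d::finite) coeffs"
  assumes "a \<in> B1 \<beta>" "b \<in> B1 \<beta>"
  shows "(\<lambda>k. (1 + norm (wv k)) * exp (\<beta> * norm (wv k)) * cmod ((a - b) k)) summable_on UNIV"
proof -
  let ?w = "\<lambda>k :: int ^ 'd. (1 + norm (wv k)) * exp (\<beta> * norm (wv k))"
  have "(\<lambda>k. ?w k * cmod (a k) + ?w k * cmod (b k)) summable_on UNIV"
    using assms by (intro summable_on_add) (auto simp: B1_def)
  then show ?thesis
  proof (rule summable_on_comparison_test)
    show "?w k * cmod ((a - b) k) \<le> ?w k * cmod (a k) + ?w k * cmod (b k)" for k
      unfolding distrib_left[symmetric] by (intro mult_left_mono) (auto simp: norm_triangle_ineq4)
  qed auto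
qed

text \<open>
  The heat semigroup turns coefficients that are merely bounded into ones that decay like
  \<open>exp (- \<alpha> t |k|)\<close>, because \<open>|k|\<^sup>2 \<ge> \<alpha> |k|\<close> for every integer frequency.
\<close>

lemma heat_free_bound:
  fixes a :: "('d::finite) coeffs"
  assumes a: "a \<in> PM 0" and \<alpha>: "0 \<le> \<alpha>" "\<alpha> < 1" and T: "T \<ge> 0"
  shows "(\<lambda>t. heat t a) \<in> calPM T \<alpha>" "calPM_norm T \<alpha> (\<lambda>t. heat t a) \<le> PM_norm 0 a"
proof -
  have adm: "admissible T (\<lambda>t. heat t a)"
    using a by (auto simp: admissible_def PM_def heat_real intro!: heat_flow_measurable continuous_intros)
  have "exp (\<alpha> * t * norm (wv k)) * cmod (heat t a k) \<le> PM_norm 0 a" if t: "t \<in> {0..T}" for t k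
  proof -
    let ?n = "norm (wv k)"
    have "\<alpha> * ?n \<le> ?n\<^sup>2"
    proof (cases "k = 0")
      case False
      have "\<alpha> * ?n \<le> ?n * ?n"
        using norm_wv_ge_1[OF False] \<alpha> by (intro mult_right_mono) auto
      then show ?thesis by (simp add: power2_eq_square)
    qed (simp add: wv_def zero_vec_def[symmetric])
    then have "(\<alpha> * ?n) * t \<le> ?n\<^sup>2 * t" using t by (intro mult_right_mono) auto
    then have "exp (\<alpha> * t * ?n - ?n\<^sup>2 * t) * cmod (a k) \<le> 1 * cmod (a k)"
      by (intro mult_right_mono) (auto simp: mult_ac)
    also have "\<dots> \<le> PM_norm 0 a"
      using PM_norm_le[OF a, of k] by simp
    finally show ?thesis by (simp add: cmod_heat exp_diff exp_minus divide_inverse mult_ac)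
  qed
  from calPM_I[OF T adm this]
  show "(\<lambda>t. heat t a) \<in> calPM T \<alpha>" "calPM_norm T \<alpha> (\<lambda>t. heat t a) \<le> PM_norm 0 a" by auto
qed

lemma divergence_bound:
  fixes u :: "'d \<Rightarrow> ('d::finite) tcoeffs"
  assumes u: "\<And>i. u i \<in> calPM T \<alpha>" and \<alpha>: "\<alpha> \<ge> 0" and T: "T \<ge> 0"
  shows "bounded_in_time T (\<lambda>s. dvg (\<chi> i. u i s))"
    "\<And>t k. t \<in> {0..T} \<Longrightarrow> exp (\<alpha> * t * norm (wv k)) * cmod (dvg (\<chi> i. u i t) k)
      \<le> norm (wv k) * (\<Sum>i\<in>UNIV. calPM_norm T \<alpha> (u i))"
proof -
  show le: "exp (\<alpha> * t * norm (wv k)) * cmod (dvg (\<chi> i. u i t) k)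
      \<le> norm (wv k) * (\<Sum>i\<in>UNIV. calPM_norm T \<alpha> (u i))" if t: "t \<in> {0..T}" for t k
  proof -
    have "exp (\<alpha> * t * norm (wv k)) * cmod (dvg (\<chi> i. u i t) k)
        \<le> exp (\<alpha> * t * norm (wv k)) * (\<Sum>i\<in>UNIV. norm (wv k) * cmod (u i t k))"
      unfolding dvg_def
      by (intro mult_left_mono sum_norm_le) (auto simp: norm_mult intro!: mult_right_mono component_le_norm_wv)
    also have "\<dots> = norm (wv k) * (\<Sum>i\<in>UNIV. exp (\<alpha> * t * norm (wv k)) * cmod (u i t k))"
      by (simp add: sum_distrib_left mult_ac)
    also have "\<dots> \<le> norm (wv k) * (\<Sum>i\<in>UNIV. calPM_norm T \<alpha> (u i))"
      by (intro mult_left_mono sum_mono calPM_le[OF u t]) auto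
    finally show ?thesis .
  qed
  have "(\<lambda>s. dvg (\<chi> i. u i s) k) \<in> borel_measurable (lebesgue_on {0..T})" for k
    unfolding dvg_def using borel_measurable_times[OF borel_measurable_const admissible_measurable[OF calPM_admissible[OF u]]]
    by (intro borel_measurable_sum) auto
  moreover have "real_coeffs (dvg (\<chi> i. u i s))" if "s \<in> {0..T}" for s
    using calPM_admissible[OF u] that
    by (auto simp: real_coeffs_def dvg_def admissible_def intro!: sum.cong)
  moreover have "cmod (dvg (\<chi> i. u i t) k) \<le> norm (wv k) * (\<Sum>i\<in>UNIV. calPM_norm T \<alpha> (u i))"
    if t: "t \<in> {0..T}" for t k
  proof -
    have "1 * cmod (dvg (\<chi> i. u i t) k) \<le> exp (\<alpha> * t * norm (wv k)) * cmod (dvg (\<chi> i. u i t) k)"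
      using t \<alpha> by (intro mult_right_mono) auto
    then show ?thesis using le[OF t, of k] by simp
  qed
  ultimately show "bounded_in_time T (\<lambda>s. dvg (\<chi> i. u i s))"
    unfolding bounded_in_time_def admissible_def by blast
qed

lemma dvg_diff: "dvg (\<chi> i. u i) k - dvg (\<chi> i. w i) k = dvg (\<chi> i. u i - w i) k"
  by (simp add: dvg_def right_diff_distrib sum_subtractf)

lemma grad_diff: "(grad a $ i) - (grad b $ i) = grad (a - b) $ i"
  by (auto simp: grad_def right_diff_distrib)


section \<open>The solution map\<close>

text \<open>
  The numbers that govern the contraction. On the region, \<open>A1\<close>, \<open>A2\<close> bound the Hamiltonian products,
  \<open>L1\<close>, \<open>L2\<close> their Lipschitz constants in \<open>v\<close>, and \<open>\<gamma>\<close>, \<open>\<Lambda>\<close> the size and the Lipschitz constant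
  of the payoff; \<open>K\<close> is the weight of the \<open>m\<close>-component. The conditions \<open>into_v\<close>, \<open>into_m\<close> send the
  region well inside itself. In \<open>contract_v\<close> and \<open>contract_m\<close> the Lipschitz constants of both
  components with respect to \<open>v\<close> and to \<open>m\<close> are collected; that of the payoff occurs without a
  factor \<open>K\<close> on the left, which is why a large \<open>K\<close> helps.
\<close>

locale contraction_setting =
  fixes T \<alpha> :: real and m0 :: "('d::finite) coeffs"
    and f1 f2 g1 :: "real ^ 'd \<Rightarrow> real" and g2 :: "real ^ 'd \<Rightarrow> real ^ 'd"
    and G :: "'d coeffs \<Rightarrow> 'd coeffs"
    and r M A1 A2 L1 L2 \<gamma> \<Lambda> K :: real
  assumes T: "T > 0" and \<alpha>: "0 \<le> \<alpha>" "\<alpha> < 1" and m0: "m0 \<in> PM 0"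
    and r: "r > 0" and M: "M = PM_norm 0 m0 + 1" and K: "K > 0"
    and f1: "\<And>v. v \<in> calBv T (\<alpha> * T) \<Longrightarrow> compose f1 v \<in> calB T (\<alpha> * T)"
    and f2: "\<And>v. v \<in> calBv T (\<alpha> * T) \<Longrightarrow> compose f2 v \<in> calB T (\<alpha> * T)"
    and g1: "\<And>v. v \<in> calBv T (\<alpha> * T) \<Longrightarrow> compose g1 v \<in> calB T (\<alpha> * T)"
    and g2: "\<And>v. v \<in> calBv T (\<alpha> * T) \<Longrightarrow> compose_vec g2 v \<in> calBv T (\<alpha> * T)"
    and size1: "\<And>v. v \<in> calBv T (\<alpha> * T) \<Longrightarrow> calBv_norm T (\<alpha> * T) v \<le> r \<Longrightarrow>
      calB_norm T (\<alpha> * T) (compose g1 v) * calB_norm T (\<alpha> * T) (compose f1 v) \<le> A1"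
    and size2: "\<And>v. v \<in> calBv T (\<alpha> * T) \<Longrightarrow> calBv_norm T (\<alpha> * T) v \<le> r \<Longrightarrow>
      calBv_norm T (\<alpha> * T) (compose_vec g2 v) * calB_norm T (\<alpha> * T) (compose f2 v) \<le> A2"
    and lip1: "\<And>v w. v \<in> calBv T (\<alpha> * T) \<Longrightarrow> calBv_norm T (\<alpha> * T) v \<le> r \<Longrightarrow>
        w \<in> calBv T (\<alpha> * T) \<Longrightarrow> calBv_norm T (\<alpha> * T) w \<le> r \<Longrightarrow>
      calB_norm T (\<alpha> * T) (compose g1 v - compose g1 w) * calB_norm T (\<alpha> * T) (compose f1 v)
      + calB_norm T (\<alpha> * T) (compose g1 w) * calB_norm T (\<alpha> * T) (compose f1 v - compose f1 w)
        \<le> L1 * calBv_norm T (\<alpha> * T) (v - w)"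
    and lip2: "\<And>v w. v \<in> calBv T (\<alpha> * T) \<Longrightarrow> calBv_norm T (\<alpha> * T) v \<le> r \<Longrightarrow>
        w \<in> calBv T (\<alpha> * T) \<Longrightarrow> calBv_norm T (\<alpha> * T) w \<le> r \<Longrightarrow>
      calBv_norm T (\<alpha> * T) (compose_vec g2 v - compose_vec g2 w) * calB_norm T (\<alpha> * T) (compose f2 v)
      + calBv_norm T (\<alpha> * T) (compose_vec g2 w) * calB_norm T (\<alpha> * T) (compose f2 v - compose f2 w)
        \<le> L2 * calBv_norm T (\<alpha> * T) (v - w)"
    and G_mem: "\<And>a. a \<in> PM (\<alpha> * T) \<Longrightarrow> G a \<in> B1 (\<alpha> * T)"
    and G_size: "\<And>a. a \<in> PM (\<alpha> * T) \<Longrightarrow> PM_norm (\<alpha> * T) a \<le> M \<Longrightarrow> B1_norm (\<alpha> * T) (G a) \<le> \<gamma>"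
    and G_lip: "\<And>a b. a \<in> PM (\<alpha> * T) \<Longrightarrow> PM_norm (\<alpha> * T) a \<le> M \<Longrightarrow>
        b \<in> PM (\<alpha> * T) \<Longrightarrow> PM_norm (\<alpha> * T) b \<le> M \<Longrightarrow>
      B1_norm (\<alpha> * T) (G a - G b) \<le> \<Lambda> * PM_norm (\<alpha> * T) (a - b)"
    and \<Lambda>: "\<Lambda> \<ge> 0"
    and into_v: "CARD('d) * (\<gamma> + A1 * M) \<le> r / 2"
    and into_m: "A2 * M\<^sup>2 / (1 - \<alpha>) \<le> 1 / 2"
    and contract_v: "CARD('d) * (L1 * M) + K * (M\<^sup>2 * L2 / (1 - \<alpha>)) \<le> 1 / 2"
    and contract_m: "CARD('d) * (\<Lambda> + A1) + K * (2 * M * A2 / (1 - \<alpha>)) \<le> K / 2"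
begin

lemma T0: "T \<ge> 0" using T by simp

lemma \<alpha>T: "\<alpha> * T \<ge> 0" using T \<alpha> by simp

abbreviation nB :: "'d tcoeffs \<Rightarrow> real" where "nB \<equiv> calB_norm T (\<alpha> * T)"
abbreviation nV :: "'d tcoeffs ^ 'd \<Rightarrow> real" where "nV \<equiv> calBv_norm T (\<alpha> * T)"
abbreviation nM :: "'d tcoeffs \<Rightarrow> real" where "nM \<equiv> calPM_norm T \<alpha>"

definition ball_v :: "('d tcoeffs ^ 'd) set" where
  "ball_v = {v \<in> calBv T (\<alpha> * T). nV v \<le> r}"

definition ball_m :: "'d tcoeffs set" where
  "ball_m = {m \<in> calPM T \<alpha>. nM m \<le> M}"

lemma ball_vD: "v \<in> ball_v \<Longrightarrow> v \<in> calBv T (\<alpha> * T)" "v \<in> ball_v \<Longrightarrow> nV v \<le> r"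
  by (auto simp: ball_v_def)

lemma ball_mD: "m \<in> ball_m \<Longrightarrow> m \<in> calPM T \<alpha>" "m \<in> ball_m \<Longrightarrow> nM m \<le> M"
  by (auto simp: ball_m_def)

lemma M_ge_1: "M \<ge> 1"
  using heat_free_bound[OF m0 \<alpha> T0] calPM_norm_nonneg[OF heat_free_bound(1)[OF m0 \<alpha> T0] T0] M by linarith

lemma nonneg_factors:
  assumes "v \<in> ball_v"
  shows "nB (compose f1 v) \<ge> 0" "nB (compose f2 v) \<ge> 0" "nB (compose g1 v) \<ge> 0" "nV (compose_vec g2 v) \<ge> 0"
  using ball_vD[OF assms] f1 f2 g1 g2 by (auto intro: calB_norm_nonneg calBv_norm_nonneg T0)

lemma A1_A2_nonneg: "A1 \<ge> 0" "A2 \<ge> 0"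
proof -
  have "nV (\<chi> i. (\<lambda>t k. 0)) = 0"
    by (simp add: calBv_norm_def calB_norm_def T0)
  moreover have "(\<chi> i. (\<lambda>t k. 0)) \<in> calBv T (\<alpha> * T)"
    by (auto simp: calBv_def admissible_def real_coeffs_def intro!: calB_I[OF T0, of _ _ 0])
  \<comment> \<open>evaluating the bounds at \<open>v = 0\<close> suffices\<close>
  ultimately have z: "(\<chi> i. (\<lambda>t k. 0)) \<in> ball_v"
    using r by (simp add: ball_v_def)
  note n = nonneg_factors[OF z]
  show "A1 \<ge> 0"
    using order_trans[OF mult_nonneg_nonneg[OF n(3,1)] size1[OF ball_vD[OF z]]] .
  show "A2 \<ge> 0"
    using order_trans[OF mult_nonneg_nonneg[OF n(4,2)] size2[OF ball_vD[OF z]]] .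
qed

definition flux :: "'d tcoeffs ^ 'd \<Rightarrow> 'd tcoeffs \<Rightarrow> 'd \<Rightarrow> 'd tcoeffs" where
  "flux v m i t = conv (m t) ((Ham_vec f2 g2 v m $ i) t)"

definition \<Phi>\<^sub>m :: "'d tcoeffs ^ 'd \<Rightarrow> 'd tcoeffs \<Rightarrow> 'd tcoeffs" where
  "\<Phi>\<^sub>m v m t k = heat t m0 k - forward (\<lambda>s. dvg (\<chi> i. flux v m i s)) t k"

definition \<Phi>\<^sub>v :: "'d tcoeffs ^ 'd \<Rightarrow> 'd tcoeffs \<Rightarrow> 'd tcoeffs ^ 'd" where
  "\<Phi>\<^sub>v v m = (\<chi> i. (\<lambda>t k. heat (T - t) (grad (G (m T)) $ i) k
     + backward T (\<lambda>s. grad (Ham f1 g1 v m s) $ i) t k))"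

lemma mild_solution_iff_fixed_point:
  "mild_solution T \<alpha> m0 f1 f2 g1 g2 G v m \<longleftrightarrow>
     v \<in> calBv T (\<alpha> * T) \<and> m \<in> calPM T \<alpha> \<and>
     (\<forall>t\<in>{0..T}. \<forall>k. m t k = \<Phi>\<^sub>m v m t k) \<and>
     (\<forall>t\<in>{0..T}. \<forall>k. \<forall>i. (v $ i) t k = (\<Phi>\<^sub>v v m $ i) t k)"
  by (simp add: mild_solution_def \<Phi>\<^sub>m_def \<Phi>\<^sub>v_def flux_def forward_def backward_def)

lemma Ham_bound:
  assumes "v \<in> ball_v" "m \<in> ball_m"
  shows "Ham f1 g1 v m \<in> calB T (\<alpha> * T)" "nB (Ham f1 g1 v m) \<le> A1 * M"
proof -
  note v = ball_vD[OF assms(1)] and m = ball_mD[OF assms(2)]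
  have eq: "Ham f1 g1 v m = (\<lambda>t k. compose g1 v t k * pairing (compose f1 v t) (m t))"
    by (simp add: Ham_def fun_eq_iff)
  note H = nonlocal_product[OF g1[OF v(1)] f1[OF v(1)] m(1) \<alpha>(1) \<alpha>T T0]
  show "Ham f1 g1 v m \<in> calB T (\<alpha> * T)" using H(1) by (simp add: eq)
  have "nB (Ham f1 g1 v m) \<le> (nB (compose g1 v) * nB (compose f1 v)) * nM m"
    using H(2) by (simp add: eq mult.assoc)
  also have "\<dots> \<le> A1 * M"
    by (intro mult_mono size1 v m A1_A2_nonneg calPM_norm_nonneg T0)
  finally show "nB (Ham f1 g1 v m) \<le> A1 * M" .
qed

lemma Ham_difference:
  assumes "v \<in> ball_v" "w \<in> ball_v" "m \<in> ball_m" "n \<in> ball_m"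
  shows "nB (Ham f1 g1 v m - Ham f1 g1 w n) \<le> L1 * M * nV (v - w) + A1 * nM (m - n)"
proof -
  note v = ball_vD[OF assms(1)] and w = ball_vD[OF assms(2)]
    and m = ball_mD[OF assms(3)] and n = ball_mD[OF assms(4)]
  have eq: "Ham f1 g1 v m = (\<lambda>t k. compose g1 v t k * pairing (compose f1 v t) (m t))" for v m
    by (simp add: Ham_def fun_eq_iff)
  have "nB (Ham f1 g1 v m - Ham f1 g1 w n)
      \<le> (nB (compose g1 v - compose g1 w) * nB (compose f1 v) + nB (compose g1 w) * nB (compose f1 v - compose f1 w)) * nM m
        + nB (compose g1 w) * nB (compose f1 w) * nM (m - n)"
    unfolding eq by (intro nonlocal_product_difference g1 f1 v w m n \<alpha> \<alpha>T T0)
  also have "\<dots> \<le> (L1 * nV (v - w)) * M + A1 * nM (m - n)"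
  proof (intro add_mono mult_mono lip1 size1 v w m calPM_norm_nonneg calPM_diff n T0 A1_A2_nonneg order_refl)
    have "0 \<le> nB (compose g1 v - compose g1 w) * nB (compose f1 v) + nB (compose g1 w) * nB (compose f1 v - compose f1 w)"
      by (intro add_nonneg_nonneg mult_nonneg_nonneg calB_norm_nonneg calB_diff f1 g1 v w T0)
    then show "0 \<le> L1 * nV (v - w)" using lip1[OF v w] by linarith
  qed
  finally show ?thesis by (simp add: mult_ac)
qed

lemma Ham_vec_component:
  "Ham_vec f2 g2 v m $ i = (\<lambda>t k. (compose_vec g2 v $ i) t k * pairing (compose f2 v t) (m t))"
  by (simp add: Ham_vec_def)

lemma Ham_vec_bound:
  assumes "v \<in> ball_v" "m \<in> ball_m"
  shows "Ham_vec f2 g2 v m $ i \<in> calB T (\<alpha> * T)" "nV (Ham_vec f2 g2 v m) \<le> A2 * M"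
proof -
  note v = ball_vD[OF assms(1)] and m = ball_mD[OF assms(2)]
  have g: "compose_vec g2 v $ i \<in> calB T (\<alpha> * T)" for i
    using g2[OF v(1)] by (simp add: calBv_def)
  note H = nonlocal_product[OF g f2[OF v(1)] m(1) \<alpha>(1) \<alpha>T T0]
  show "Ham_vec f2 g2 v m $ i \<in> calB T (\<alpha> * T)" using H(1) by (simp add: Ham_vec_component)
  have "nV (Ham_vec f2 g2 v m) \<le> (\<Sum>i\<in>UNIV. nB (compose_vec g2 v $ i) * (nB (compose f2 v) * nM m))"
    unfolding calBv_norm_def Ham_vec_component by (intro sum_mono H(2))
  also have "\<dots> = (nV (compose_vec g2 v) * nB (compose f2 v)) * nM m"
    by (simp add: calBv_norm_def sum_distrib_right mult.assoc)
  also have "\<dots> \<le> A2 * M"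
    by (intro mult_mono size2 v m A1_A2_nonneg calPM_norm_nonneg T0)
  finally show "nV (Ham_vec f2 g2 v m) \<le> A2 * M" .
qed

lemma Ham_vec_difference:
  assumes "v \<in> ball_v" "w \<in> ball_v" "m \<in> ball_m" "n \<in> ball_m"
  shows "nV (Ham_vec f2 g2 v m - Ham_vec f2 g2 w n) \<le> L2 * M * nV (v - w) + A2 * nM (m - n)"
proof -
  note v = ball_vD[OF assms(1)] and w = ball_vD[OF assms(2)]
    and m = ball_mD[OF assms(3)] and n = ball_mD[OF assms(4)]
  have g: "compose_vec g2 v $ i \<in> calB T (\<alpha> * T)" "compose_vec g2 w $ i \<in> calB T (\<alpha> * T)" for i
    using g2[OF v(1)] g2[OF w(1)] by (simp_all add: calBv_def)
  let ?D = "\<lambda>i. nB (compose_vec g2 v $ i - compose_vec g2 w $ i)" and ?N = "\<lambda>i. nB (compose_vec g2 w $ i)"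
  have "nV (Ham_vec f2 g2 v m - Ham_vec f2 g2 w n)
      \<le> (\<Sum>i\<in>UNIV. (?D i * nB (compose f2 v) + ?N i * nB (compose f2 v - compose f2 w)) * nM m
        + ?N i * nB (compose f2 w) * nM (m - n))"
    unfolding calBv_norm_def vector_minus_component Ham_vec_component
    by (intro sum_mono nonlocal_product_difference g f2 v w m n \<alpha> \<alpha>T T0)
  also have "\<dots> = (nV (compose_vec g2 v - compose_vec g2 w) * nB (compose f2 v)
        + nV (compose_vec g2 w) * nB (compose f2 v - compose f2 w)) * nM m
        + nV (compose_vec g2 w) * nB (compose f2 w) * nM (m - n)"
    by (simp add: calBv_norm_def sum.distrib sum_distrib_right distrib_right)
  also have "\<dots> \<le> (L2 * nV (v - w)) * M + A2 * nM (m - n)"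
  proof (intro add_mono mult_mono lip2 size2 v w m calPM_norm_nonneg calPM_diff n T0 A1_A2_nonneg order_refl)
    have "0 \<le> nV (compose_vec g2 v - compose_vec g2 w) * nB (compose f2 v)
        + nV (compose_vec g2 w) * nB (compose f2 v - compose f2 w)"
      by (intro add_nonneg_nonneg mult_nonneg_nonneg calB_norm_nonneg calBv_norm_nonneg
          calB_diff calBv_diff f2 g2 v w T0)
    then show "0 \<le> L2 * nV (v - w)" using lip2[OF v w] by linarith
  qed
  finally show ?thesis by (simp add: mult_ac)
qed

lemma flux_bound:
  assumes "v \<in> ball_v" "m \<in> ball_m"
  shows "flux v m i \<in> calPM T \<alpha>" "(\<Sum>i\<in>UNIV. nM (flux v m i)) \<le> A2 * M\<^sup>2"
proof -
  note m = ball_mD[OF assms(2)]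
  have eq: "flux v m i = (\<lambda>t. conv (m t) ((Ham_vec f2 g2 v m $ i) t))" for i
    by (simp add: flux_def fun_eq_iff)
  note c = conv_calPM[OF m(1) Ham_vec_bound(1)[OF assms] \<alpha>(1) T0]
  show "flux v m i \<in> calPM T \<alpha>" using c(1) by (simp add: eq)
  have "(\<Sum>i\<in>UNIV. nM (flux v m i)) \<le> nM m * nV (Ham_vec f2 g2 v m)"
    unfolding eq calBv_norm_def sum_distrib_left by (intro sum_mono c(2))
  also have "\<dots> \<le> M * (A2 * M)"
    using M_ge_1 by (intro mult_mono m(2) Ham_vec_bound(2)[OF assms])
      (auto intro!: calBv_norm_nonneg T0 simp: calBv_def Ham_vec_bound(1)[OF assms])
  finally show "(\<Sum>i\<in>UNIV. nM (flux v m i)) \<le> A2 * M\<^sup>2"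
    by (simp add: power2_eq_square mult_ac)
qed

lemma flux_difference:
  assumes "v \<in> ball_v" "w \<in> ball_v" "m \<in> ball_m" "n \<in> ball_m"
  shows "(\<Sum>i\<in>UNIV. nM (flux v m i - flux w n i)) \<le> M\<^sup>2 * L2 * nV (v - w) + 2 * M * A2 * nM (m - n)"
proof -
  note m = ball_mD[OF assms(3)] and n = ball_mD[OF assms(4)]
  have eq: "flux v m i = (\<lambda>t. conv (m t) ((Ham_vec f2 g2 v m $ i) t))" for v m i
    by (simp add: flux_def fun_eq_iff)
  note Hv = Ham_vec_bound[OF assms(1,3)] and Hw = Ham_vec_bound[OF assms(2,4)]
  have "(\<Sum>i\<in>UNIV. nM (flux v m i - flux w n i)) \<le>
      (\<Sum>i\<in>UNIV. nM (m - n) * nB (Ham_vec f2 g2 v m $ i)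
        + nM n * nB (Ham_vec f2 g2 v m $ i - Ham_vec f2 g2 w n $ i))"
    unfolding eq by (intro sum_mono conv_difference m n Hv(1) Hw(1) \<alpha> T0)
  also have "\<dots> = nM (m - n) * nV (Ham_vec f2 g2 v m) + nM n * nV (Ham_vec f2 g2 v m - Ham_vec f2 g2 w n)"
    by (simp add: calBv_norm_def sum.distrib sum_distrib_left)
  also have "\<dots> \<le> nM (m - n) * (A2 * M) + M * (L2 * M * nV (v - w) + A2 * nM (m - n))"
    using M_ge_1
    by (intro add_mono mult_mono Hv(2) n(2) Ham_vec_difference assms calPM_norm_nonneg calPM_diff m(1) n(1) T0
        calBv_norm_nonneg calBv_diff order_refl) (auto simp: calBv_def Hv(1) Hw(1))
  finally show ?thesis by (simp add: power2_eq_square algebra_simps)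
qed

lemma \<Phi>\<^sub>m_into:
  assumes "v \<in> ball_v" "m \<in> ball_m"
  shows "\<Phi>\<^sub>m v m \<in> calPM T \<alpha>" "nM (\<Phi>\<^sub>m v m) \<le> M - 1 / 2"
proof -
  let ?q = "\<lambda>s. dvg (\<chi> i. flux v m i s)" and ?C = "\<Sum>i\<in>UNIV. nM (flux v m i)"
  note q = divergence_bound[OF flux_bound(1)[OF assms] \<alpha>(1) T0]
  have C: "?C \<ge> 0"
    by (intro sum_nonneg calPM_norm_nonneg flux_bound(1) assms T0)
  note F = forward_bound[OF q(1) \<alpha> T0 C q(2)]
  note H = heat_free_bound[OF m0 \<alpha> T0]
  have eq: "\<Phi>\<^sub>m v m = (\<lambda>t. heat t m0) - forward ?q"
    by (simp add: \<Phi>\<^sub>m_def fun_eq_iff)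
  show "\<Phi>\<^sub>m v m \<in> calPM T \<alpha>"
    unfolding eq by (intro calPM_diff H F T0)
  have "nM (\<Phi>\<^sub>m v m) \<le> nM (\<lambda>t. heat t m0) + nM (forward ?q)"
    unfolding eq by (intro calPM_diff H F T0)
  also have "nM (forward ?q) \<le> A2 * M\<^sup>2 / (1 - \<alpha>)"
    using F(2) divide_right_mono[OF flux_bound(2)[OF assms], of "1 - \<alpha>"] \<alpha> by linarith
  finally show "nM (\<Phi>\<^sub>m v m) \<le> M - 1 / 2"
    using H(2) into_m M by linarith
qed

lemma \<Phi>\<^sub>m_difference:
  assumes "v \<in> ball_v" "w \<in> ball_v" "m \<in> ball_m" "n \<in> ball_m"
  shows "nM (\<Phi>\<^sub>m v m - \<Phi>\<^sub>m w n) \<le> M\<^sup>2 * L2 / (1 - \<alpha>) * nV (v - w) + 2 * M * A2 / (1 - \<alpha>) * nM (m - n)"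
proof -
  let ?q = "\<lambda>v m s. dvg (\<chi> i. flux v m i s)" and ?d = "\<lambda>i. flux w n i - flux v m i"
  let ?C = "\<Sum>i\<in>UNIV. nM (flux v m i - flux w n i)"
  have d: "?d i \<in> calPM T \<alpha>" for i
    by (intro calPM_diff flux_bound(1) assms T0)
  note q = divergence_bound[where u = ?d, OF d \<alpha>(1) T0]
  have C: "?C \<ge> 0"
    by (intro sum_nonneg calPM_norm_nonneg calPM_diff flux_bound(1) assms T0)
  have "(\<Sum>i\<in>UNIV. nM (?d i)) = ?C"
    by (intro sum.cong calPM_norm_minus_commute refl)
  note F = forward_bound[OF q(1) \<alpha> T0 C q(2)[unfolded this]]
  have "(\<Phi>\<^sub>m v m - \<Phi>\<^sub>m w n) t k = forward (\<lambda>s. dvg (\<chi> i. ?d i s)) t k" if t: "t \<in> {0..T}" for t k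
  proof -
    have "?q w n - ?q v m = (\<lambda>s. dvg (\<chi> i. ?d i s))"
      by (simp add: fun_eq_iff dvg_diff fun_diff_def)
    then show ?thesis
      using forward_diff[OF divergence_bound(1)[OF flux_bound(1)[OF assms(2,4)] \<alpha>(1) T0]
          divergence_bound(1)[OF flux_bound(1)[OF assms(1,3)] \<alpha>(1) T0] t, where k = k]
      by (simp add: \<Phi>\<^sub>m_def)
  qed
  then have "nM (\<Phi>\<^sub>m v m - \<Phi>\<^sub>m w n) = nM (forward (\<lambda>s. dvg (\<chi> i. ?d i s)))"
    by (rule calPM_norm_cong)
  also have "\<dots> \<le> ?C / (1 - \<alpha>)" by (rule F(2))
  also have "\<dots> \<le> (M\<^sup>2 * L2 * nV (v - w) + 2 * M * A2 * nM (m - n)) / (1 - \<alpha>)"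
    using \<alpha> by (intro divide_right_mono flux_difference assms) auto
  finally show ?thesis by (simp add: add_divide_distrib)
qed

lemma terminal_in:
  assumes "m \<in> ball_m"
  shows "(\<lambda>t. heat (T - t) (grad (G (m T)) $ i)) \<in> calB T (\<alpha> * T)"
    "nB (\<lambda>t. heat (T - t) (grad (G (m T)) $ i)) \<le> \<gamma>"
proof -
  note m = ball_mD[OF assms]
  note s = calPM_time_slice[OF m(1) T0]
  have B: "G (m T) \<in> B1 (\<alpha> * T)" by (rule G_mem[OF s(1)])
  note b = terminal_bound[OF _ _ T0, of "G (m T)" "\<alpha> * T" i]
  show "(\<lambda>t. heat (T - t) (grad (G (m T)) $ i)) \<in> calB T (\<alpha> * T)"
    using b(1) B by (auto simp: B1_def)
  have "nB (\<lambda>t. heat (T - t) (grad (G (m T)) $ i)) \<le> B1_norm (\<alpha> * T) (G (m T))"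
    using b(2) B by (auto simp: B1_def)
  also have "\<dots> \<le> \<gamma>"
    using s m by (intro G_size) auto
  finally show "nB (\<lambda>t. heat (T - t) (grad (G (m T)) $ i)) \<le> \<gamma>" .
qed

lemma \<Phi>\<^sub>v_into:
  assumes "v \<in> ball_v" "m \<in> ball_m"
  shows "\<Phi>\<^sub>v v m \<in> calBv T (\<alpha> * T)" "nV (\<Phi>\<^sub>v v m) \<le> r / 2"
proof -
  let ?t = "\<lambda>i t. heat (T - t) (grad (G (m T)) $ i)" and ?b = "\<lambda>i. backward T (\<lambda>s. grad (Ham f1 g1 v m s) $ i)"
  note t = terminal_in[OF assms(2)] and H = Ham_bound[OF assms]
  note b = backward_bound[OF H(1) \<alpha>T T0]
  have comp: "\<Phi>\<^sub>v v m $ i \<in> calB T (\<alpha> * T)" "nB (\<Phi>\<^sub>v v m $ i) \<le> nB (?t i) + nB (?b i)" for i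
    using calB_dominated[OF t(1)[of i] b(1)[of i] T0
        admissible_add[OF calB_admissible[OF t(1)[of i]] calB_admissible[OF b(1)[of i]]] norm_triangle_ineq]
    by (simp_all add: \<Phi>\<^sub>v_def)
  show "\<Phi>\<^sub>v v m \<in> calBv T (\<alpha> * T)"
    using comp(1) by (simp add: calBv_def)
  have "nB (\<Phi>\<^sub>v v m $ i) \<le> \<gamma> + A1 * M" for i
    using comp(2)[of i] t(2)[of i] b(2)[of i] H(2) by linarith
  then have "nV (\<Phi>\<^sub>v v m) \<le> CARD('d) * (\<gamma> + A1 * M)"
    unfolding calBv_norm_def by (intro sum_bounded_above[THEN order_trans]) auto
  then show "nV (\<Phi>\<^sub>v v m) \<le> r / 2" using into_v by linarith
qed

lemma \<Phi>\<^sub>v_difference: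
  assumes "v \<in> ball_v" "w \<in> ball_v" "m \<in> ball_m" "n \<in> ball_m"
  shows "nV (\<Phi>\<^sub>v v m - \<Phi>\<^sub>v w n) \<le> CARD('d) * (L1 * M) * nV (v - w) + CARD('d) * (\<Lambda> + A1) * nM (m - n)"
proof -
  let ?a = "G (m T) - G (n T)" and ?h = "Ham f1 g1 v m - Ham f1 g1 w n"
  note m = ball_mD[OF assms(3)] and n = ball_mD[OF assms(4)]
  note sm = calPM_time_slice[OF m(1) T0] and sn = calPM_time_slice[OF n(1) T0]
  note Hv = Ham_bound(1)[OF assms(1,3)] and Hw = Ham_bound(1)[OF assms(2,4)]
  have h: "?h \<in> calB T (\<alpha> * T)" by (intro calB_diff Hv Hw T0)
  have B: "G (m T) \<in> B1 (\<alpha> * T)" "G (n T) \<in> B1 (\<alpha> * T)"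
    using sm sn by (auto intro: G_mem)
  have "real_coeffs ?a" using B by (auto simp: B1_def real_coeffs_diff)
  note t = terminal_bound[OF this B1_diff_summable[OF B] T0]
  note b = backward_bound[OF h \<alpha>T T0]
  have "B1_norm (\<alpha> * T) ?a \<le> \<Lambda> * PM_norm (\<alpha> * T) (m T - n T)"
    using sm sn m n by (intro G_lip) auto
  also have "PM_norm (\<alpha> * T) (m T - n T) \<le> nM (m - n)"
    using calPM_time_slice(2)[OF calPM_diff(1)[OF m(1) n(1) T0] T0] by simp
  finally have a: "B1_norm (\<alpha> * T) ?a \<le> \<Lambda> * nM (m - n)" using \<Lambda> by (simp add: mult_left_mono)
  have "nB ((\<Phi>\<^sub>v v m - \<Phi>\<^sub>v w n) $ i) \<le> L1 * M * nV (v - w) + (\<Lambda> + A1) * nM (m - n)" for i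
  proof -
    let ?t = "\<lambda>t. heat (T - t) (grad ?a $ i)" and ?b = "backward T (\<lambda>s. grad (?h s) $ i)"
    let ?s = "\<lambda>t k. ?t t k + ?b t k"
    have "((\<Phi>\<^sub>v v m - \<Phi>\<^sub>v w n) $ i) t k = ?s t k" if t: "t \<in> {0..T}" for t k
    proof -
      have "(\<lambda>s. grad (Ham f1 g1 v m s) $ i) - (\<lambda>s. grad (Ham f1 g1 w n s) $ i) = (\<lambda>s. grad (?h s) $ i)"
        by (simp add: fun_eq_iff grad_def right_diff_distrib)
      then have "backward T (\<lambda>s. grad (Ham f1 g1 v m s) $ i) t k - backward T (\<lambda>s. grad (Ham f1 g1 w n s) $ i) t k = ?b t k"
        using backward_diff[OF calB_grad_bounded_in_time[OF Hv \<alpha>T T0] calB_grad_bounded_in_time[OF Hw \<alpha>T T0] t]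
        by simp
      moreover have "heat (T - t) (grad (G (m T)) $ i) k - heat (T - t) (grad (G (n T)) $ i) k = ?t t k"
        by (simp add: grad_diff[symmetric] heat_diff)
      ultimately show ?thesis by (simp add: \<Phi>\<^sub>v_def add_diff_add)
    qed
    then have "nB ((\<Phi>\<^sub>v v m - \<Phi>\<^sub>v w n) $ i) = nB ?s"
      by (rule calB_norm_cong)
    also have "\<dots> \<le> nB ?t + nB ?b"
      by (rule calB_dominated(2)[OF t(1)[of i] b(1)[of i] T0
            admissible_add[OF calB_admissible[OF t(1)[of i]] calB_admissible[OF b(1)[of i]]] norm_triangle_ineq])
    also have "\<dots> \<le> \<Lambda> * nM (m - n) + (L1 * M * nV (v - w) + A1 * nM (m - n))"
      using t(2)[of i] a b(2)[of i] Ham_difference[OF assms] by linarith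
    finally show ?thesis by (simp add: algebra_simps)
  qed
  then have "nV (\<Phi>\<^sub>v v m - \<Phi>\<^sub>v w n) \<le> CARD('d) * (L1 * M * nV (v - w) + (\<Lambda> + A1) * nM (m - n))"
    unfolding calBv_norm_def by (intro sum_bounded_above[THEN order_trans]) auto
  then show ?thesis by (simp add: algebra_simps)
qed

end


section \<open>The fixed point\<close>

context contraction_setting
begin

definition \<Phi> :: "('d tcoeffs ^ 'd) \<times> 'd tcoeffs \<Rightarrow> ('d tcoeffs ^ 'd) \<times> 'd tcoeffs" where
  "\<Phi> x = (\<Phi>\<^sub>v (fst x) (snd x), \<Phi>\<^sub>m (fst x) (snd x))"

text \<open>
  Only a pseudometric: it does not see the values outside \<open>{0..T}\<close>, which are not determined by
  the equations.
\<close>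

definition dist_K :: "('d tcoeffs ^ 'd) \<times> 'd tcoeffs \<Rightarrow> ('d tcoeffs ^ 'd) \<times> 'd tcoeffs \<Rightarrow> real" where
  "dist_K x y = nV (fst x - fst y) + K * nM (snd x - snd y)"

lemma diff_diff_cancel_v: "v - (v - w) = (w :: 'd tcoeffs ^ 'd)"
  by (simp add: vec_eq_iff fun_eq_iff)

lemma \<Phi>_into:
  assumes "x \<in> ball_v \<times> ball_m"
  shows "\<Phi> x \<in> ball_v \<times> ball_m"
proof -
  have x: "fst x \<in> ball_v" "snd x \<in> ball_m" using assms by auto
  show ?thesis
    using \<Phi>\<^sub>v_into[OF x] \<Phi>\<^sub>m_into[OF x] r by (simp add: \<Phi>_def ball_v_def ball_m_def)
qed

lemma dist_K_parts:
  assumes "x \<in> ball_v \<times> ball_m" "y \<in> ball_v \<times> ball_m"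
  shows "0 \<le> nV (fst x - fst y)" "0 \<le> nM (snd x - snd y)" "0 \<le> dist_K x y"
    "nV (fst x - fst y) \<le> dist_K x y" "nM (snd x - snd y) \<le> dist_K x y / K"
proof -
  show *: "0 \<le> nV (fst x - fst y)" "0 \<le> nM (snd x - snd y)"
    using assms by (auto intro!: calBv_norm_nonneg calPM_norm_nonneg calBv_diff calPM_diff T0 dest: ball_vD ball_mD)
  show "0 \<le> dist_K x y" "nV (fst x - fst y) \<le> dist_K x y" "nM (snd x - snd y) \<le> dist_K x y / K"
    using * K by (auto simp: dist_K_def field_simps)
qed

lemma dist_K_triangle:
  assumes "x \<in> ball_v \<times> ball_m" "y \<in> ball_v \<times> ball_m" "z \<in> ball_v \<times> ball_m"
  shows "dist_K x z \<le> dist_K x y + dist_K y z"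
proof -
  have "nV (fst x - fst z) \<le> nV (fst x - fst y) + nV (fst y - fst z)"
    using assms by (intro calBv_norm_triangle T0) (auto dest: ball_vD)
  moreover have "nM (snd x - snd z) \<le> nM (snd x - snd y) + nM (snd y - snd z)"
    using assms by (intro calPM_norm_triangle T0) (auto dest: ball_mD)
  then have "K * nM (snd x - snd z) \<le> K * (nM (snd x - snd y) + nM (snd y - snd z))"
    using K by (intro mult_left_mono) auto
  ultimately show ?thesis by (simp add: dist_K_def distrib_left)
qed

lemma dist_K_commute: "dist_K x y = dist_K y x"
  unfolding dist_K_def using calBv_norm_minus_commute calPM_norm_minus_commute by metis

lemma dist_K_contraction:
  assumes "x \<in> ball_v \<times> ball_m" "y \<in> ball_v \<times> ball_m"
  shows "dist_K (\<Phi> x) (\<Phi> y) \<le> dist_K x y / 2"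
proof -
  obtain v m w n where xy: "x = (v, m)" "y = (w, n)" by (metis surj_pair)
  note mem = assms[unfolded xy mem_Times_iff fst_conv snd_conv]
  let ?a = "nV (v - w)" and ?b = "nM (m - n)"
  have ab: "?a \<ge> 0" "?b \<ge> 0" using dist_K_parts(1,2)[OF assms] by (auto simp: xy)
  have "dist_K (\<Phi> x) (\<Phi> y) \<le> (CARD('d) * (L1 * M) * ?a + CARD('d) * (\<Lambda> + A1) * ?b)
      + K * (M\<^sup>2 * L2 / (1 - \<alpha>) * ?a + 2 * M * A2 / (1 - \<alpha>) * ?b)"
    unfolding dist_K_def \<Phi>_def xy fst_conv snd_conv
    using K mem by (intro add_mono mult_left_mono \<Phi>\<^sub>v_difference \<Phi>\<^sub>m_difference) auto
  also have "\<dots> = (CARD('d) * (L1 * M) + K * (M\<^sup>2 * L2 / (1 - \<alpha>))) * ?a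
      + (CARD('d) * (\<Lambda> + A1) + K * (2 * M * A2 / (1 - \<alpha>))) * ?b"
    by (simp only: distrib_left distrib_right mult.assoc add_ac)
  also have "\<dots> \<le> 1 / 2 * ?a + K / 2 * ?b"
    by (intro add_mono mult_right_mono contract_v contract_m ab)
  finally show ?thesis by (simp add: dist_K_def xy)
qed

text \<open>
  Picard iteration from zero. The fixed-point equation holds up to \<open>dist_K\<close>, that is, on \<open>{0..T}\<close>.
\<close>

lemma fixed_point_exists:
  obtains x where "x \<in> ball_v \<times> ball_m" "dist_K x (\<Phi> x) = 0"
proof -
  define z where "z n = (\<Phi> ^^ n) ((\<chi> i. (\<lambda>t k. 0)), (\<lambda>t k. 0))" for n
  have "(\<chi> i. (\<lambda>t k. 0)) \<in> ball_v"
    using r by (auto simp: ball_v_def calBv_def admissible_def real_coeffs_def calBv_norm_def calB_norm_def T0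
        intro!: calB_I[OF T0, of _ _ 0])
  moreover have "(\<lambda>t k. 0) \<in> ball_m"
    using M_ge_1 calPM_I[OF T0, of "\<lambda>t k. 0" \<alpha> M]
    by (simp add: ball_m_def admissible_def real_coeffs_def)
  ultimately have z: "z n \<in> ball_v \<times> ball_m" for n
    unfolding z_def by (induction n) (auto intro: \<Phi>_into simp del: mem_Times_iff)
  define w where "w = dist_K (z 1) (z 0)"
  have w0: "w \<ge> 0" unfolding w_def by (rule dist_K_parts(3)[OF z z])
  have step: "dist_K (z (Suc n)) (z n) \<le> w * (1 / 2) ^ n" for n
  proof (induction n)
    case (Suc n)
    have "dist_K (z (Suc (Suc n))) (z (Suc n)) \<le> dist_K (z (Suc n)) (z n) / 2"
      using dist_K_contraction[OF z z, of "Suc n" n] by (simp add: z_def)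
    then show ?case using Suc by simp
  qed (simp add: w_def)
  \<comment> \<open>tail of the geometric series: \<open>e n - e (Suc n)\<close> is the bound in \<open>step\<close>\<close>
  define e where "e n = 2 * w * (1 / 2) ^ n" for n :: nat
  have cau: "dist_K (z (n + j)) (z n) \<le> e n - e (n + j)" for n j
  proof (induction j)
    case 0
    then show ?case by (simp add: dist_K_def calBv_norm_def calB_norm_def calPM_norm_def T0)
  next
    case (Suc j)
    have "dist_K (z (n + Suc j)) (z n) \<le> w * (1 / 2) ^ (n + j) + dist_K (z (n + j)) (z n)"
      using dist_K_triangle[OF z[of "Suc (n + j)"] z[of "n + j"] z[of n]] step[of "n + j"] by simp
    also have "\<dots> \<le> e n - e (n + Suc j)"
      using Suc by (simp add: e_def)
    finally show ?case .
  qed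
  have cau: "dist_K (z p) (z n) \<le> e n" if "n \<le> p" for n p
  proof -
    have "e p \<ge> 0" using w0 by (simp add: e_def)
    then show ?thesis using cau[of n "p - n"] that by simp
  qed
  have e: "e \<longlonglongrightarrow> 0"
    unfolding e_def by (intro tendsto_mult_right_zero LIMSEQ_power_zero) simp
  obtain v where v: "v \<in> calBv T (\<alpha> * T)" "\<And>n. nV (fst (z n) - v) \<le> CARD('d) * e n"
  proof (rule calBv_complete[OF T0 \<alpha>T _ _ e, of "\<lambda>n. fst (z n)"])
    show "fst (z n) \<in> calBv T (\<alpha> * T)" for n using z[of n] by (auto dest: ball_vD)
    show "nV (fst (z p) - fst (z n)) \<le> e n" if "n \<le> p" for n p
      using order_trans[OF dist_K_parts(4)[OF z z] cau[OF that]] .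
  qed blast
  have eK: "(\<lambda>n. e n / K) \<longlonglongrightarrow> 0"
    using tendsto_divide[OF e tendsto_const[of K]] K by simp
  obtain m where m: "m \<in> calPM T \<alpha>" "\<And>n. nM (snd (z n) - m) \<le> e n / K"
  proof (rule calPM_complete[OF T0 \<alpha>(1) _ _ eK, of "\<lambda>n. snd (z n)"])
    show "snd (z n) \<in> calPM T \<alpha>" for n using z[of n] by (auto dest: ball_mD)
    show "nM (snd (z p) - snd (z n)) \<le> e n / K" if "n \<le> p" for n p
      using dist_K_parts(5)[OF z z, of p n] divide_right_mono[OF cau[OF that], of K] K by linarith
  qed blast
  have "nV v \<le> r"
  proof (rule LIMSEQ_le_const)
    show "(\<lambda>n. r + CARD('d) * e n) \<longlonglongrightarrow> r"
      using tendsto_add[OF tendsto_const tendsto_mult_right_zero[OF e]] by simp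
    have "nV v \<le> r + CARD('d) * e n" for n
    proof -
      have "nV (fst (z n) - (fst (z n) - v)) \<le> nV (fst (z n)) + nV (fst (z n) - v)"
        using z[of n] by (intro calBv_diff T0 v) (auto dest: ball_vD)
      moreover have "nV (fst (z n)) \<le> r" using z[of n] by (auto dest: ball_vD)
      ultimately show ?thesis using v(2)[of n] unfolding diff_diff_cancel_v by simp
    qed
    then show "\<exists>N. \<forall>n\<ge>N. nV v \<le> r + CARD('d) * e n" by blast
  qed
  moreover have "nM m \<le> M"
  proof (rule LIMSEQ_le_const)
    show "(\<lambda>n. M + e n / K) \<longlonglongrightarrow> M"
      using tendsto_add[OF tendsto_const eK] by simp
    have "nM m \<le> M + e n / K" for n
    proof -
      have "nM (snd (z n) - (snd (z n) - m)) \<le> nM (snd (z n)) + nM (snd (z n) - m)"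
        using z[of n] by (intro calPM_diff T0 m) (auto dest: ball_mD)
      moreover have "nM (snd (z n)) \<le> M" using z[of n] by (auto dest: ball_mD)
      ultimately show ?thesis using m(2)[of n] by (simp add: fun_diff_def)
    qed
    then show "\<exists>N. \<forall>n\<ge>N. nM m \<le> M + e n / K" by blast
  qed
  ultimately have x: "(v, m) \<in> ball_v \<times> ball_m"
    using v m by (simp add: ball_v_def ball_m_def)
  have near: "dist_K (z n) (v, m) \<le> (CARD('d) + 1) * e n" for n
    using v(2)[of n] mult_left_mono[OF m(2)[of n], of K] K by (simp add: dist_K_def algebra_simps)
  have "dist_K (v, m) (\<Phi> (v, m)) \<le> 0"
  proof (rule LIMSEQ_le_const)
    have "(\<lambda>n. (CARD('d) + 1) * e (Suc n) + (CARD('d) + 1) * e n / 2) \<longlonglongrightarrow> 0 + 0 / 2"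
      by (intro tendsto_intros tendsto_mult_right_zero e LIMSEQ_Suc) simp
    then show "(\<lambda>n. (CARD('d) + 1) * e (Suc n) + (CARD('d) + 1) * e n / 2) \<longlonglongrightarrow> 0" by simp
    have "dist_K (v, m) (\<Phi> (v, m)) \<le> (CARD('d) + 1) * e (Suc n) + (CARD('d) + 1) * e n / 2" for n
    proof -
      have "dist_K (v, m) (\<Phi> (v, m)) \<le> dist_K (v, m) (z (Suc n)) + dist_K (z (Suc n)) (\<Phi> (v, m))"
        by (intro dist_K_triangle x z \<Phi>_into)
      also have "dist_K (z (Suc n)) (\<Phi> (v, m)) \<le> dist_K (z n) (v, m) / 2"
        using dist_K_contraction[OF z x, of n] by (simp add: z_def)
      finally show ?thesis
        using near[of n] near[of "Suc n"] dist_K_commute[of "(v, m)"] by simp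
    qed
    then show "\<exists>N. \<forall>n\<ge>N. dist_K (v, m) (\<Phi> (v, m)) \<le> (CARD('d) + 1) * e (Suc n) + (CARD('d) + 1) * e n / 2"
      by blast
  qed
  with that x dist_K_parts(3)[OF x \<Phi>_into[OF x]] show thesis by (meson order_antisym)
qed

lemma dist_K_zeroD:
  assumes "x \<in> ball_v \<times> ball_m" "y \<in> ball_v \<times> ball_m" "dist_K x y = 0" "t \<in> {0..T}"
  shows "(fst x $ i) t k = (fst y $ i) t k" "snd x t k = snd y t k"
proof -
  have d: "fst x - fst y \<in> calBv T (\<alpha> * T)" "snd x - snd y \<in> calPM T \<alpha>"
    using assms by (auto intro!: calBv_diff calPM_diff T0 dest: ball_vD ball_mD)
  have "cmod ((fst x $ i) t k - (fst y $ i) t k) \<le> nB ((fst x - fst y) $ i)"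
    using calB_cmod_le[of "(fst x - fst y) $ i" T "\<alpha> * T" t k] d(1) \<alpha>T assms(4) by (simp add: calBv_def)
  also have "\<dots> \<le> nV (fst x - fst y)"
    by (intro calB_component_le d T0)
  also have "\<dots> \<le> 0"
    using dist_K_parts(4)[OF assms(1,2)] assms(3) by simp
  finally show "(fst x $ i) t k = (fst y $ i) t k" by simp
  have "cmod ((snd x - snd y) t k) \<le> 0"
    using order_trans[OF calPM_cmod_le[OF d(2) \<alpha>(1) assms(4), of k] dist_K_parts(5)[OF assms(1,2)]] assms(3) by simp
  then show "snd x t k = snd y t k" by simp
qed

lemma mild_solution_in_ball_iff:
  assumes "v \<in> ball_v" "m \<in> ball_m"
  shows "mild_solution T \<alpha> m0 f1 f2 g1 g2 G v m \<longleftrightarrow> dist_K (v, m) (\<Phi> (v, m)) = 0"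
proof
  assume "dist_K (v, m) (\<Phi> (v, m)) = 0"
  with assms dist_K_zeroD[of "(v, m)" "\<Phi> (v, m)"] \<Phi>_into[of "(v, m)"]
  show "mild_solution T \<alpha> m0 f1 f2 g1 g2 G v m"
    unfolding mild_solution_iff_fixed_point by (auto simp: \<Phi>_def dest: ball_vD ball_mD)
next
  assume *: "mild_solution T \<alpha> m0 f1 f2 g1 g2 G v m"
  have "nV (v - \<Phi>\<^sub>v v m) = nV (v - v)"
    unfolding calBv_norm_def
    using * by (intro sum.cong calB_norm_cong) (auto simp: mild_solution_iff_fixed_point)
  moreover have "nM (m - \<Phi>\<^sub>m v m) = nM (m - m)"
    using * by (intro calPM_norm_cong) (auto simp: mild_solution_iff_fixed_point)
  ultimately show "dist_K (v, m) (\<Phi> (v, m)) = 0"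
    by (simp add: dist_K_def \<Phi>_def calBv_norm_def calB_norm_def calPM_norm_def T0)
qed

lemma fixed_point_unique:
  assumes x: "x \<in> ball_v \<times> ball_m" "dist_K x (\<Phi> x) = 0" and y: "y \<in> ball_v \<times> ball_m" "dist_K y (\<Phi> y) = 0"
  shows "dist_K x y = 0"
proof -
  have "dist_K x y \<le> dist_K x (\<Phi> x) + dist_K (\<Phi> x) y"
    by (intro dist_K_triangle x y \<Phi>_into)
  also have "dist_K (\<Phi> x) y \<le> dist_K (\<Phi> x) (\<Phi> y) + dist_K (\<Phi> y) y"
    by (intro dist_K_triangle x y \<Phi>_into)
  finally have "dist_K x y \<le> dist_K x y / 2"
    using x(2) y(2) dist_K_contraction[OF x(1) y(1)] dist_K_commute[of "\<Phi> y" y] by simp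
  then show ?thesis using dist_K_parts(3)[OF x(1) y(1)] by simp
qed

text \<open>
  The ball is centred at the solution itself. Its radius is the distance that the solution keeps
  from the boundary of the region in which it is unique.
\<close>

lemma solvable: "solvable_uniquely_in_ball T \<alpha> m0 f1 f2 g1 g2 G"
proof -
  obtain v m where x: "(v, m) \<in> ball_v \<times> ball_m" "dist_K (v, m) (\<Phi> (v, m)) = 0"
    using fixed_point_exists by (metis surj_pair)
  then have vm: "v \<in> ball_v" "m \<in> ball_m" by auto
  note v = ball_vD[OF vm(1)] and m = ball_mD[OF vm(2)]
  have sol: "mild_solution T \<alpha> m0 f1 f2 g1 g2 G v m"
    using mild_solution_in_ball_iff[OF vm] x(2) by simp
  have "nV v = nV (\<Phi>\<^sub>v v m)"
    unfolding calBv_norm_def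
    using sol by (intro sum.cong calB_norm_cong) (auto simp: mild_solution_iff_fixed_point)
  then have v2: "nV v \<le> r / 2" using \<Phi>\<^sub>v_into(2)[OF vm] by simp
  have "nM m = nM (\<Phi>\<^sub>m v m)"
    using sol by (intro calPM_norm_cong) (auto simp: mild_solution_iff_fixed_point)
  then have m2: "nM m \<le> M - 1 / 2" using \<Phi>\<^sub>m_into(2)[OF vm] by simp
  define R where "R = min (r / 2) (1 / 2)"
  have R: "R > 0" using r by (simp add: R_def)
  have unique: "\<forall>t\<in>{0..T}. n t = m t \<and> (\<forall>i. (w $ i) t = (v $ i) t)"
    if y: "mild_solution T \<alpha> m0 f1 f2 g1 g2 G w n" "nV (w - v) + nM (n - m) < R" for w n
  proof -
    have mem: "w \<in> calBv T (\<alpha> * T)" "n \<in> calPM T \<alpha>"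
      using y(1) by (auto simp: mild_solution_def)
    have nn: "nV (w - v) \<ge> 0" "nM (n - m) \<ge> 0"
      by (intro calBv_norm_nonneg calPM_norm_nonneg calBv_diff calPM_diff mem v m T0)+
    have "nV (v - (v - w)) \<le> nV v + nV (v - w)"
      by (intro calBv_diff v mem T0)
    then have "nV w \<le> r"
      using v2 y(2) nn unfolding diff_diff_cancel_v by (simp add: calBv_norm_minus_commute[of T _ v w] R_def)
    moreover have "nM (m - (m - n)) \<le> nM m + nM (m - n)"
      by (intro calPM_diff m mem T0)
    moreover have "m - (m - n) = n" by (simp add: fun_eq_iff)
    ultimately have "nM n \<le> M"
      using m2 y(2) nn by (simp add: calPM_norm_minus_commute[of T _ m n] R_def)
    with \<open>nV w \<le> r\<close> have b: "w \<in> ball_v" "n \<in> ball_m"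
      using mem by (auto simp: ball_v_def ball_m_def)
    then have "dist_K (w, n) (v, m) = 0"
      using fixed_point_unique[OF _ _ x] y(1) mild_solution_in_ball_iff[OF b] by auto
    with dist_K_zeroD[of "(w, n)" "(v, m)"] b vm show ?thesis by (auto simp: fun_eq_iff)
  qed
  have "nV (v - v) + nM (m - m) < R"
    using R by (simp add: calBv_norm_def calB_norm_def calPM_norm_def T0)
  with sol unique v(1) m(1) R show ?thesis
    unfolding solvable_uniquely_in_ball_def by blast
qed

end


section \<open>Small payoffs and small Hamiltonians\<close>

lemma rpow_nonneg: "rpow x p \<ge> 0"
  by (simp add: rpow_def)

lemma rpow_mono: "0 \<le> x \<Longrightarrow> x \<le> y \<Longrightarrow> 0 \<le> p \<Longrightarrow> rpow x p \<le> rpow y p"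
  by (simp add: rpow_def powr_mono2)

lemma rpow_add: "x > 0 \<Longrightarrow> rpow x p * rpow x q = x powr (p + q)"
  by (simp add: rpow_def powr_add)

text \<open>
  The bounds on \<open>A\<close> and \<open>L\<close> that follow from the Hamiltonian assumption when \<open>\<parallel>v\<parallel> \<le> r\<close>. The
  factor \<open>2\<close> comes from the two summands \<open>\<parallel>v1\<parallel>\<close> and \<open>\<parallel>v2\<parallel>\<close> in the local Lipschitz condition.
\<close>

definition ham_size :: "real \<Rightarrow> real \<Rightarrow> real \<Rightarrow> real \<Rightarrow> real \<Rightarrow> real" where
  "ham_size r cf pf cg pg = cg * cf * (rpow r pg * rpow r pf)"

definition ham_lip :: "real \<Rightarrow> real \<Rightarrow> real \<Rightarrow> real \<Rightarrow> real \<Rightarrow> real \<Rightarrow> real \<Rightarrow> real \<Rightarrow> real \<Rightarrow> real" where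
  "ham_lip r cf pf cf' pf' cg pg cg' pg' =
     2 * (cg' * cf * (rpow r pg' * rpow r pf) + cg * cf' * (rpow r pg * rpow r pf'))"

lemma product_size:
  assumes "0 \<le> f" "f \<le> cf * rpow x pf" "0 \<le> g" "g \<le> cg * rpow x pg"
    and "0 \<le> x" "x \<le> r" "cf > 0" "cg > 0" "pf \<ge> 0" "pg \<ge> 0"
  shows "g * f \<le> ham_size r cf pf cg pg"
proof -
  have "g * f \<le> (cg * rpow r pg) * (cf * rpow r pf)"
    using assms by (intro mult_mono order_trans[OF assms(2)] order_trans[OF assms(4)] mult_left_mono rpow_mono) (auto simp: rpow_nonneg)
  then show ?thesis by (simp add: ham_size_def mult_ac)
qed

lemma product_lip:
  assumes "0 \<le> f" "f \<le> cf * rpow x pf" "0 \<le> g" "g \<le> cg * rpow y pg"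
    and "df \<ge> 0" "df \<le> cf' * N * (rpow x pf' + rpow y pf')"
    and "dg \<ge> 0" "dg \<le> cg' * N * (rpow x pg' + rpow y pg')"
    and "0 \<le> x" "x \<le> r" "0 \<le> y" "y \<le> r" "N \<ge> 0"
    and "cf > 0" "cg > 0" "pf \<ge> 0" "pg \<ge> 0" "cf' > 0" "cg' > 0" "pf' \<ge> 0" "pg' \<ge> 0"
  shows "dg * f + g * df \<le> ham_lip r cf pf cf' pf' cg pg cg' pg' * N"
proof -
  have dg: "dg \<le> cg' * N * (2 * rpow r pg')"
    using rpow_mono[of x r pg'] rpow_mono[of y r pg'] assms
    by (intro order_trans[OF assms(8)] mult_left_mono) auto
  have df: "df \<le> cf' * N * (2 * rpow r pf')"
    using rpow_mono[of x r pf'] rpow_mono[of y r pf'] assms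
    by (intro order_trans[OF assms(6)] mult_left_mono) auto
  have f: "f \<le> cf * rpow r pf"
    using assms by (intro order_trans[OF assms(2)] mult_left_mono rpow_mono) auto
  have g: "g \<le> cg * rpow r pg"
    using assms by (intro order_trans[OF assms(4)] mult_left_mono rpow_mono) auto
  have "dg * f + g * df \<le> (cg' * N * (2 * rpow r pg')) * (cf * rpow r pf) + (cg * rpow r pg) * (cf' * N * (2 * rpow r pf'))"
    using assms by (intro add_mono mult_mono dg df f g) (auto simp: rpow_nonneg)
  then show ?thesis by (simp add: ham_lip_def algebra_simps)
qed

text \<open>
  The sum of all coefficients that \<open>A1\<close>, \<open>A2\<close>, \<open>L1\<close> and \<open>L2\<close> have in the conditions of
  \<open>contraction_setting\<close>, so that a common bound \<open>\<eta>\<close> on these four numbers with \<open>\<eta>\<close> times this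
  sum at most \<open>1 / 4\<close> meets all of them except \<open>into_v\<close>, where \<open>r\<close> enters. The weight is
  \<open>K = 4 (d \<Lambda> + 1)\<close>: the payoff term \<open>d \<Lambda>\<close> then uses at most half of the allowance
  \<open>K / 2\<close>, and \<open>K / 4 \<ge> 1\<close> is left for the rest.
\<close>

definition total_gain :: "nat \<Rightarrow> real \<Rightarrow> real \<Rightarrow> real \<Rightarrow> real" where
  "total_gain d \<alpha> M \<Lambda> = (let K = 4 * (d * \<Lambda> + 1) in
     d * M + d + M\<^sup>2 / (1 - \<alpha>) + K * (M\<^sup>2 / (1 - \<alpha>)) + K * (2 * M / (1 - \<alpha>)))"

lemma solvable_if_small:
  fixes m0 :: "('d::finite) coeffs" and M cG :: real
  assumes T: "T > 0" and \<alpha>: "0 \<le> \<alpha>" "\<alpha> < 1" and m0: "m0 \<in> PM 0" and r: "r > 0" and M: "M = PM_norm 0 m0 + 1"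
    and f1: "ham_assumption T \<alpha> f1 cf1 pf1 cf1' pf1'" and f2: "ham_assumption T \<alpha> f2 cf2 pf2 cf2' pf2'"
    and g1: "ham_assumption T \<alpha> g1 cg1 pg1 cg1' pg1'" and g2: "ham_assumption_vec T \<alpha> g2 cg2 pg2 cg2' pg2'"
    and G: "payoff_assumption T \<alpha> G cG cG' \<Psi>1 \<Psi>2"
    and \<Lambda>: "\<Lambda> \<ge> 0" "cG' * \<Psi>2 (2 * M) \<le> \<Lambda>" and \<gamma>: "CARD('d) * (cG * M * \<Psi>1 M) \<le> r / 4"
    and A: "ham_size r cf1 pf1 cg1 pg1 \<le> \<eta>" "ham_size r cf2 pf2 cg2 pg2 \<le> \<eta>"
    and L: "ham_lip r cf1 pf1 cf1' pf1' cg1 pg1 cg1' pg1' \<le> \<eta>" "ham_lip r cf2 pf2 cf2' pf2' cg2 pg2 cg2' pg2' \<le> \<eta>"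
    and \<eta>: "\<eta> * total_gain CARD('d) \<alpha> M \<Lambda> \<le> 1 / 4"
    and A1: "CARD('d) * (ham_size r cf1 pf1 cg1 pg1 * M) \<le> r / 4"
  shows "solvable_uniquely_in_ball T \<alpha> m0 f1 f2 g1 g2 G"
proof -
  let ?\<beta> = "\<alpha> * T"
  let ?d = "real CARD('d)"
  define K where "K = 4 * (?d * \<Lambda> + 1)"
  have K: "K \<ge> 4" using \<Lambda> by (simp add: K_def)
  have T0: "T \<ge> 0" and \<beta>: "?\<beta> \<ge> 0" using T \<alpha> by auto
  have M1: "M \<ge> 1" using PM_norm_nonneg[OF m0] M by simp
  note bounds = f1[unfolded ham_assumption_def, THEN conjunct2, unfolded ham_bounds_def]
    f2[unfolded ham_assumption_def, THEN conjunct2, unfolded ham_bounds_def]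
    g1[unfolded ham_assumption_def, THEN conjunct2, unfolded ham_bounds_def]
    g2[unfolded ham_assumption_vec_def, THEN conjunct2, unfolded ham_bounds_vec_def]
  note pay = G[unfolded payoff_assumption_def]
  have mem: "compose f1 v \<in> calB T ?\<beta>" "compose f2 v \<in> calB T ?\<beta>" "compose g1 v \<in> calB T ?\<beta>"
    "compose_vec g2 v \<in> calBv T ?\<beta>" if "v \<in> calBv T ?\<beta>" for v
    using bounds that by (auto simp: compose_in_def compose_vec_def calBv_def)
  have size_bounds:
    "calB_norm T ?\<beta> (compose f1 v) \<le> cf1 * rpow (calBv_norm T ?\<beta> v) pf1"
    "calB_norm T ?\<beta> (compose f2 v) \<le> cf2 * rpow (calBv_norm T ?\<beta> v) pf2"
    "calB_norm T ?\<beta> (compose g1 v) \<le> cg1 * rpow (calBv_norm T ?\<beta> v) pg1"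
    "calBv_norm T ?\<beta> (compose_vec g2 v) \<le> cg2 * rpow (calBv_norm T ?\<beta> v) pg2"
    if "v \<in> calBv T ?\<beta>" for v
    using bounds that by blast+
  have lip_bounds:
    "calB_norm T ?\<beta> (compose f1 v - compose f1 w)
      \<le> cf1' * calBv_norm T ?\<beta> (v - w) * (rpow (calBv_norm T ?\<beta> v) pf1' + rpow (calBv_norm T ?\<beta> w) pf1')"
    "calB_norm T ?\<beta> (compose f2 v - compose f2 w)
      \<le> cf2' * calBv_norm T ?\<beta> (v - w) * (rpow (calBv_norm T ?\<beta> v) pf2' + rpow (calBv_norm T ?\<beta> w) pf2')"
    "calB_norm T ?\<beta> (compose g1 v - compose g1 w)
      \<le> cg1' * calBv_norm T ?\<beta> (v - w) * (rpow (calBv_norm T ?\<beta> v) pg1' + rpow (calBv_norm T ?\<beta> w) pg1')"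
    "calBv_norm T ?\<beta> (compose_vec g2 v - compose_vec g2 w)
      \<le> cg2' * calBv_norm T ?\<beta> (v - w) * (rpow (calBv_norm T ?\<beta> v) pg2' + rpow (calBv_norm T ?\<beta> w) pg2')"
    if "v \<in> calBv T ?\<beta>" "w \<in> calBv T ?\<beta>" for v w
    using bounds that by blast+
  have constants: "cf1 > 0" "cf1' > 0" "cf2 > 0" "cf2' > 0" "cg1 > 0" "cg1' > 0" "cg2 > 0" "cg2' > 0"
    "pf1 \<ge> 0" "pf1' \<ge> 0" "pf2 \<ge> 0" "pf2' \<ge> 0" "pg1 \<ge> 0" "pg1' \<ge> 0" "pg2 \<ge> 0" "pg2' \<ge> 0"
    using bounds by blast+
  have size_nonneg: "ham_size r cf1 pf1 cg1 pg1 \<ge> 0"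
    using constants by (auto simp: ham_size_def rpow_nonneg)
  have gain: "\<eta> * (?d * M) + \<eta> * ?d + \<eta> * (M\<^sup>2 / (1 - \<alpha>)) + \<eta> * (K * (M\<^sup>2 / (1 - \<alpha>)))
      + \<eta> * (K * (2 * M / (1 - \<alpha>))) \<le> 1 / 4"
    using \<eta> by (simp add: total_gain_def Let_def K_def distrib_left)
  have \<eta>0: "\<eta> \<ge> 0" using size_nonneg A(1) by linarith
  have pos: "0 \<le> \<eta> * (?d * M)" "0 \<le> \<eta> * ?d" "0 \<le> \<eta> * (M\<^sup>2 / (1 - \<alpha>))"
    "0 \<le> \<eta> * (K * (M\<^sup>2 / (1 - \<alpha>)))" "0 \<le> \<eta> * (K * (2 * M / (1 - \<alpha>)))"
    using \<eta>0 M1 K \<alpha> by auto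
  interpret contraction_setting T \<alpha> m0 f1 f2 g1 g2 G r M "ham_size r cf1 pf1 cg1 pg1" \<eta> \<eta> \<eta> "cG * M * \<Psi>1 M" \<Lambda> K
  proof unfold_locales
    fix v :: "'d tcoeffs ^ 'd" assume v: "v \<in> calBv T ?\<beta>" "calBv_norm T ?\<beta> v \<le> r"
    show "calB_norm T ?\<beta> (compose g1 v) * calB_norm T ?\<beta> (compose f1 v) \<le> ham_size r cf1 pf1 cg1 pg1"
      by (intro product_size[where x = "calBv_norm T ?\<beta> v"] size_bounds constants calB_norm_nonneg
          calBv_norm_nonneg mem v T0)
    have "calBv_norm T ?\<beta> (compose_vec g2 v) * calB_norm T ?\<beta> (compose f2 v) \<le> ham_size r cf2 pf2 cg2 pg2"
      by (intro product_size[where x = "calBv_norm T ?\<beta> v"] size_bounds constants calB_norm_nonneg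
          calBv_norm_nonneg mem v T0)
    then show "calBv_norm T ?\<beta> (compose_vec g2 v) * calB_norm T ?\<beta> (compose f2 v) \<le> \<eta>"
      using A(2) by linarith
    fix w :: "'d tcoeffs ^ 'd" assume w: "w \<in> calBv T ?\<beta>" "calBv_norm T ?\<beta> w \<le> r"
    have N: "calBv_norm T ?\<beta> (v - w) \<ge> 0"
      by (intro calBv_norm_nonneg calBv_diff v w T0)
    have "calB_norm T ?\<beta> (compose g1 v - compose g1 w) * calB_norm T ?\<beta> (compose f1 v)
      + calB_norm T ?\<beta> (compose g1 w) * calB_norm T ?\<beta> (compose f1 v - compose f1 w)
        \<le> ham_lip r cf1 pf1 cf1' pf1' cg1 pg1 cg1' pg1' * calBv_norm T ?\<beta> (v - w)"
      by (intro product_lip[where x = "calBv_norm T ?\<beta> v" and y = "calBv_norm T ?\<beta> w"]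
          size_bounds lip_bounds constants calB_norm_nonneg calBv_norm_nonneg calB_diff calBv_diff mem v w T0)
    also have "\<dots> \<le> \<eta> * calBv_norm T ?\<beta> (v - w)"
      by (intro mult_right_mono L N)
    finally show "calB_norm T ?\<beta> (compose g1 v - compose g1 w) * calB_norm T ?\<beta> (compose f1 v)
      + calB_norm T ?\<beta> (compose g1 w) * calB_norm T ?\<beta> (compose f1 v - compose f1 w)
        \<le> \<eta> * calBv_norm T ?\<beta> (v - w)" .
    have "calBv_norm T ?\<beta> (compose_vec g2 v - compose_vec g2 w) * calB_norm T ?\<beta> (compose f2 v)
      + calBv_norm T ?\<beta> (compose_vec g2 w) * calB_norm T ?\<beta> (compose f2 v - compose f2 w)
        \<le> ham_lip r cf2 pf2 cf2' pf2' cg2 pg2 cg2' pg2' * calBv_norm T ?\<beta> (v - w)"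
      by (intro product_lip[where x = "calBv_norm T ?\<beta> v" and y = "calBv_norm T ?\<beta> w"]
          size_bounds lip_bounds constants calB_norm_nonneg calBv_norm_nonneg calB_diff calBv_diff mem v w T0)
    also have "\<dots> \<le> \<eta> * calBv_norm T ?\<beta> (v - w)"
      by (intro mult_right_mono L N)
    finally show "calBv_norm T ?\<beta> (compose_vec g2 v - compose_vec g2 w) * calB_norm T ?\<beta> (compose f2 v)
      + calBv_norm T ?\<beta> (compose_vec g2 w) * calB_norm T ?\<beta> (compose f2 v - compose f2 w)
        \<le> \<eta> * calBv_norm T ?\<beta> (v - w)" .
  next
    fix a :: "'d coeffs" assume a: "a \<in> PM ?\<beta>" "PM_norm ?\<beta> a \<le> M"
    note na = PM_norm_nonneg[OF a(1)]
    have "\<Psi>1 (PM_norm ?\<beta> a) \<le> \<Psi>1 M"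
      using pay na a(2) by (intro mono_onD[of "{0..}" \<Psi>1]) auto
    moreover have "0 \<le> \<Psi>1 (PM_norm ?\<beta> a)" using pay na by auto
    ultimately have "cG * PM_norm ?\<beta> a * \<Psi>1 (PM_norm ?\<beta> a) \<le> cG * M * \<Psi>1 M"
      using pay na a(2) M1 by (intro mult_mono) auto
    then show "B1_norm ?\<beta> (G a) \<le> cG * M * \<Psi>1 M"
      using pay a(1) by (meson order_trans)
    fix b :: "'d coeffs" assume b: "b \<in> PM ?\<beta>" "PM_norm ?\<beta> b \<le> M"
    note nb = PM_norm_nonneg[OF b(1)] and nab = PM_norm_nonneg[OF PM_diff[OF a(1) b(1)]]
    have "\<Psi>2 (PM_norm ?\<beta> a + PM_norm ?\<beta> b) \<le> \<Psi>2 (2 * M)"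
      using pay na nb a(2) b(2) by (intro mono_onD[of "{0..}" \<Psi>2]) auto
    then have "cG' * \<Psi>2 (PM_norm ?\<beta> a + PM_norm ?\<beta> b) \<le> \<Lambda>"
      using pay \<Lambda>(2) mult_left_mono[of "\<Psi>2 (PM_norm ?\<beta> a + PM_norm ?\<beta> b)" "\<Psi>2 (2 * M)" cG'] by linarith
    from mult_right_mono[OF this nab]
    have "cG' * PM_norm ?\<beta> (a - b) * \<Psi>2 (PM_norm ?\<beta> a + PM_norm ?\<beta> b) \<le> \<Lambda> * PM_norm ?\<beta> (a - b)"
      by (simp only: mult_ac)
    then show "B1_norm ?\<beta> (G a - G b) \<le> \<Lambda> * PM_norm ?\<beta> (a - b)"
      using pay a(1) b(1) by (meson order_trans)
  next
    show "?d * (cG * M * \<Psi>1 M + ham_size r cf1 pf1 cg1 pg1 * M) \<le> r / 2"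
      using \<gamma> A1 by (simp add: distrib_left)
    show "\<eta> * M\<^sup>2 / (1 - \<alpha>) \<le> 1 / 2"
      using gain pos unfolding times_divide_eq_right[symmetric] by linarith
    have "?d * (\<eta> * M) + K * (M\<^sup>2 * \<eta> / (1 - \<alpha>)) = \<eta> * (?d * M) + \<eta> * (K * (M\<^sup>2 / (1 - \<alpha>)))"
      by simp
    then show "?d * (\<eta> * M) + K * (M\<^sup>2 * \<eta> / (1 - \<alpha>)) \<le> 1 / 2"
      using gain pos by linarith
    have "?d * ham_size r cf1 pf1 cg1 pg1 \<le> \<eta> * ?d"
      using A(1) by (simp add: mult.commute)
    moreover have "K * (2 * M * \<eta> / (1 - \<alpha>)) = \<eta> * (K * (2 * M / (1 - \<alpha>)))"
      by simp
    moreover have "?d * \<Lambda> \<le> K / 4"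
      by (simp add: K_def)
    ultimately show "?d * (\<Lambda> + ham_size r cf1 pf1 cg1 pg1) + K * (2 * M * \<eta> / (1 - \<alpha>)) \<le> K / 2"
      using gain pos K unfolding distrib_left by linarith
  qed (use T \<alpha> m0 r M \<Lambda> K mem pay in auto)
  show ?thesis by (rule solvable)
qed

lemma total_gain_pos:
  assumes "\<alpha> < 1" "M \<ge> 1" "\<Lambda> \<ge> 0" "d \<ge> 1"
  shows "total_gain d \<alpha> M \<Lambda> > 0" "d * M \<le> total_gain d \<alpha> M \<Lambda>"
proof -
  have "real d \<ge> 1" using assms by simp
  then have "real d * M \<ge> 1" using assms mult_mono[of 1 "real d" 1 M] by simp
  moreover have "total_gain d \<alpha> M \<Lambda> \<ge> real d * M"
    using assms by (simp add: total_gain_def Let_def)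
  ultimately show "total_gain d \<alpha> M \<Lambda> > 0" "d * M \<le> total_gain d \<alpha> M \<Lambda>" by linarith+
qed

text \<open>
  The quantities are sums of powers of \<open>r\<close> with exponents \<open>p_f + p_g\<close>, and \<open>p_f + p_g'\<close>,
  \<open>p_f' + p_g\<close> for the Lipschitz constants, all of which tend to \<open>0\<close> with \<open>r\<close>. The last conclusion
  compares with \<open>r\<close> itself and needs the exponent of the first to exceed \<open>1\<close>.
\<close>

lemma small_radius_exists:
  fixes D \<eta> :: real
  assumes \<eta>: "\<eta> > 0" and "D > 0"
    and e: "pf1 + pg1 > 1" "pf2 + pg2 > 1" "pf1 + pg1' > 0" "pf1' + pg1 > 0" "pf2 + pg2' > 0" "pf2' + pg2 > 0"
  obtains r where "r > 0" "ham_size r cf1 pf1 cg1 pg1 \<le> \<eta>" "ham_size r cf2 pf2 cg2 pg2 \<le> \<eta>"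
    "ham_lip r cf1 pf1 cf1' pf1' cg1 pg1 cg1' pg1' \<le> \<eta>" "ham_lip r cf2 pf2 cf2' pf2' cg2 pg2 cg2' pg2' \<le> \<eta>"
    "D * ham_size r cf1 pf1 cg1 pg1 \<le> r / 4"
proof -
  have id: "((\<lambda>r. r) \<longlongrightarrow> 0) (at_right (0::real))" by (rule tendsto_ident_at)
  have ev: "\<forall>\<^sub>F r in at_right (0::real). r > 0" by (simp add: eventually_at_right_less)
  have pw: "((\<lambda>r. r powr s) \<longlongrightarrow> 0) (at_right (0::real))" if "s > 0" for s
    using ev by (intro tendsto_zero_powrI[OF id tendsto_const _ that]) (auto elim: eventually_mono)
  have size: "\<forall>\<^sub>F r in at_right 0. ham_size r cf pf cg pg < \<eta>" if "pf + pg > 0" for cf pf cg pg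
  proof -
    have "((\<lambda>r. cg * cf * r powr (pg + pf)) \<longlongrightarrow> 0) (at_right 0)"
      using that by (intro tendsto_mult_right_zero pw) simp
    from order_tendstoD(2)[OF this \<eta>] ev show ?thesis
      by eventually_elim (simp add: ham_size_def rpow_add)
  qed
  have lip: "\<forall>\<^sub>F r in at_right 0. ham_lip r cf pf cf' pf' cg pg cg' pg' < \<eta>"
    if "pf + pg' > 0" "pf' + pg > 0" for cf pf cf' pf' cg pg cg' pg'
  proof -
    have "((\<lambda>r. 2 * (cg' * cf * r powr (pg' + pf) + cg * cf' * r powr (pg + pf'))) \<longlongrightarrow> 0) (at_right 0)"
      using that by (intro tendsto_mult_right_zero tendsto_add_zero pw) auto
    from order_tendstoD(2)[OF this \<eta>] ev show ?thesis
      by eventually_elim (simp add: ham_lip_def rpow_add)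
  qed
  have lin: "\<forall>\<^sub>F r in at_right 0. D * ham_size r cf1 pf1 cg1 pg1 < r / 4"
  proof -
    have "((\<lambda>r. D * (cg1 * cf1) * r powr (pg1 + pf1 - 1)) \<longlongrightarrow> 0) (at_right 0)"
      using e by (intro tendsto_mult_right_zero pw) simp
    then have "\<forall>\<^sub>F r in at_right 0. D * (cg1 * cf1) * r powr (pg1 + pf1 - 1) < 1 / 4"
      by (rule order_tendstoD) simp
    with ev show ?thesis
    proof eventually_elim
      case (elim r)
      then have "r * (D * (cg1 * cf1) * r powr (pg1 + pf1 - 1)) < r * (1 / 4)"
        by (intro mult_strict_left_mono)
      then show ?case
        using elim by (simp add: ham_size_def rpow_add powr_diff field_simps)
    qed
  qed
  have "\<forall>\<^sub>F r in at_right 0. r > 0 \<and> ham_size r cf1 pf1 cg1 pg1 < \<eta> \<and> ham_size r cf2 pf2 cg2 pg2 < \<eta>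
    \<and> ham_lip r cf1 pf1 cf1' pf1' cg1 pg1 cg1' pg1' < \<eta> \<and> ham_lip r cf2 pf2 cf2' pf2' cg2 pg2 cg2' pg2' < \<eta>
    \<and> D * ham_size r cf1 pf1 cg1 pg1 < r / 4"
    using e by (intro eventually_conj ev size lip lin) auto
  from eventually_happens[OF this] that show thesis by force
qed

text \<open>
  Since \<open>\<epsilon>\<close> makes \<open>cG' \<Psi>2 (2 M) \<le> 1\<close>, the radius can be fixed with \<open>\<Lambda> = 1\<close> before the payoff is
  known.
\<close>

lemma solvable_small_payoff:
  fixes m0 :: "('d::finite) coeffs"
  assumes T: "T > 0" and \<alpha>: "0 \<le> \<alpha>" "\<alpha> < 1" and m0: "m0 \<in> PM 0"
    and f1: "ham_assumption T \<alpha> f1 cf1 pf1 cf1' pf1'" and f2: "ham_assumption T \<alpha> f2 cf2 pf2 cf2' pf2'"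
    and g1: "ham_assumption T \<alpha> g1 cg1 pg1 cg1' pg1'" and g2: "ham_assumption_vec T \<alpha> g2 cg2 pg2 cg2' pg2'"
    and e: "pf1 + pg1 > 1" "pf2 + pg2 > 1" "pf1 + pg1' > 0" "pf1' + pg1 > 0" "pf2 + pg2' > 0" "pf2' + pg2 > 0"
  shows "\<exists>\<epsilon>>0. \<forall>G cG cG'. payoff_assumption T \<alpha> G cG cG' \<Psi>1 \<Psi>2 \<and> cG + cG' < \<epsilon> \<longrightarrow>
    solvable_uniquely_in_ball T \<alpha> m0 f1 f2 g1 g2 G"
proof -
  let ?d = "CARD('d)"
  define M where "M = PM_norm 0 m0 + 1"
  have M1: "M \<ge> 1" using PM_norm_nonneg[OF m0] by (simp add: M_def)
  define Q where "Q = total_gain ?d \<alpha> M 1"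
  have Q: "Q > 0"
    unfolding Q_def using \<alpha> M1 by (intro total_gain_pos) (auto simp: Suc_le_eq)
  have dM: "?d * M > 0" using M1 by simp
  obtain r where r: "r > 0" "ham_size r cf1 pf1 cg1 pg1 \<le> 1 / (4 * Q)" "ham_size r cf2 pf2 cg2 pg2 \<le> 1 / (4 * Q)"
    "ham_lip r cf1 pf1 cf1' pf1' cg1 pg1 cg1' pg1' \<le> 1 / (4 * Q)" "ham_lip r cf2 pf2 cf2' pf2' cg2 pg2 cg2' pg2' \<le> 1 / (4 * Q)"
    "?d * M * ham_size r cf1 pf1 cg1 pg1 \<le> r / 4"
    by (rule small_radius_exists[OF _ dM e, of "1 / (4 * Q)"]) (use Q in simp)
  \<comment> \<open>absolute values, because without a payoff \<open>\<Psi>1\<close> and \<open>\<Psi>2\<close> are arbitrary functions\<close>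
  define \<epsilon> where "\<epsilon> = min (r / (4 * ?d * M * (\<bar>\<Psi>1 M\<bar> + 1))) (1 / (\<bar>\<Psi>2 (2 * M)\<bar> + 1))"
  show ?thesis
  proof (intro exI[of _ \<epsilon>] conjI allI impI; (elim conjE)?)
    show "\<epsilon> > 0" using r M1 by (simp add: \<epsilon>_def add_pos_nonneg add_nonneg_pos)
    fix G cG cG' assume G: "payoff_assumption T \<alpha> (G :: 'd coeffs \<Rightarrow> 'd coeffs) cG cG' \<Psi>1 \<Psi>2" and small: "cG + cG' < \<epsilon>"
    have c: "cG > 0" "cG' > 0" using G by (auto simp: payoff_assumption_def)
    show "solvable_uniquely_in_ball T \<alpha> m0 f1 f2 g1 g2 G"
    proof (rule solvable_if_small[OF T \<alpha> m0 r(1) M_def f1 f2 g1 g2 G, of 1 "1 / (4 * Q)"])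
      have "cG' \<le> 1 / (\<bar>\<Psi>2 (2 * M)\<bar> + 1)" using small c by (simp add: \<epsilon>_def)
      then have "cG' * (\<bar>\<Psi>2 (2 * M)\<bar> + 1) \<le> 1" by (simp add: field_simps)
      moreover have "cG' * \<Psi>2 (2 * M) \<le> cG' * (\<bar>\<Psi>2 (2 * M)\<bar> + 1)" using c by (intro mult_left_mono) auto
      ultimately show "cG' * \<Psi>2 (2 * M) \<le> 1" by linarith
      have "cG \<le> r / (4 * ?d * M * (\<bar>\<Psi>1 M\<bar> + 1))" using small c by (simp add: \<epsilon>_def)
      moreover have "4 * ?d * M * (\<bar>\<Psi>1 M\<bar> + 1) > 0" using M1 by (intro mult_pos_pos) auto
      ultimately have "cG * (4 * ?d * M * (\<bar>\<Psi>1 M\<bar> + 1)) \<le> r" by (simp add: pos_le_divide_eq)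
      moreover have "cG * (4 * ?d * M * \<Psi>1 M) \<le> cG * (4 * ?d * M * (\<bar>\<Psi>1 M\<bar> + 1))"
        using c M1 by (intro mult_left_mono) auto
      ultimately show "?d * (cG * M * \<Psi>1 M) \<le> r / 4" by (simp add: mult_ac)
      show "1 / (4 * Q) * total_gain ?d \<alpha> M 1 \<le> 1 / 4" using Q by (simp add: Q_def)
      show "?d * (ham_size r cf1 pf1 cg1 pg1 * M) \<le> r / 4" using r(6) by (simp add: mult_ac)
    qed (use r in auto)
  qed
qed

lemma ham_lip_le:
  assumes "cf > 0" "cf' > 0" "cg > 0" "cg' > 0" "cf' * cg + cf * cg' \<le> \<epsilon>" "rpow r pg' * rpow r pf \<le> Z" "rpow r pg * rpow r pf' \<le> Z"
  shows "ham_lip r cf pf cf' pf' cg pg cg' pg' \<le> 2 * \<epsilon> * Z"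
proof -
  have Z: "Z \<ge> 0" using assms(6) mult_nonneg_nonneg[OF rpow_nonneg rpow_nonneg] by (meson order_trans)
  have "cg' * cf * (rpow r pg' * rpow r pf) + cg * cf' * (rpow r pg * rpow r pf') \<le> cg' * cf * Z + cg * cf' * Z"
    using assms by (intro add_mono mult_left_mono) auto
  also have "\<dots> = (cf' * cg + cf * cg') * Z" by (simp add: algebra_simps)
  also have "\<dots> \<le> \<epsilon> * Z" using assms Z by (intro mult_right_mono)
  finally show ?thesis by (simp add: ham_lip_def)
qed

lemma ham_size_le:
  assumes "cf > 0" "cg > 0" "cf * cg \<le> \<epsilon>" "rpow r pg * rpow r pf \<le> Z"
  shows "ham_size r cf pf cg pg \<le> \<epsilon> * Z"
proof -
  have "ham_size r cf pf cg pg \<le> (cf * cg) * Z"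
    unfolding ham_size_def using assms by (subst mult.commute[of cg]) (intro mult_left_mono, auto)
  also have "\<dots> \<le> \<epsilon> * Z"
    using assms mult_nonneg_nonneg[OF rpow_nonneg rpow_nonneg] by (intro mult_right_mono) (meson order_trans)+
  finally show ?thesis .
qed

text \<open>
  Here the payoff is given, so \<open>r\<close> and \<open>\<Lambda>\<close> are fixed first. The exponents then enter only through
  the finitely many powers of \<open>r\<close> bounded by \<open>Z\<close>.
\<close>

lemma solvable_small_hamiltonian:
  fixes m0 :: "('d::finite) coeffs"
  assumes T: "T > 0" and \<alpha>: "0 \<le> \<alpha>" "\<alpha> < 1" and m0: "m0 \<in> PM 0"
    and G: "payoff_assumption T \<alpha> G cG cG' \<Psi>1 \<Psi>2"
  shows "\<exists>\<epsilon>>0. \<forall>(f1 :: real ^ 'd \<Rightarrow> real) (f2 :: real ^ 'd \<Rightarrow> real) (g1 :: real ^ 'd \<Rightarrow> real)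
      (g2 :: real ^ 'd \<Rightarrow> real ^ 'd) cf1 cf1' cf2 cf2' cg1 cg1' cg2 cg2'.
      ham_assumption T \<alpha> f1 cf1 pf1 cf1' pf1' \<and>
      ham_assumption T \<alpha> f2 cf2 pf2 cf2' pf2' \<and>
      ham_assumption T \<alpha> g1 cg1 pg1 cg1' pg1' \<and>
      ham_assumption_vec T \<alpha> g2 cg2 pg2 cg2' pg2' \<and>
      cf1 * cg1 + cf2 * cg2 + cf1' * cg1 + cf1 * cg1' + cf2 * cg2' + cf2' * cg2 < \<epsilon> \<longrightarrow>
      solvable_uniquely_in_ball T \<alpha> m0 f1 f2 g1 g2 G"
proof -
  let ?d = "CARD('d)"
  define M where "M = PM_norm 0 m0 + 1"
  have M1: "M \<ge> 1" using PM_norm_nonneg[OF m0] by (simp add: M_def)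
  have c: "cG > 0" "cG' > 0" "\<Psi>1 M \<ge> 0" "\<Psi>2 (2 * M) \<ge> 0"
    using G M1 by (auto simp: payoff_assumption_def image_subset_iff)
  define \<Lambda> where "\<Lambda> = cG' * \<Psi>2 (2 * M)"
  have \<Lambda>: "\<Lambda> \<ge> 0" using c by (simp add: \<Lambda>_def)
  define r where "r = 4 * (?d * (cG * M * \<Psi>1 M) + 1)"
  have r: "r \<ge> 4" using c M1 by (simp add: r_def)
  define Q where "Q = total_gain ?d \<alpha> M \<Lambda>"
  have Q: "Q > 0" "?d * M \<le> Q"
    unfolding Q_def using \<alpha> M1 \<Lambda> by (auto intro!: total_gain_pos simp: Suc_le_eq)
  let ?p = "\<lambda>p q. rpow r p * rpow r q"
  define Z where "Z = 1 + (?p pg1 pf1 + ?p pg2 pf2 + ?p pg1' pf1 + ?p pg1 pf1' + ?p pg2' pf2 + ?p pg2 pf2')"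
  have p: "?p a b \<ge> 0" for a b by (intro mult_nonneg_nonneg rpow_nonneg)
  have Z: "Z \<ge> 1" "?p pg1 pf1 \<le> Z" "?p pg2 pf2 \<le> Z" "?p pg1' pf1 \<le> Z" "?p pg1 pf1' \<le> Z" "?p pg2' pf2 \<le> Z" "?p pg2 pf2' \<le> Z"
    using p[of pg1 pf1] p[of pg2 pf2] p[of pg1' pf1] p[of pg1 pf1'] p[of pg2' pf2] p[of pg2 pf2'] unfolding Z_def by linarith+
  define \<epsilon> where "\<epsilon> = 1 / (4 * Q) / (2 * Z)"
  have eq: "2 * \<epsilon> * Z = 1 / (4 * Q)" using Z by (simp add: \<epsilon>_def)
  show ?thesis
  proof (intro exI[of _ \<epsilon>] conjI allI impI; (elim conjE)?)
    show \<epsilon>: "\<epsilon> > 0" using Q Z by (simp add: \<epsilon>_def)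
    fix f1 f2 g1 :: "real ^ 'd \<Rightarrow> real" and g2 :: "real ^ 'd \<Rightarrow> real ^ 'd" and cf1 cf1' cf2 cf2' cg1 cg1' cg2 cg2'
    assume H: "ham_assumption T \<alpha> f1 cf1 pf1 cf1' pf1'" "ham_assumption T \<alpha> f2 cf2 pf2 cf2' pf2'"
      "ham_assumption T \<alpha> g1 cg1 pg1 cg1' pg1'" "ham_assumption_vec T \<alpha> g2 cg2 pg2 cg2' pg2'"
      and small: "cf1 * cg1 + cf2 * cg2 + cf1' * cg1 + cf1 * cg1' + cf2 * cg2' + cf2' * cg2 < \<epsilon>"
    have pos: "cf1 > 0" "cf1' > 0" "cf2 > 0" "cf2' > 0" "cg1 > 0" "cg1' > 0" "cg2 > 0" "cg2' > 0"
      using H by (auto simp: ham_assumption_def ham_assumption_vec_def ham_bounds_def ham_bounds_vec_def)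
    then have "cf1 * cg1 > 0" "cf2 * cg2 > 0" "cf1' * cg1 > 0" "cf1 * cg1' > 0" "cf2 * cg2' > 0" "cf2' * cg2 > 0"
      by simp_all
    with small have le: "cf1 * cg1 \<le> \<epsilon>" "cf2 * cg2 \<le> \<epsilon>" "cf1' * cg1 + cf1 * cg1' \<le> \<epsilon>" "cf2' * cg2 + cf2 * cg2' \<le> \<epsilon>"
      by linarith+
    have half: "\<epsilon> * Z \<le> 1 / (4 * Q)" using eq \<epsilon> Z Q by (simp add: field_simps)
    have A: "ham_size r cf1 pf1 cg1 pg1 \<le> 1 / (4 * Q)" "ham_size r cf2 pf2 cg2 pg2 \<le> 1 / (4 * Q)"
      using ham_size_le[OF pos(1,5) le(1) Z(2)] ham_size_le[OF pos(3,7) le(2) Z(3)] half by linarith+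
    have L: "ham_lip r cf1 pf1 cf1' pf1' cg1 pg1 cg1' pg1' \<le> 1 / (4 * Q)"
      "ham_lip r cf2 pf2 cf2' pf2' cg2 pg2 cg2' pg2' \<le> 1 / (4 * Q)"
      using ham_lip_le[OF pos(1,2,5,6) le(3) Z(4,5)] ham_lip_le[OF pos(3,4,7,8) le(4) Z(6,7)] eq by linarith+
    show "solvable_uniquely_in_ball T \<alpha> m0 f1 f2 g1 g2 G"
    proof (rule solvable_if_small[OF T \<alpha> m0 _ M_def H G \<Lambda> _ _ A L])
      show "r > 0" using r by simp
      show "cG' * \<Psi>2 (2 * M) \<le> \<Lambda>" by (simp add: \<Lambda>_def)
      show "?d * (cG * M * \<Psi>1 M) \<le> r / 4" by (simp add: r_def)
      show "1 / (4 * Q) * total_gain ?d \<alpha> M \<Lambda> \<le> 1 / 4" using Q by (simp add: Q_def)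
      have "(?d * M) * ham_size r cf1 pf1 cg1 pg1 \<le> (?d * M) * (1 / (4 * Q))"
        using M1 by (intro mult_left_mono A) auto
      also have "\<dots> \<le> Q * (1 / (4 * Q))"
        using Q by (intro mult_right_mono) auto
      also have "\<dots> \<le> r / 4" using Q r by simp
      finally show "?d * (ham_size r cf1 pf1 cg1 pg1 * M) \<le> r / 4" by (simp add: mult_ac)
    qed
  qed
qed

theorem theorem1:
  fixes T \<alpha> :: real and m0 :: "('d::finite) coeffs"
  assumes "T > 0" and "0 \<le> \<alpha>" and "\<alpha> < 1" and "m0 \<in> PM 0"
  shows
    "(\<forall>(f1 :: real ^ 'd \<Rightarrow> real) (f2 :: real ^ 'd \<Rightarrow> real) (g1 :: real ^ 'd \<Rightarrow> real)
       (g2 :: real ^ 'd \<Rightarrow> real ^ 'd)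
       cf1 pf1 cf1' pf1' cf2 pf2 cf2' pf2' cg1 pg1 cg1' pg1' cg2 pg2 cg2' pg2' \<Psi>1 \<Psi>2.
       ham_assumption T \<alpha> f1 cf1 pf1 cf1' pf1' \<and>
       ham_assumption T \<alpha> f2 cf2 pf2 cf2' pf2' \<and>
       ham_assumption T \<alpha> g1 cg1 pg1 cg1' pg1' \<and>
       ham_assumption_vec T \<alpha> g2 cg2 pg2 cg2' pg2' \<and>
       pf1 + pg1 > 1 \<and> pf2 + pg2 > 1 \<and>
       pf1 + pg1' > 0 \<and> pf1' + pg1 > 0 \<and> pf2 + pg2' > 0 \<and> pf2' + pg2 > 0 \<longrightarrow>
       (\<exists>\<epsilon>>0. \<forall>G cG cG'.
          payoff_assumption T \<alpha> G cG cG' \<Psi>1 \<Psi>2 \<and> cG + cG' < \<epsilon> \<longrightarrow>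
          solvable_uniquely_in_ball T \<alpha> m0 f1 f2 g1 g2 G))
     \<and>
     (\<forall>G cG cG' \<Psi>1 \<Psi>2 pf1 pf1' pf2 pf2' pg1 pg1' pg2 pg2'.
       payoff_assumption T \<alpha> G cG cG' \<Psi>1 \<Psi>2 \<longrightarrow>
       (\<exists>\<epsilon>>0. \<forall>(f1 :: real ^ 'd \<Rightarrow> real) (f2 :: real ^ 'd \<Rightarrow> real) (g1 :: real ^ 'd \<Rightarrow> real)
          (g2 :: real ^ 'd \<Rightarrow> real ^ 'd) cf1 cf1' cf2 cf2' cg1 cg1' cg2 cg2'.
          ham_assumption T \<alpha> f1 cf1 pf1 cf1' pf1' \<and>
          ham_assumption T \<alpha> f2 cf2 pf2 cf2' pf2' \<and>
          ham_assumption T \<alpha> g1 cg1 pg1 cg1' pg1' \<and>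
          ham_assumption_vec T \<alpha> g2 cg2 pg2 cg2' pg2' \<and>
          cf1 * cg1 + cf2 * cg2 + cf1' * cg1 + cf1 * cg1' + cf2 * cg2' + cf2' * cg2 < \<epsilon> \<longrightarrow>
          solvable_uniquely_in_ball T \<alpha> m0 f1 f2 g1 g2 G))"
  by (intro conjI allI impI; (elim conjE)?)
     (rule solvable_small_payoff[OF assms] solvable_small_hamiltonian[OF assms]; assumption)+

end
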